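(* Let $G_1$ be the Hahn product of copies of $\mathbb{Z}$ indexed by $\omega$, i.e. the group $\mathbb{Z}^{\omega}$ of all sequences of integers with the lexicographic ordering. Then the ordered abelian group $G_1$ is stably embedded, and up to isomorphism it is the unique model of its own (complete) theory which is stably embedded.
   Context: Ordered abelian groups are structures in the language $\{0,+,-,<\}$. A structure $\mathcal M$ is stably embedded if for every elementary extension $\mathcal N\succcurlyeq\mathcal M$, every $m$ and every $D\subseteq N^m$ definable with parameters from $N$, the trace $D\cap M^m$ is definable in $\mathcal M$ with parameters from $M$ (equivalently, all $n$-types over $M$, for all $n$, are definable). The lexicographic ordering on $\mathbb{Z}^\omega$ is given by $f>0$ iff $f\neq0$ and $f(i)>0$ for the least $i$ with $f(i)\neq0$. *)

theory Defs
  imports Main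
begin

section \<open>First-order logic in the language of ordered abelian groups\<close>

datatype oag_term =
    Var nat
  | ZeroT
  | PlusT oag_term oag_term
  | MinusT oag_term

datatype oag_fm =
    EqF oag_term oag_term
  | LessF oag_term oag_term
  | NotF oag_fm
  | AndF oag_fm oag_fm
  | ExF nat oag_fm

fun term_vars :: "oag_term \<Rightarrow> nat set" where
  "term_vars (Var i) = {i}"
| "term_vars ZeroT = {}"
| "term_vars (PlusT t u) = term_vars t \<union> term_vars u"
| "term_vars (MinusT t) = term_vars t"

fun free_vars :: "oag_fm \<Rightarrow> nat set" where
  "free_vars (EqF t u) = term_vars t \<union> term_vars u"
| "free_vars (LessF t u) = term_vars t \<union> term_vars u"
| "free_vars (NotF \<phi>) = free_vars \<phi>"
| "free_vars (AndF \<phi> \<psi>) = free_vars \<phi> \<union> free_vars \<psi>"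
| "free_vars (ExF i \<phi>) = free_vars \<phi> - {i}"

definition sentence :: "oag_fm \<Rightarrow> bool" where
  "sentence \<phi> \<longleftrightarrow> free_vars \<phi> = {}"

record 'a oag_struct =
  Univ :: "'a set"
  zeroS :: 'a
  plusS :: "'a \<Rightarrow> 'a \<Rightarrow> 'a"
  minusS :: "'a \<Rightarrow> 'a"
  lessS :: "'a \<Rightarrow> 'a \<Rightarrow> bool"

text \<open>An arbitrary structure for the language; no group or order axioms are imposed, since these
  are first-order and hence part of the theory of any ordered abelian group.
  The universe is nonempty because it contains the interpretation of zero.\<close>

definition is_structure :: "'a oag_struct \<Rightarrow> bool" where
  "is_structure M \<longleftrightarrow>
     zeroS M \<in> Univ M \<and>
     (\<forall>x\<in>Univ M. \<forall>y\<in>Univ M. plusS M x y \<in> Univ M) \<and>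
     (\<forall>x\<in>Univ M. minusS M x \<in> Univ M)"

fun val :: "'a oag_struct \<Rightarrow> (nat \<Rightarrow> 'a) \<Rightarrow> oag_term \<Rightarrow> 'a" where
  "val M s (Var i) = s i"
| "val M s ZeroT = zeroS M"
| "val M s (PlusT t u) = plusS M (val M s t) (val M s u)"
| "val M s (MinusT t) = minusS M (val M s t)"

fun sat :: "'a oag_struct \<Rightarrow> (nat \<Rightarrow> 'a) \<Rightarrow> oag_fm \<Rightarrow> bool" where
  "sat M s (EqF t u) \<longleftrightarrow> val M s t = val M s u"
| "sat M s (LessF t u) \<longleftrightarrow> lessS M (val M s t) (val M s u)"
| "sat M s (NotF \<phi>) \<longleftrightarrow> \<not> sat M s \<phi>"
| "sat M s (AndF \<phi> \<psi>) \<longleftrightarrow> sat M s \<phi> \<and> sat M s \<psi>"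
| "sat M s (ExF i \<phi>) \<longleftrightarrow> (\<exists>x\<in>Univ M. sat M (s(i := x)) \<phi>)"

definition holds :: "'a oag_struct \<Rightarrow> oag_fm \<Rightarrow> bool" where
  "holds M \<phi> \<longleftrightarrow> (\<forall>s. range s \<subseteq> Univ M \<longrightarrow> sat M s \<phi>)"

definition Th :: "'a oag_struct \<Rightarrow> oag_fm set" where
  "Th M = {\<phi>. sentence \<phi> \<and> holds M \<phi>}"

definition is_model :: "'a oag_struct \<Rightarrow> oag_fm set \<Rightarrow> bool" where
  "is_model M T \<longleftrightarrow> is_structure M \<and> (\<forall>\<phi>\<in>T. holds M \<phi>)"

definition is_isomorphism :: "'a oag_struct \<Rightarrow> 'b oag_struct \<Rightarrow> ('a \<Rightarrow> 'b) \<Rightarrow> bool" where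
  "is_isomorphism M N h \<longleftrightarrow>
     bij_betw h (Univ M) (Univ N) \<and>
     h (zeroS M) = zeroS N \<and>
     (\<forall>x\<in>Univ M. \<forall>y\<in>Univ M. h (plusS M x y) = plusS N (h x) (h y)) \<and>
     (\<forall>x\<in>Univ M. h (minusS M x) = minusS N (h x)) \<and>
     (\<forall>x\<in>Univ M. \<forall>y\<in>Univ M. lessS M x y \<longleftrightarrow> lessS N (h x) (h y))"

definition isomorphic :: "'a oag_struct \<Rightarrow> 'b oag_struct \<Rightarrow> bool" where
  "isomorphic M N \<longleftrightarrow> (\<exists>h. is_isomorphism M N h)"


section \<open>Definable sets and stable embeddedness\<close>

definition tuples :: "'a oag_struct \<Rightarrow> nat \<Rightarrow> 'a list set" where
  "tuples M m = {xs. length xs = m \<and> set xs \<subseteq> Univ M}"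

text \<open>The variables with index below \<open>m\<close> are the coordinates of the tuple; the others are assigned
  the parameters \<open>b\<close>, of which a formula uses only finitely many.\<close>

definition definable :: "'a oag_struct \<Rightarrow> nat \<Rightarrow> 'a list set \<Rightarrow> bool" where
  "definable M m D \<longleftrightarrow>
     (\<exists>\<phi> b. range b \<subseteq> Univ M \<and>
        D = {xs \<in> tuples M m. sat M (\<lambda>i. if i < m then xs ! i else b i) \<phi>})"

text \<open>An elementary extension of \<open>M\<close> is a structure \<open>N\<close>, possibly over another type, together with
  an elementary embedding of \<open>M\<close> into \<open>N\<close>, along which \<open>M\<close> is identified with its image.\<close>

definition elementary_embedding ::
    "'a oag_struct \<Rightarrow> 'b oag_struct \<Rightarrow> ('a \<Rightarrow> 'b) \<Rightarrow> bool" where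
  "elementary_embedding M N e \<longleftrightarrow>
     e ` Univ M \<subseteq> Univ N \<and>
     (\<forall>\<phi> s. range s \<subseteq> Univ M \<longrightarrow> (sat M s \<phi> \<longleftrightarrow> sat N (e \<circ> s) \<phi>))"

text \<open>HOL cannot quantify over types inside a formula, so the type \<open>'b\<close> over which the elementary
  extensions range is an explicit argument. In a conclusion \<open>'b\<close> should be a free type variable,
  which yields all elementary extensions whatsoever. In a hypothesis one fixed type makes the
  assumption formally weaker; by downward Loewenheim-Skolem it is equivalent to the unrestricted
  one as soon as \<open>'b\<close> is infinite and of cardinality at least that of \<open>M\<close>: if \<open>D\<close> is definable
  in \<open>N\<close> with parameters \<open>b\<close>, its trace is already cut out in an elementary substructure of \<open>N\<close>
  that contains \<open>M\<close> and \<open>b\<close> and has cardinality at most \<open>|M| + \<aleph>\<^sub>0\<close>.\<close>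

definition stably_embedded :: "'b itself \<Rightarrow> 'a oag_struct \<Rightarrow> bool" where
  "stably_embedded _ M \<longleftrightarrow>
     (\<forall>(N :: 'b oag_struct) e m D.
        is_structure N \<longrightarrow> elementary_embedding M N e \<longrightarrow> definable N m D \<longrightarrow>
        definable M m {xs \<in> tuples M m. map e xs \<in> D})"


section \<open>The Hahn product of copies of the integers indexed by the natural numbers\<close>

definition lex_pos :: "(nat \<Rightarrow> int) \<Rightarrow> bool" where
  "lex_pos f \<longleftrightarrow> f \<noteq> (\<lambda>_. 0) \<and> f (LEAST i. f i \<noteq> 0) > 0"

definition G1 :: "(nat \<Rightarrow> int) oag_struct" where
  "G1 = \<lparr> Univ = UNIV,
          zeroS = (\<lambda>_. 0),
          plusS = (\<lambda>f g i. f i + g i),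
          minusS = (\<lambda>f i. - f i),
          lessS = (\<lambda>f g. lex_pos (\<lambda>i. g i - f i)) \<rparr>"

end

theory Submission
  imports Defs "HOL-Library.Extended_Nat" "HOL-Computational_Algebra.Primes"
begin

text \<open>Write \<open>v\<^sub>m x\<close> for the first position at which the sequence \<open>x\<close> is not divisible by \<open>m\<close>; for
  \<open>m = 0\<close> this is the valuation of the Hahn product. A back-and-forth argument shows that the truth
  of a formula at a tuple of \<open>\<int>\<^sup>\<omega>\<close> depends only on finitely many comparisons \<open>v\<^sub>m t + e \<le> v\<^sub>n t'\<close>
  between integer combinations of the tuple, together with the digits at these positions modulo
  \<open>m\<close>, or up to truncation when \<open>m = 0\<close>. If \<open>D\<close> is definable in an elementary extension, then every
  finite part of its trace is cut out by parameters \<open>b\<close> from \<open>\<int>\<^sup>\<omega>\<close>. Along an ultrafilter the digits of an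
  integer combination of the \<open>b\<close> converge modulo \<open>m\<close>, or converge outright up to a position where they
  become infinite. So all comparisons between combinations of \<open>x\<close> and \<open>b\<close> are in the limit comparisons
  between \<open>x\<close> and finitely many limit sequences, and the trace is definable.

  Conversely, let \<open>H\<close> be a stably embedded model. Traces of definable sets of an ultrapower over \<open>\<nat>\<close>
  are definable in \<open>H\<close>, hence inherit the first-order consequences of well-ordering, of the
  archimedean property of each digit, and of completeness. They imply in turn that the value set of
  \<open>H\<close> is \<open>\<omega>\<close>, that its digits are standard integers, and that all digit sequences occur.\<close>

section \<open>Valuations modulo \<open>m\<close> on integer sequences\<close>

text \<open>A single formula sees positions and digits only up to a bound. Positions form a copy of
  \<open>\<omega>\<close>, so the data must record distances and not just the order of valuations;
  each inserted position doubles the bound, which is why every extension step starts from a larger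
  \<open>B'\<close>. Digits behave as in Presburger arithmetic, with residues for small moduli and
  truncated values. A new element occurs with several coefficients and cannot be divided;
  multiplying by a factorial leaves a single coefficient, and the congruence modulo that factorial,
  itself part of the data, permits the division at the end. In the limit argument convergence fails
  only where a digit at modulus \<open>0\<close> runs off to infinity. The position of this failure
  is a fixed number, and comparisons with fixed numbers are part of the data. For the converse,
  three second-order properties hold in \<open>G1\<close> for arbitrary sets, hence in every model
  for definable ones. Stable embeddedness makes sets defined by reference to the standard positions,
  multiples and partial sums definable, so that these schemes apply to them.\<close>

definition mval :: "nat \<Rightarrow> (nat \<Rightarrow> int) \<Rightarrow> enat" where
  "mval m x = (if \<forall>i. int m dvd x i then \<infinity> else enat (LEAST i. \<not> int m dvd x i))"

text \<open>Where \<open>mval m x = \<infinity>\<close> the index read is unspecified but the same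
  for all such \<open>x\<close>, so equal values of \<open>mval\<close> always mean that the same
  index is read.\<close>

definition lead :: "nat \<Rightarrow> (nat \<Rightarrow> int) \<Rightarrow> int" where
  "lead m x = x (the_enat (mval m x))"

lemma mval_eq_infinity_iff: "mval m x = \<infinity> \<longleftrightarrow> (\<forall>i. int m dvd x i)"
  by (simp add: mval_def)

lemma mval_eq_enat_iff:
  "mval m x = enat i \<longleftrightarrow> (\<forall>j<i. int m dvd x j) \<and> \<not> int m dvd x i"
proof
  assume "mval m x = enat i"
  then have *: "\<exists>i. \<not> int m dvd x i" and i: "i = (LEAST i. \<not> int m dvd x i)"
    by (auto simp: mval_def split: if_splits)
  show "(\<forall>j<i. int m dvd x j) \<and> \<not> int m dvd x i"
    using LeastI_ex[OF *] not_less_Least[of _ "\<lambda>i. \<not> int m dvd x i"] unfolding i by blast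
next
  assume "(\<forall>j<i. int m dvd x j) \<and> \<not> int m dvd x i"
  then have "(LEAST i. \<not> int m dvd x i) = i"
    by (intro Least_equality) (auto simp: not_le[symmetric])
  with \<open>_ \<and> _\<close> show "mval m x = enat i" by (auto simp: mval_def)
qed

lemma enat_le_mval_iff: "enat d \<le> mval m x \<longleftrightarrow> (\<forall>i<d. int m dvd x i)"
proof (cases "mval m x")
  case (enat i)
  then show ?thesis using mval_eq_enat_iff[of m x i] by (auto intro: ccontr)
next
  case infinity
  then show ?thesis using mval_eq_infinity_iff[of m x] by auto
qed

lemma enat_less_mval_iff: "enat d < mval m x \<longleftrightarrow> (\<forall>i\<le>d. int m dvd x i)"
  using enat_le_mval_iff[of "Suc d" m x] by (simp add: Suc_ile_eq less_Suc_eq_le)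

lemma mval_dvd: "enat i < mval m x \<Longrightarrow> int m dvd x i"
  by (simp add: enat_less_mval_iff)

lemma lead_eq: "mval m x = enat i \<Longrightarrow> lead m x = x i"
  by (simp add: lead_def)

lemma le_mvalI: "(\<And>i. enat i < e \<Longrightarrow> int m dvd x i) \<Longrightarrow> e \<le> mval m x"
  by (cases e) (auto simp: enat_le_mval_iff mval_eq_infinity_iff)

lemma mval_cong: "(\<And>i. int m dvd x i - y i) \<Longrightarrow> mval m x = mval m y"
proof -
  assume *: "\<And>i. int m dvd x i - y i"
  have "int m dvd x i \<longleftrightarrow> int m dvd y i" for i
    using *[of i] by (metis dvd_diff_commute dvd_diff_right_iff)
  then show ?thesis by (simp add: mval_def)
qed

text \<open>Up to the position of \<open>x\<close> all entries of \<open>y\<close> are divisible by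
  \<open>m\<close>, so adding \<open>y\<close> disturbs neither that position nor the digit modulo
  \<open>m\<close>.\<close>

lemma mval_diff_less:
  assumes "mval m x < mval m y"
  shows "mval m (\<lambda>k. x k + y k) = mval m x" "int m dvd lead m (\<lambda>k. x k + y k) - lead m x"
proof -
  obtain i where i: "mval m x = enat i" using assms by (cases "mval m x") auto
  then have y: "int m dvd y j" if "j \<le> i" for j
    using assms enat_less_mval_iff[of i m y] that by simp
  have "mval m (\<lambda>k. x k + y k) = enat i"
    using i y by (auto simp: mval_eq_enat_iff dvd_add_left_iff)
  then show "mval m (\<lambda>k. x k + y k) = mval m x" "int m dvd lead m (\<lambda>k. x k + y k) - lead m x"
    using i y by (auto simp: lead_eq)
qed

text \<open>Multiplying sequence and modulus by the same \<open>q\<close> preserves divisibility.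
  This allows the coefficient of a new element to be replaced by a prescribed multiple of
  it.\<close>

lemma mval_scale:
  assumes "q > 0" "\<bar>\<sigma>\<bar> = 1"
  shows "mval (q * m) (\<lambda>k. \<sigma> * int q * x k) = mval m x"
proof -
  have "int (q * m) dvd \<sigma> * int q * x k \<longleftrightarrow> int m dvd x k" for k
  proof -
    have "int (q * m) dvd \<sigma> * int q * x k \<longleftrightarrow> int q * int m dvd int q * (\<sigma> * x k)"
      by (simp add: mult_ac)
    also have "\<dots> \<longleftrightarrow> int m dvd \<sigma> * x k" using assms by simp
    also have "\<dots> \<longleftrightarrow> int m dvd x k"
      using assms by (cases "\<sigma> \<ge> 0") (auto simp: abs_if split: if_splits)
    finally show ?thesis .
  qed
  then show ?thesis by (simp add: mval_def)
qed

section \<open>Integer combinations of tuples\<close>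

definition lin :: "nat \<Rightarrow> (nat \<Rightarrow> int) \<Rightarrow> (nat \<Rightarrow> nat \<Rightarrow> int) \<Rightarrow> nat \<Rightarrow> int" where
  "lin n z s = (\<lambda>k. \<Sum>i<n. z i * s i k)"

text \<open>Coefficient vectors are functions on all of \<open>nat\<close>; vanishing from
  \<open>n\<close> on makes the set finite.\<close>

definition coefs :: "nat \<Rightarrow> nat \<Rightarrow> (nat \<Rightarrow> int) set" where
  "coefs n B = {z. \<forall>i. \<bar>z i\<bar> \<le> int B \<and> (i \<ge> n \<longrightarrow> z i = 0)}"

lemma finite_coefs: "finite (coefs n B)"
proof -
  have "coefs n B \<subseteq> {f. \<forall>x. (x \<in> {..<n} \<longrightarrow> f x \<in> {- int B..int B}) \<and> (x \<notin> {..<n} \<longrightarrow> f x = 0)}"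
    by (auto simp: coefs_def abs_le_iff) (metis minus_le_iff)
  then show ?thesis
    by (rule finite_subset) (intro finite_set_of_finite_funs; simp)
qed

lemma coefs_mono: "B \<le> B' \<Longrightarrow> coefs n B \<subseteq> coefs n B'"
  unfolding coefs_def by (auto intro: order_trans)

lemma zero_in_coefs: "(\<lambda>_. 0) \<in> coefs n B"
  by (simp add: coefs_def)

lemma coefs_diff: "z \<in> coefs n B \<Longrightarrow> w \<in> coefs n B' \<Longrightarrow> (\<lambda>i. z i - w i) \<in> coefs n (B + B')"
  unfolding coefs_def mem_Collect_eq by (smt (verit) of_nat_add)

lemma coefs_scale:
  assumes "z \<in> coefs n B" "\<bar>a\<bar> \<le> int A" shows "(\<lambda>i. a * z i) \<in> coefs n (A * B)"
  using assms by (auto simp: coefs_def abs_mult intro!: mult_mono)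

lemma coefs_upd0: "z \<in> coefs n B \<Longrightarrow> z(i := 0) \<in> coefs n B"
  by (auto simp: coefs_def)

lemma lin_diff: "lin n (\<lambda>i. z i - w i) s k = lin n z s k - lin n w s k"
  by (simp add: lin_def sum_subtractf left_diff_distrib)

lemma lin_scale: "lin n (\<lambda>i. a * z i) s k = a * lin n z s k"
  by (simp add: lin_def sum_distrib_left mult_ac)

lemma lin_zero: "lin n (\<lambda>_. 0) s = (\<lambda>_. 0)"
  by (simp add: lin_def)

lemma lin_upd:
  assumes "i < n"
  shows "lin n z (s(i := c)) k = lin n (z(i := 0)) s k + z i * c k"
proof -
  have fi: "finite {..<n}" "i \<in> {..<n}" using assms by auto
  show ?thesis unfolding lin_def sum.remove[OF fi] by (auto intro!: sum.cong)
qed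

section \<open>Approximate isomorphism data\<close>

text \<open>At modulus \<open>0\<close> digits are integers, of which a formula sees the exact value only if it is small,
  and otherwise the sign.\<close>

definition clip :: "nat \<Rightarrow> int \<Rightarrow> int" where
  "clip B a = max (- (int B + 1)) (min (int B + 1) a)"

definition dig_eq :: "nat \<Rightarrow> nat \<Rightarrow> int \<Rightarrow> int \<Rightarrow> bool" where
  "dig_eq B m a b \<longleftrightarrow> (if m = 0 then clip B a = clip B b else int m dvd a - b)"

text \<open>One bound \<open>B\<close> serves for coefficients, moduli, shifts, fixed positions and
  the truncation of digits. The second clause amounts to distances from position \<open>0\<close>.
  Leading digits are guarded on one side only: for \<open>B \<ge> 1\<close> the first clause with
  \<open>e = 1\<close> and equal arguments already says that either both valuations are infinite or
  neither is.\<close>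

definition data_eq :: "nat \<Rightarrow> nat \<Rightarrow> (nat \<Rightarrow> nat \<Rightarrow> int) \<Rightarrow> (nat \<Rightarrow> nat \<Rightarrow> int) \<Rightarrow> bool" where
  "data_eq n B s s' \<longleftrightarrow>
     (\<forall>z\<in>coefs n B. \<forall>z'\<in>coefs n B. \<forall>m\<le>B. \<forall>m'\<le>B. \<forall>e\<le>B.
        mval m (lin n z s) + enat e \<le> mval m' (lin n z' s) \<longleftrightarrow>
        mval m (lin n z s') + enat e \<le> mval m' (lin n z' s')) \<and>
     (\<forall>z\<in>coefs n B. \<forall>m\<le>B. \<forall>d\<le>B.
        enat d \<le> mval m (lin n z s) \<longleftrightarrow> enat d \<le> mval m (lin n z s')) \<and>
     (\<forall>z\<in>coefs n B. \<forall>m\<le>B. mval m (lin n z s) \<noteq> \<infinity> \<longrightarrow>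
        dig_eq B m (lead m (lin n z s)) (lead m (lin n z s')))"

lemma clip_eq_iff:
  "clip B a = clip B b \<longleftrightarrow> a = b \<or> (a > int B \<and> b > int B) \<or> (a < - int B \<and> b < - int B)"
  unfolding clip_def by linarith

lemma clip_eq_mono: "clip B' a = clip B' b \<Longrightarrow> B \<le> B' \<Longrightarrow> clip B a = clip B b"
  unfolding clip_eq_iff by linarith

lemma dig_eq_mono: "dig_eq B' m a b \<Longrightarrow> B \<le> B' \<Longrightarrow> dig_eq B m a b"
  by (auto simp: dig_eq_def intro: clip_eq_mono)

lemma dig_eq_0: "dig_eq B m a b \<Longrightarrow> int m dvd a \<longleftrightarrow> int m dvd b"
  unfolding dig_eq_def clip_eq_iff
  by (cases "m = 0") (auto, (metis dvd_diff_right_iff dvd_diff_commute)+)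

lemma clip_scale_imp:
  assumes "clip B1 (\<sigma> * int q * a) = clip B1 (\<sigma> * int q * b)" "\<bar>\<sigma>\<bar> = 1" "q > 0" "q * B \<le> B1"
  shows "clip B a = clip B b"
proof -
  have \<sigma>: "\<sigma> = 1 \<or> \<sigma> = - 1" using assms(2) by linarith
  have le: "int q * int B \<le> int B1" using assms(4) by (metis of_nat_le_iff of_nat_mult)
  have *: "int q * a = int q * b \<or> (int q * a > int B1 \<and> int q * b > int B1) \<or>
      (int q * a < - int B1 \<and> int q * b < - int B1)"
    using assms(1) \<sigma> unfolding clip_eq_iff by auto
  have pos: "x > int B" if "int q * x > int B1" for x
  proof (rule ccontr)
    assume "\<not> x > int B"
    then have "int q * x \<le> int q * int B" by (intro mult_left_mono) auto
    with that le show False by linarith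
  qed
  have neg: "x < - int B" if "int q * x < - int B1" for x
    using pos[of "- x"] that by auto
  show ?thesis using * pos neg assms(3) unfolding clip_eq_iff by auto
qed

text \<open>Scaling by \<open>q\<close> stretches the window of exactly visible digits, so the
  larger window \<open>B1\<close> for the scaled digits determines the window \<open>B\<close> for
  the original ones.\<close>

lemma dig_eq_scale_imp:
  assumes "dig_eq B1 (q * m) (\<sigma> * int q * a) (\<sigma> * int q * b)" "\<bar>\<sigma>\<bar> = 1" "q > 0" "q * B \<le> B1"
  shows "dig_eq B m a b"
proof (cases "m = 0")
  case True
  then show ?thesis using assms(1) clip_scale_imp[OF _ assms(2-4), of a b] by (simp add: dig_eq_def)
next
  case False
  have "int q * int m dvd int q * (\<sigma> * (a - b))"
    using assms False by (simp add: dig_eq_def algebra_simps)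
  then have "int m dvd \<sigma> * (a - b)" using assms(3) by simp
  then have "int m dvd a - b"
    using assms(2) by (cases "\<sigma> \<ge> 0") (auto simp: abs_if dvd_diff_commute split: if_splits)
  then show ?thesis using False by (simp add: dig_eq_def)
qed

section \<open>Extension lemmas for positions, digits and congruences\<close>

definition near :: "nat \<Rightarrow> 'i set \<Rightarrow> ('i \<Rightarrow> enat) \<Rightarrow> ('i \<Rightarrow> enat) \<Rightarrow> bool" where
  "near d I p p' \<longleftrightarrow>
     (\<forall>i\<in>I. \<forall>j\<in>I. \<forall>e\<le>d. p i + enat e \<le> p j \<longleftrightarrow> p' i + enat e \<le> p' j)"

lemma nearD: "near d I p p' \<Longrightarrow> i \<in> I \<Longrightarrow> j \<in> I \<Longrightarrow> e \<le> d \<Longrightarrow>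
    p i + enat e \<le> p j \<longleftrightarrow> p' i + enat e \<le> p' j"
  by (auto simp: near_def)

lemma near_le: "near d I p p' \<Longrightarrow> i \<in> I \<Longrightarrow> j \<in> I \<Longrightarrow> p i \<le> p j \<longleftrightarrow> p' i \<le> p' j"
  using nearD[of d I p p' i j 0] by (simp add: zero_enat_def[symmetric])

lemma near_less: "near d I p p' \<Longrightarrow> i \<in> I \<Longrightarrow> j \<in> I \<Longrightarrow> p i < p j \<longleftrightarrow> p' i < p' j"
  using near_le[of d I p p' j i] by (simp add: not_le[symmetric])

lemma near_eq: "near d I p p' \<Longrightarrow> i \<in> I \<Longrightarrow> j \<in> I \<Longrightarrow> p i = p j \<longleftrightarrow> p' i = p' j"
  using near_le[of d I p p' j i] near_le[of d I p p' i j] by (metis antisym order_refl)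

lemma near_infinity: "near d I p p' \<Longrightarrow> d \<ge> 1 \<Longrightarrow> i \<in> I \<Longrightarrow> p i = \<infinity> \<longleftrightarrow> p' i = \<infinity>"
  using nearD[of d I p p' i i 1] by (cases "p i"; cases "p' i") (auto)

text \<open>Comparing \<open>y\<close> with \<open>x + w\<close> means comparing \<open>y\<close>
  with \<open>x\<close> at the signed shift \<open>e - w\<close>. Over natural numbers a negative
  shift has to be turned around into a negated inequality, whence the \<open>+ 1\<close>.\<close>

lemma shift_iffs:
  fixes x w e y x' y' :: nat
  assumes "x + (w + e) \<le> y \<longleftrightarrow> x' + (w + e) \<le> y'" "y + (e - w) \<le> x \<longleftrightarrow> y' + (e - w) \<le> x'"
    "x + (w - e + 1) \<le> y \<longleftrightarrow> x' + (w - e + 1) \<le> y'"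
  shows "y + e \<le> x + w \<longleftrightarrow> y' + e \<le> x' + w" "x + w + e \<le> y \<longleftrightarrow> x' + w + e \<le> y'"
proof -
  show "y + e \<le> x + w \<longleftrightarrow> y' + e \<le> x' + w"
  proof (cases "e \<le> w")
    case True
    then obtain v where "w = e + v" using le_Suc_ex by blast
    then show ?thesis using assms(3) by auto
  next
    case False
    then obtain v where "e = w + v" using le_Suc_ex nat_le_linear by blast
    then show ?thesis using assms(2) by auto
  qed
  show "x + w + e \<le> y \<longleftrightarrow> x' + w + e \<le> y'" using assms(1) by (simp add: add.assoc)
qed

lemma shift_iffs':
  fixes x w e y x' y' :: nat
  assumes "y + (w + e) \<le> x + w \<longleftrightarrow> y' + (w + e) \<le> x' + w"
    "x + w + (e - w) \<le> y \<longleftrightarrow> x' + w + (e - w) \<le> y'"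
    "y + (w - e + 1) \<le> x + w \<longleftrightarrow> y' + (w - e + 1) \<le> x' + w"
  shows "y + e \<le> x \<longleftrightarrow> y' + e \<le> x'" "x + e \<le> y \<longleftrightarrow> x' + e \<le> y'"
proof -
  show "x + e \<le> y \<longleftrightarrow> x' + e \<le> y'"
  proof (cases "e \<le> w")
    case True
    then obtain v where "w = e + v" using le_Suc_ex by blast
    then show ?thesis using assms(3) by auto
  next
    case False
    then obtain v where "e = w + v" using le_Suc_ex nat_le_linear by blast
    then show ?thesis using assms(2) by auto
  qed
  show "y + e \<le> x \<longleftrightarrow> y' + e \<le> x'" using assms(1) by auto
qed

text \<open>A finite new position lies within \<open>d\<close> above the nearest known one below it,
  or within \<open>d\<close> below a known one, or further than \<open>d\<close> from both sides.
  The first two cases copy the distance. In the third the surrounding gap is at least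
  \<open>2 * d + 2\<close>, which leaves a point at distance at least \<open>d + 1\<close> from both
  ends. \<open>og\<close> at position \<open>0\<close> guarantees a known position below.\<close>

lemma near_extend1:
  assumes near: "near (2 * d + 2) I p p'" and "finite I" and og: "og \<in> I" "p og = 0" "p' og = 0"
  shows "\<exists>q'. (q = \<infinity> \<longleftrightarrow> q' = \<infinity>) \<and> (\<forall>i\<in>I. \<forall>e\<le>d. (p i + enat e \<le> q \<longleftrightarrow> p' i + enat e \<le> q') \<and>
                (q + enat e \<le> p i \<longleftrightarrow> q' + enat e \<le> p' i))"
proof (cases q)
  case infinity
  have "p i = \<infinity> \<longleftrightarrow> p' i = \<infinity>" if "i \<in> I" for i
    using near_infinity[OF near _ that] by simp
  then show ?thesis using infinity by (intro exI[of _ \<infinity>]) auto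
next
  case (enat x)
  have "finite (p ` {i\<in>I. p i \<le> q})" "p ` {i\<in>I. p i \<le> q} \<noteq> {}"
    using assms by (auto simp: intro!: exI[of _ og])
  then have "Max (p ` {i\<in>I. p i \<le> q}) \<in> p ` {i\<in>I. p i \<le> q}" by (rule Max_in)
  then obtain a where a: "a \<in> I" "p a \<le> q" and pa: "p a = Max (p ` {i\<in>I. p i \<le> q})" by auto
  have amax: "p i \<le> p a" if "i \<in> I" "p i \<le> q" for i
    unfolding pa using that \<open>finite I\<close> by (intro Max_ge) auto
  obtain xa where xa: "p a = enat xa" using a enat by (cases "p a") auto
  obtain xa' where xa': "p' a = enat xa'"
    using near_infinity[OF near _ a(1)] xa by (cases "p' a") auto
  have rel: "p i + enat e \<le> p j \<longleftrightarrow> p' i + enat e \<le> p' j" if "i \<in> I" "j \<in> I" "e \<le> 2 * d + 2" for i j e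
    using nearD[OF near that] .
  have xax: "xa \<le> x" using a xa enat by simp
  show ?thesis
  proof (cases "x \<le> xa + d")
    case True
    have "(p i + enat e \<le> q \<longleftrightarrow> p' i + enat e \<le> enat (xa' + (x - xa))) \<and>
                (q + enat e \<le> p i \<longleftrightarrow> enat (xa' + (x - xa)) + enat e \<le> p' i)" if i: "i \<in> I" and e: "e \<le> d" for i e
    proof -
      have 1: "p a + enat ((x - xa) + e) \<le> p i \<longleftrightarrow> p' a + enat ((x - xa) + e) \<le> p' i"
        using i e True a by (intro rel) auto
      have 2: "p i + enat (e - (x - xa)) \<le> p a \<longleftrightarrow> p' i + enat (e - (x - xa)) \<le> p' a"
        using i e True a by (intro rel) auto
      have 3: "p a + enat ((x - xa) - e + 1) \<le> p i \<longleftrightarrow> p' a + enat ((x - xa) - e + 1) \<le> p' i"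
        using i e True a by (intro rel) auto
      show ?thesis
      proof (cases "p i")
        case inf: infinity
        then have "p' i = \<infinity>" using near_infinity[OF near _ i] by simp
        then show ?thesis using inf enat by simp
      next
        case y: (enat y)
        then obtain y' where y': "p' i = enat y'" using near_infinity[OF near _ i] by (cases "p' i") auto
        have "xa + ((x - xa) + e) \<le> y \<longleftrightarrow> xa' + ((x - xa) + e) \<le> y'"
          "y + (e - (x - xa)) \<le> xa \<longleftrightarrow> y' + (e - (x - xa)) \<le> xa'"
          "xa + ((x - xa) - e + 1) \<le> y \<longleftrightarrow> xa' + ((x - xa) - e + 1) \<le> y'"
          using 1 2 3 by (simp_all add: xa xa' y y')
        then have "y + e \<le> x \<longleftrightarrow> y' + e \<le> xa' + (x - xa)" "x + e \<le> y \<longleftrightarrow> xa' + (x - xa) + e \<le> y'"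
          using shift_iffs[of xa "x - xa" e y xa' y'] xax by simp_all
        then show ?thesis by (simp add: y y' enat)
      qed
    qed
    then show ?thesis using enat by (intro exI[of _ "enat (xa' + (x - xa))"]) auto
  next
    case far: False
    show ?thesis
    proof (cases "\<exists>b\<in>I. p b > q \<and> p b \<le> q + enat d")
      case True
      then obtain b xb where b: "b \<in> I" "p b = enat xb" "xb > x" "xb \<le> x + d"
        using enat by auto (metis enat_ile enat_ord_simps(1) enat_ord_simps(2))
      obtain xb' where xb': "p' b = enat xb'"
        using near_infinity[OF near _ b(1)] b by (cases "p' b") auto
      have "p a + enat (d + 1) \<le> p b \<longleftrightarrow> p' a + enat (d + 1) \<le> p' b"
        using a b by (intro rel) auto
      \<comment> \<open>\<open>b\<close> lies more than \<open>d\<close> above \<open>a\<close>, and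
        this much of the distance is preserved, so the subtraction in \<open>xb' - (xb - x)\<close>
        does not truncate.\<close>
      then have big: "xb' \<ge> d + 1" using xa xa' b xb' far by auto
      have xeqs: "x + (xb - x) = xb" "xb' - (xb - x) + (xb - x) = xb'" using b(3,4) big by simp_all
      have "(p i + enat e \<le> q \<longleftrightarrow> p' i + enat e \<le> enat (xb' - (xb - x))) \<and>
                (q + enat e \<le> p i \<longleftrightarrow> enat (xb' - (xb - x)) + enat e \<le> p' i)" if i: "i \<in> I" and e: "e \<le> d" for i e
      proof -
        have 1: "p i + enat ((xb - x) + e) \<le> p b \<longleftrightarrow> p' i + enat ((xb - x) + e) \<le> p' b"
          using i e b by (intro rel) auto
        have 2: "p b + enat (e - (xb - x)) \<le> p i \<longleftrightarrow> p' b + enat (e - (xb - x)) \<le> p' i"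
          using i e b by (intro rel) auto
        have 3: "p i + enat ((xb - x) - e + 1) \<le> p b \<longleftrightarrow> p' i + enat ((xb - x) - e + 1) \<le> p' b"
          using i e b by (intro rel) auto
        show ?thesis
        proof (cases "p i")
          case inf: infinity
          then have "p' i = \<infinity>" using near_infinity[OF near _ i] by simp
          then show ?thesis using inf enat by simp
        next
          case y: (enat y)
          then obtain y' where y': "p' i = enat y'" using near_infinity[OF near _ i] by (cases "p' i") auto
          have "y + ((xb - x) + e) \<le> xb \<longleftrightarrow> y' + ((xb - x) + e) \<le> xb'"
            "xb + (e - (xb - x)) \<le> y \<longleftrightarrow> xb' + (e - (xb - x)) \<le> y'"
            "y + ((xb - x) - e + 1) \<le> xb \<longleftrightarrow> y' + ((xb - x) - e + 1) \<le> xb'"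
            using 1 2 3 by (simp_all add: b xb' y y')
          then have "y + e \<le> x \<longleftrightarrow> y' + e \<le> xb' - (xb - x)" "x + e \<le> y \<longleftrightarrow> xb' - (xb - x) + e \<le> y'"
            using shift_iffs'[of y "xb - x" e x y' "xb' - (xb - x)", unfolded xeqs] by blast+
          then show ?thesis by (simp add: y y' enat)
        qed
      qed
      then show ?thesis using enat by (intro exI[of _ "enat (xb' - (xb - x))"]) auto
    next
      case False
      have "(p i + enat e \<le> q \<longleftrightarrow> p' i + enat e \<le> enat (xa' + d + 1)) \<and>
                (q + enat e \<le> p i \<longleftrightarrow> enat (xa' + d + 1) + enat e \<le> p' i)" if i: "i \<in> I" and e: "e \<le> d" for i e
      proof (cases "p i \<le> q")
        case True
        then have "p i \<le> p a" using amax i by blast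
        moreover have "p i + enat 0 \<le> p a \<longleftrightarrow> p' i + enat 0 \<le> p' a" using i a by (intro rel) auto
        ultimately show ?thesis using True far xa xa' enat xax e
          by (cases "p i"; cases "p' i") (auto)
      next
        case False
        then have *: "q + enat d < p i" using i \<open>\<not> (\<exists>b\<in>I. _ b)\<close> by auto
        have "p a + enat (2 * d + 2) \<le> p i \<longleftrightarrow> p' a + enat (2 * d + 2) \<le> p' i"
          using i a by (intro rel) auto
        with * False show ?thesis using far xa xa' enat xax e
          by (cases "p i"; cases "p' i") (auto)
      qed
      then show ?thesis using enat by (intro exI[of _ "enat (xa' + d + 1)"]) auto
    qed
  qed
qed

text \<open>Each insertion replaces the required bound \<open>d\<close> by \<open>2 * d + 2\<close>,
  so \<open>D\<close> can be chosen before \<open>p\<close> and \<open>p'\<close> are known.\<close>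

lemma near_extend:
  assumes "finite I" "finite K" "og \<in> I"
  shows "\<exists>D\<ge>d. \<forall>p p'. near D I p p' \<longrightarrow> p og = 0 \<longrightarrow> p' og = 0 \<longrightarrow>
           (\<exists>p''. (\<forall>i\<in>I. p'' i = p' i) \<and> near d (I \<union> K) p p'')"
  using assms(2)
proof (induction K arbitrary: d rule: finite_induct)
  case empty
  show ?case by (intro exI[of _ d]) auto
next
  case (insert k K)
  obtain D where D: "D \<ge> 2 * d + 2"
    "\<And>p p'. near D I p p' \<Longrightarrow> p og = 0 \<Longrightarrow> p' og = 0 \<Longrightarrow>
           (\<exists>p''. (\<forall>i\<in>I. p'' i = p' i) \<and> near (2 * d + 2) (I \<union> K) p p'')"
    using insert.IH[of "2 * d + 2"] by blast
  have "\<exists>p''. (\<forall>i\<in>I. p'' i = p' i) \<and> near d (I \<union> insert k K) p p''"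
    if nr: "near D I p p'" "p og = 0" "p' og = 0" for p p'
  proof -
    obtain p1 where p1: "\<forall>i\<in>I. p1 i = p' i" "near (2 * d + 2) (I \<union> K) p p1"
      using D(2)[OF nr] by blast
    show ?thesis
    proof (cases "k \<in> I \<union> K")
      case True
      then have "I \<union> insert k K = I \<union> K" by auto
      moreover have "near d (I \<union> K) p p1" using p1(2) by (auto simp: near_def)
      ultimately show ?thesis using p1(1) by auto
    next
      case False
      have fin: "finite (I \<union> K)" and og: "og \<in> I \<union> K" "p1 og = 0"
        using assms insert.hyps nr p1(1) by auto
      obtain q' where "(p k = \<infinity> \<longleftrightarrow> q' = \<infinity>) \<and>
        (\<forall>i\<in>I \<union> K. \<forall>e\<le>d. (p i + enat e \<le> p k \<longleftrightarrow> p1 i + enat e \<le> q') \<and>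
                (p k + enat e \<le> p i \<longleftrightarrow> q' + enat e \<le> p1 i))"
        using near_extend1[OF p1(2) fin og(1) nr(2) og(2), of "p k"] by (rule exE)
      note q' = conjunct1[OF this] conjunct2[OF this]
      have "near d (I \<union> insert k K) p (p1(k := q'))"
        unfolding near_def
      proof (intro ballI allI impI)
        fix i j e assume ij: "i \<in> I \<union> insert k K" "j \<in> I \<union> insert k K" and e: "e \<le> (d::nat)"
        consider "i = k" "j = k" | "i = k" "j \<noteq> k" "j \<in> I \<union> K" | "i \<noteq> k" "j = k" "i \<in> I \<union> K"
          | "i \<noteq> k" "j \<noteq> k" "i \<in> I \<union> K" "j \<in> I \<union> K" using ij by auto
        then show "(p i + enat e \<le> p j) = ((p1(k := q')) i + enat e \<le> (p1(k := q')) j)"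
        proof cases
          case 1
          then show ?thesis using q'(1) by (cases "p k"; cases q') (auto)
        next
          case 2 then show ?thesis using q'(2) e by simp
        next
          case 3 then show ?thesis using q'(2) e by simp
        next
          case 4
          then show ?thesis using nearD[OF p1(2), of i j e] e by simp
        qed
      qed
      moreover have "\<forall>i\<in>I. (p1(k := q')) i = p' i" using p1(1) False by auto
      ultimately show ?thesis by blast
    qed
  qed
  then show ?case using D(1) by (intro exI[of _ D]) auto
qed

text \<open>The extension step of Presburger arithmetic, with \<open>\<kappa>\<close> as new digit
  and the values \<open>- u x\<close> as known ones. If \<open>\<kappa>\<close> is within
  \<open>B + M\<close> of a known value, the distance to it is copied, and the congruence follows
  from that of \<open>u x\<close> and \<open>u' x\<close>. Otherwise a window of \<open>M\<close>
  consecutive integers at distance more than \<open>B\<close> contains the right residue, and a gap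
  of more than \<open>2 * B + 2 * M\<close> between known values has room for this window.\<close>

lemma digit_extend:
  fixes u u' :: "'i \<Rightarrow> int"
  assumes fin: "finite Z" and ne: "Z \<noteq> {}" and M: "M > 0" and B': "int B' \<ge> 2 * int B + 2 * M + 1"
    and clip: "\<And>x y. x \<in> Z \<Longrightarrow> y \<in> Z \<Longrightarrow> clip B' (u x - u y) = clip B' (u' x - u' y)"
    and cong: "\<And>x. x \<in> Z \<Longrightarrow> M dvd u x - u' x"
  shows "\<exists>\<kappa>'. M dvd \<kappa> - \<kappa>' \<and> (\<forall>x\<in>Z. clip B (\<kappa> + u x) = clip B (\<kappa>' + u' x))"
proof (cases "\<exists>x\<in>Z. \<bar>\<kappa> + u x\<bar> \<le> int B + M")
  case True
  then obtain x where x: "x \<in> Z" "\<bar>\<kappa> + u x\<bar> \<le> int B + M" by blast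
  have "clip B (\<kappa> + u y) = clip B (\<kappa> + u x - u' x + u' y)" if "y \<in> Z" for y
    using clip[OF that x(1)] x(2) B' M unfolding clip_eq_iff by linarith
  then show ?thesis using cong[OF x(1)]
    by (intro exI[of _ "\<kappa> + u x - u' x"]) (auto simp: dvd_diff_commute algebra_simps)
next
  case False
  have congr: "\<exists>t. 1 \<le> t \<and> t \<le> M \<and> M dvd \<kappa> - (a + t)" for a
  proof (intro exI conjI)
    let ?t = "(\<kappa> - a - 1) mod M + 1"
    show "1 \<le> ?t" "?t \<le> M"
      using pos_mod_bound[OF M, of "\<kappa> - a - 1"] pos_mod_sign[OF M, of "\<kappa> - a - 1"] by linarith+
    have "\<kappa> - (a + ?t) = (\<kappa> - a - 1) - (\<kappa> - a - 1) mod M" by simp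
    then show "M dvd \<kappa> - (a + ?t)" by (simp add: minus_mod_eq_mult_div)
  qed
  let ?G = "{x \<in> Z. \<kappa> + u x > 0}" and ?L = "{x \<in> Z. \<kappa> + u x \<le> 0}"
  have gap: "u' y - u' x > 2 * int B + 2 * M" if "x \<in> ?L" "y \<in> ?G" for x y
  proof -
    have "\<bar>\<kappa> + u x\<bar> > int B + M" "\<bar>\<kappa> + u y\<bar> > int B + M" "\<kappa> + u x \<le> 0" "\<kappa> + u y > 0"
      using False that by (auto simp: not_le)
    then have "u y - u x > 2 * int B + 2 * M" by linarith
    moreover have "clip B' (u y - u x) = clip B' (u' y - u' x)" using clip that by blast
    ultimately show ?thesis using B' M unfolding clip_eq_iff by linarith
  qed
  have far: "\<bar>\<kappa> + u x\<bar> > int B" if "x \<in> Z" for x using False that M by force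
  show ?thesis
  proof (cases "?G = {}")
    case True
    \<comment> \<open>All sums are below \<open>- B\<close>. The candidate stays below every
      \<open>- u' x\<close> by more than \<open>B\<close>, whichever \<open>t \<le> M\<close> the
      congruence demands.\<close>
    let ?m = "Min ((\<lambda>x. - u' x) ` Z)"
    obtain t where t: "1 \<le> t" "t \<le> M" "M dvd \<kappa> - ((?m - int B - M - 1) + t)" using congr by blast
    have "clip B (\<kappa> + u x) = clip B (((?m - int B - M - 1) + t) + u' x)" if "x \<in> Z" for x
    proof -
      have "?m \<le> - u' x" using that fin by (intro Min_le) auto
      moreover have "\<kappa> + u x \<le> 0" using True that by auto
      ultimately show ?thesis using far[OF that] t(1,2)
        unfolding clip_eq_iff by linarith
    qed
    then show ?thesis using t(3) by blast
  next
    case ne: False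
    let ?m = "Max ((\<lambda>x. - u' x) ` ?G)"
    obtain t where t: "1 \<le> t" "t \<le> M" "M dvd \<kappa> - ((?m + int B) + t)" using congr by blast
    have "?m \<in> (\<lambda>x. - u' x) ` ?G" using fin ne by (intro Max_in) auto
    then obtain y where y: "y \<in> ?G" "?m = - u' y" by blast
    have "clip B (\<kappa> + u x) = clip B (((?m + int B) + t) + u' x)" if "x \<in> Z" for x
    proof (cases "x \<in> ?G")
      case True
      have "- u' x \<le> ?m" using True fin by (intro Max_ge) auto
      moreover have "\<kappa> + u x > 0" using True by blast
      ultimately show ?thesis using far[OF that] t(1,2)
        unfolding clip_eq_iff by linarith
    next
      case False
      then have "x \<in> ?L" using that by auto
      moreover from this have "\<kappa> + u x \<le> 0" by blast
      ultimately show ?thesis using gap[OF _ y(1), of x] far[OF that] t(1,2) y(2)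
        unfolding clip_eq_iff by linarith
    qed
    then show ?thesis using t(3) by blast
  qed
qed

section \<open>Chinese remainder theorem for arbitrary moduli\<close>

lemma crt_two:
  fixes a b r s :: int
  assumes "gcd a b dvd r - s"
  shows "\<exists>x. a dvd x - r \<and> b dvd x - s"
proof -
  obtain k where k: "r - s = gcd a b * k" using assms by blast
  obtain u v where uv: "u * a + v * b = gcd a b" using bezout_int by blast
  have "r - u * a * k - s = v * b * k" using k uv[symmetric] by (simp add: algebra_simps)
  then show ?thesis by (intro exI[of _ "r - u * a * k"]) auto
qed

lemma lcm_gcd_dvd:
  assumes "finite A" "\<And>m. m \<in> A \<Longrightarrow> gcd m b dvd (c :: int)"
  shows "gcd (Lcm A) b dvd c"
  using assms
proof (induction A rule: finite_induct)
  case empty then show ?case by simp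
next
  case (insert m A)
  have "gcd (lcm m (Lcm A)) b = lcm (gcd m b) (gcd (Lcm A) b)"
    using gcd_lcm_distrib[of b m "Lcm A"] by (simp add: gcd.commute)
  then show ?case using insert by (simp add: lcm_least)
qed

lemma crt_finite:
  fixes A :: "int set"
  assumes "finite A" "\<And>m m'. m \<in> A \<Longrightarrow> m' \<in> A \<Longrightarrow> gcd m m' dvd r m - r m'"
  shows "\<exists>x. \<forall>m\<in>A. m dvd x - r m"
  using assms
proof (induction A rule: finite_induct)
  case empty then show ?case by simp
next
  case (insert b A)
  then obtain x where x: "\<forall>m\<in>A. m dvd x - r m" by auto
  have "gcd (Lcm A) b dvd x - r b"
  proof (rule lcm_gcd_dvd[OF insert.hyps(1)])
    fix m assume m: "m \<in> A"
    have "gcd m b dvd r m - r b" using insert.prems m by auto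
    moreover have "gcd m b dvd x - r m" using x m by (meson dvd_trans gcd_dvd1)
    ultimately have "gcd m b dvd (x - r m) + (r m - r b)" by (rule dvd_add[rotated])
    then show "gcd m b dvd x - r b" by simp
  qed
  then obtain y where y: "Lcm A dvd y - x" "b dvd y - r b" using crt_two by blast
  have "m dvd y - r m" if "m \<in> A" for m
  proof -
    have "m dvd y - x" using y(1) that dvd_Lcm dvd_trans by blast
    then have "m dvd (y - x) + (x - r m)" using x that by (intro dvd_add) auto
    then show ?thesis by simp
  qed
  then show ?case using y(2) by auto
qed

section \<open>Adding one element to a pair of matching tuples\<close>

datatype pos_index = Origin | OldPos "nat \<Rightarrow> int" nat | NewPos nat

text \<open>Differences of two combinations bounded by \<open>B\<close> must be available, hence
  \<open>2 * B\<close>. \<open>Origin\<close> stands for position \<open>0\<close>, so that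
  comparison with fixed positions becomes a matter of distance.\<close>

definition old_positions :: "nat \<Rightarrow> nat \<Rightarrow> pos_index set" where
  "old_positions n B = insert Origin ((\<lambda>(z, m). OldPos z m) ` (coefs n (2 * B) \<times> {..B}))"

lemma finite_old_positions: "finite (old_positions n B)"
  by (simp add: old_positions_def finite_coefs)

lemma old_positionsI: "z \<in> coefs n (2 * B) \<Longrightarrow> m \<le> B \<Longrightarrow> OldPos z m \<in> old_positions n B"
  by (auto simp: old_positions_def)

lemma dvd_dig_eq: "dig_eq B m a b \<Longrightarrow> int m dvd a - a' \<Longrightarrow> int m dvd b - b' \<Longrightarrow> dig_eq B m a' b'"
proof (cases "m = 0")
  case False
  assume *: "dig_eq B m a b" "int m dvd a - a'" "int m dvd b - b'"
  then have "int m dvd a - b" using False by (simp only: dig_eq_def if_False)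
  from dvd_add[OF dvd_diff[OF this *(2)] *(3)] have "int m dvd (a - b) - (a - a') + (b - b')" .
  moreover have "(a - b) - (a - a') + (b - b') = a' - b'" by simp
  ultimately show ?thesis using False by (simp only: dig_eq_def if_False)
qed (simp add: dig_eq_def)

text \<open>A position not after the valuation either is the valuation, where the leading digits
  match, or precedes it, where both entries are divisible by \<open>m\<close>.\<close>

lemma dig_eq_position:
  assumes near: "near d I p p'" and I: "a \<in> I" "b \<in> I" and d: "d \<ge> 1"
    and b: "p b = mval m x" "p' b = mval m x'"
    and le: "p a \<le> mval m x" and a: "p a = enat \<delta>" "p' a = enat \<delta>'"
    and dig: "mval m x \<noteq> \<infinity> \<Longrightarrow> dig_eq B m (lead m x) (lead m x')"
  shows "dig_eq B m (x \<delta>) (x' \<delta>')"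
proof (cases "mval m x = enat \<delta>")
  case True
  then have "mval m x' = enat \<delta>'" using near_eq[OF near I] a b by simp
  then show ?thesis using True dig by (simp add: lead_eq)
next
  case False
  then have "enat \<delta> < mval m x" using le a by simp
  moreover have "enat \<delta>' < mval m x'" using near_less[OF near I] a b calculation by simp
  ultimately show ?thesis using mval_dvd[of \<delta> m x] mval_dvd[of \<delta>' m x']
    by (cases "m = 0") (auto simp: dig_eq_def)
qed

text \<open>For each modulus \<open>m\<close> the combination \<open>zm m\<close> closest to \<open>C\<close> determines the position of
  \<open>z - C\<close> for all other \<open>z\<close>. Once the new positions are matched, the digits of \<open>C'\<close> are found one by one
  with the Chinese remainder theorem: two congruences modulo \<open>m\<close> and \<open>m'\<close> are compatible because
  the combinations \<open>zm m - zm m'\<close> agree in both tuples modulo \<open>gcd m m'\<close>, and \<open>m = 0\<close> fits in as equality.\<close>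

lemma data_extend_raw:
  fixes n B :: nat
  assumes B: "B \<ge> 1"
  shows "\<exists>B'\<ge>2 * B. \<forall>s s' C. data_eq n B' s s' \<longrightarrow> (\<exists>C' p p' \<iota>.
     near B (old_positions n B \<union> NewPos ` {..B}) p p' \<and> p Origin = 0 \<and> p' Origin = 0 \<and>
     (\<forall>z\<in>coefs n (2 * B). \<forall>m\<le>B. p (OldPos z m) = mval m (lin n z s) \<and> p' (OldPos z m) = mval m (lin n z s')) \<and>
     (\<forall>z\<in>coefs n B. \<forall>m\<le>B. \<iota> z m \<in> old_positions n B \<union> NewPos ` {..B} \<and>
        mval m (\<lambda>k. lin n z s k - C k) = p (\<iota> z m) \<and> mval m (\<lambda>k. lin n z s' k - C' k) = p' (\<iota> z m) \<and>
        (p (\<iota> z m) \<noteq> \<infinity> \<longrightarrow>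
           dig_eq B m (lead m (\<lambda>k. lin n z s k - C k)) (lead m (\<lambda>k. lin n z s' k - C' k)))))"
    (is "\<exists>B'\<ge>_. \<forall>s s' C. _ \<longrightarrow> ?P s s' C")
proof -
  let ?I = "old_positions n B" and ?N = "NewPos ` {..B}"
  \<comment> \<open>The digit found at modulus \<open>0\<close> must satisfy the congruences for all
    other moduli simultaneously.\<close>
  define M :: nat where "M = Lcm {1..B}"
  obtain D where D: "D \<ge> B" "\<And>p p'. near D ?I p p' \<Longrightarrow> p Origin = 0 \<Longrightarrow> p' Origin = 0 \<Longrightarrow>
           (\<exists>p''. (\<forall>i\<in>?I. p'' i = p' i) \<and> near B (?I \<union> ?N) p p'')"
    using near_extend[OF finite_old_positions[of n B], of ?N Origin B]
    by (auto simp: old_positions_def)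
  \<comment> \<open>\<open>D\<close> pays for the inserted positions, \<open>2 * B\<close> for
    differences of combinations, and \<open>2 * B + 2 * M + 1\<close> is what
    \<open>digit_extend\<close> needs.\<close>
  define B' where "B' = D + 2 * B + 2 * M + 1"
  have M: "M \<ge> 1" "\<And>m. 1 \<le> m \<Longrightarrow> m \<le> B \<Longrightarrow> int m dvd int M"
    unfolding M_def by (auto simp: Suc_le_eq intro!: dvd_Lcm Nat.gr0I)
  have Mdvd: "int M dvd x" if "\<And>m. 1 \<le> m \<Longrightarrow> m \<le> B \<Longrightarrow> int m dvd x" for x
  proof -
    have "M dvd nat \<bar>x\<bar>" unfolding M_def using that by (intro Lcm_least) (auto simp: nat_dvd_iff)
    then show ?thesis by (simp add: nat_dvd_iff)
  qed
  have "?P s s' C"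
    if data: "data_eq n B' s s'" for s s' C
  proof -
    define T where "T z = lin n z s" for z
    define T' where "T' z = lin n z s'" for z
    have T_diff: "T (\<lambda>i. z i - w i) k = T z k - T w k" "T' (\<lambda>i. z i - w i) k = T' z k - T' w k" for z w k
      by (simp_all add: T_def T'_def lin_diff)
    have sub: "coefs n (2 * B) \<subseteq> coefs n B'" "coefs n B \<subseteq> coefs n (2 * B)"
      by (auto simp: B'_def intro!: coefs_mono)
    have diff: "(\<lambda>i. z i - w i) \<in> coefs n (2 * B)" if "z \<in> coefs n B" "w \<in> coefs n B" for z w
      using coefs_diff[OF that] by (simp add: mult_2)
    have "\<exists>w\<in>coefs n B. \<forall>z\<in>coefs n B. mval m (\<lambda>k. T z k - C k) \<le> mval m (\<lambda>k. T w k - C k)" for m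
    proof -
      let ?S = "(\<lambda>z. mval m (\<lambda>k. T z k - C k)) ` coefs n B"
      have fin: "finite ?S" and ne: "?S \<noteq> {}" using finite_coefs[of n B] zero_in_coefs[of n B] by auto
      then have "Max ?S \<in> ?S" by (rule Max_in)
      moreover have "\<forall>y\<in>?S. y \<le> Max ?S" using fin by auto
      ultimately show ?thesis by (smt (verit, best) imageE imageI)
    qed
    then obtain zm where zm: "\<And>m. zm m \<in> coefs n B"
      "\<And>m z. z \<in> coefs n B \<Longrightarrow> mval m (\<lambda>k. T z k - C k) \<le> mval m (\<lambda>k. T (zm m) k - C k)"
      by metis
    define zd where "zd z m = (\<lambda>i. z i - zm m i)" for z m
    have zd: "zd z m \<in> coefs n (2 * B)" if "z \<in> coefs n B" for z m
      unfolding zd_def using diff[OF that zm(1)] .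
    define \<gamma> where "\<gamma> m = mval m (\<lambda>k. T (zm m) k - C k)" for m
    define \<kappa> where "\<kappa> m = lead m (\<lambda>k. T (zm m) k - C k)" for m
    define p where "p i = (case i of Origin \<Rightarrow> 0 | OldPos z m \<Rightarrow> mval m (T z) | NewPos m \<Rightarrow> \<gamma> m)" for i
    \<comment> \<open>The value at the new positions is a placeholder; \<open>near_extend\<close>
      chooses it.\<close>
    define p0 where "p0 i = (case i of Origin \<Rightarrow> 0 | OldPos z m \<Rightarrow> mval m (T' z) | NewPos m \<Rightarrow> 0)" for i
    have data1: "mval m (T z) + enat e \<le> mval m' (T z') \<longleftrightarrow> mval m (T' z) + enat e \<le> mval m' (T' z')"
      if "z \<in> coefs n B'" "z' \<in> coefs n B'" "m \<le> B'" "m' \<le> B'" "e \<le> B'" for z z' m m' e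
      using data that unfolding data_eq_def T_def T'_def by blast
    have data2: "enat d \<le> mval m (T z) \<longleftrightarrow> enat d \<le> mval m (T' z)"
      if "z \<in> coefs n B'" "m \<le> B'" "d \<le> B'" for z m d
      using data that unfolding data_eq_def T_def T'_def by blast
    have data3: "dig_eq B' m (lead m (T z)) (lead m (T' z))"
      if "z \<in> coefs n B'" "m \<le> B'" "mval m (T z) \<noteq> \<infinity>" for z m
      using data that unfolding data_eq_def T_def T'_def by blast
    have one_le: "enat (Suc 0) \<le> x \<longleftrightarrow> x \<noteq> 0" for x
      by (cases x) (auto simp: zero_enat_def)
    have "near D ?I p p0"
      unfolding near_def
    proof (intro ballI allI impI)
      fix i j e assume ij: "i \<in> ?I" "j \<in> ?I" and e: "e \<le> D"
      have eB: "e \<le> B'" using e by (simp add: B'_def)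
      have BB: "B \<le> B'" "1 \<le> B'" by (auto simp: B'_def)
      show "(p i + enat e \<le> p j) = (p0 i + enat e \<le> p0 j)"
      proof (cases i)
        case Origin
        show ?thesis
        proof (cases j)
          case Origin
          then show ?thesis using \<open>i = Origin\<close> by (simp add: p_def p0_def)
        next
          case (OldPos z m)
          then have "z \<in> coefs n B'" "m \<le> B'" using ij sub(1) BB by (auto simp: old_positions_def)
          then show ?thesis using data2[OF _ _ eB] Origin OldPos by (simp add: p_def p0_def)
        qed (use ij in \<open>auto simp: old_positions_def\<close>)
      next
        case (OldPos z m)
        then have zm: "z \<in> coefs n B'" "m \<le> B'" using ij sub(1) BB by (auto simp: old_positions_def)
        show ?thesis
        proof (cases j)
          case Origin
          then show ?thesis using data2[OF zm BB(2)] OldPos by (simp add: p_def p0_def one_le)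
        next
          case (OldPos z' m')
          then have "z' \<in> coefs n B'" "m' \<le> B'" using ij sub(1) BB by (auto simp: old_positions_def)
          then show ?thesis using data1[OF zm(1) _ zm(2) _ eB] \<open>i = _\<close> OldPos by (simp add: p_def p0_def)
        qed (use ij in \<open>auto simp: old_positions_def\<close>)
      qed (use ij in \<open>auto simp: old_positions_def\<close>)
    qed
    then obtain p' where p': "\<forall>i\<in>?I. p' i = p0 i" "near B (?I \<union> ?N) p p'"
      using D(2)[of p p0] by (auto simp: p_def p0_def)
    have pOrigin: "p Origin = 0" "p' Origin = 0"
      using p'(1) by (auto simp: p_def p0_def old_positions_def)
    have pOld: "p (OldPos z m) = mval m (T z)" "p' (OldPos z m) = mval m (T' z)" "OldPos z m \<in> ?I \<union> ?N"
      if "z \<in> coefs n (2 * B)" "m \<le> B" for z m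
      using p'(1) old_positionsI[OF that] by (auto simp: p_def p0_def)
    define \<gamma>' where "\<gamma>' m = p' (NewPos m)" for m
    have pNew: "p (NewPos m) = \<gamma> m" "p' (NewPos m) = \<gamma>' m" for m
      by (auto simp: p_def \<gamma>'_def)
    have NewI: "NewPos m \<in> ?I \<union> ?N" if "m \<le> B" for m using that by auto
    note nr = p'(2)
    have dig: "dig_eq B' g (T z \<delta>) (T' z \<delta>')"
      if "z \<in> coefs n (2 * B)" "g \<le> B" "a \<in> ?I \<union> ?N" "p a = enat \<delta>" "p' a = enat \<delta>'" "p a \<le> mval g (T z)"
      for g z a \<delta> \<delta>'
    proof (rule dig_eq_position[OF nr that(3) pOld(3)[OF that(1,2)] B pOld(1,2)[OF that(1,2)] that(6,4,5)])
      show "dig_eq B' g (lead g (T z)) (lead g (T' z))" if "mval g (T z) \<noteq> \<infinity>"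
        using data3[OF _ _ that] \<open>z \<in> _\<close> \<open>g \<le> B\<close> sub by (auto simp: B'_def)
    qed
    have \<gamma>inf: "\<gamma> m = \<infinity> \<longleftrightarrow> \<gamma>' m = \<infinity>" if "m \<le> B" for m
      using near_infinity[OF nr B NewI[OF that]] by (simp add: pNew)
    \<comment> \<open>These are the combinations for which \<open>z - C\<close> attains the maximal
      position \<open>\<gamma> 0\<close> at modulus \<open>0\<close>. For finite
      \<open>\<gamma> 0\<close> the digit there is \<open>\<kappa> 0\<close> plus the digit of the
      difference \<open>zd z 0\<close>.\<close>
    define Z0 where "Z0 = {z \<in> coefs n B. \<gamma> 0 \<le> mval 0 (T (zd z 0))}"
    have "\<exists>k. \<gamma> 0 \<noteq> \<infinity> \<longrightarrow> int M dvd \<kappa> 0 - k \<and> (\<forall>z\<in>Z0. clip B (\<kappa> 0 + T (zd z 0) (the_enat (\<gamma> 0))) =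
             clip B (k + T' (zd z 0) (the_enat (\<gamma>' 0))))"
    proof (cases "\<gamma> 0")
      case infinity then show ?thesis by simp
    next
      case \<delta>: (enat \<delta>)
      then obtain \<delta>' where \<delta>': "\<gamma>' 0 = enat \<delta>'" using \<gamma>inf[of 0] by (cases "\<gamma>' 0") auto
      have "\<exists>k. int M dvd \<kappa> 0 - k \<and> (\<forall>z\<in>Z0. clip B (\<kappa> 0 + T (zd z 0) \<delta>) = clip B (k + T' (zd z 0) \<delta>'))"
      proof (rule digit_extend)
        show "finite Z0" unfolding Z0_def using finite_coefs by auto
        have "T (zd (zm 0) 0) = (\<lambda>_. 0)" by (simp add: zd_def T_def lin_zero)
        then have "mval 0 (T (zd (zm 0) 0)) = \<infinity>" by (simp add: mval_eq_infinity_iff)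
        then have "zm 0 \<in> Z0" using zm(1) by (simp add: Z0_def)
        then show "Z0 \<noteq> {}" by auto
        show "int M > 0" using M by simp
        show "int B' \<ge> 2 * int B + 2 * int M + 1" by (simp add: B'_def)
        show "clip B' (T (zd x 0) \<delta> - T (zd y 0) \<delta>) = clip B' (T' (zd x 0) \<delta>' - T' (zd y 0) \<delta>')"
          if xy: "x \<in> Z0" "y \<in> Z0" for x y
        proof -
          let ?z = "\<lambda>i. x i - y i"
          have z: "?z \<in> coefs n (2 * B)" using xy diff by (auto simp: Z0_def)
          have "\<gamma> 0 \<le> mval 0 (T ?z)"
          proof (rule le_mvalI)
            fix i assume i: "enat i < \<gamma> 0"
            then have "enat i < mval 0 (T (zd x 0))" "enat i < mval 0 (T (zd y 0))"
              using xy by (auto simp: Z0_def)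
            then have "int 0 dvd T (zd x 0) i - T (zd y 0) i" by (intro dvd_diff mval_dvd)
            then show "int 0 dvd T ?z i" by (simp add: zd_def T_diff)
          qed
          then have "dig_eq B' 0 (T ?z \<delta>) (T' ?z \<delta>')"
            using dig[OF z _ NewI[of 0], of 0 \<delta> \<delta>'] \<delta> \<delta>' by (simp add: pNew)
          then show ?thesis by (simp add: zd_def T_diff dig_eq_def)
        qed
        show "int M dvd T (zd x 0) \<delta> - T' (zd x 0) \<delta>'" if x: "x \<in> Z0" for x
        proof (rule Mdvd)
          fix m assume m: "1 \<le> m" "m \<le> B"
          have xd: "zd x 0 \<in> coefs n (2 * B)" using zd x by (auto simp: Z0_def)
          have "\<gamma> 0 \<le> mval m (T (zd x 0))"
          proof (rule le_mvalI)
            fix i assume i: "enat i < \<gamma> 0"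
            then have "enat i < mval 0 (T (zd x 0))" using x by (auto simp: Z0_def)
            then have "int 0 dvd T (zd x 0) i" by (rule mval_dvd)
            then show "int m dvd T (zd x 0) i" by simp
          qed
          then have "dig_eq B' m (T (zd x 0) \<delta>) (T' (zd x 0) \<delta>')"
            using dig[OF xd m(2) NewI[of 0], of \<delta> \<delta>'] \<delta> \<delta>' by (simp add: pNew)
          then show "int m dvd T (zd x 0) \<delta> - T' (zd x 0) \<delta>'" using m by (simp add: dig_eq_def)
        qed
      qed
      then show ?thesis using \<delta> \<delta>' by simp
    qed
    then obtain \<kappa>0 where \<kappa>0: "\<gamma> 0 \<noteq> \<infinity> \<Longrightarrow> int M dvd \<kappa> 0 - \<kappa>0"
      "\<And>z. \<gamma> 0 \<noteq> \<infinity> \<Longrightarrow> z \<in> Z0 \<Longrightarrow> clip B (\<kappa> 0 + T (zd z 0) (the_enat (\<gamma> 0))) =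
             clip B (\<kappa>0 + T' (zd z 0) (the_enat (\<gamma>' 0)))" by blast
    \<comment> \<open>For \<open>m > 0\<close> only the residue matters and the old digit can be
      kept. The digit at modulus \<open>0\<close> is the one just found, congruent to the old one
      modulo \<open>M\<close>.\<close>
    define \<kappa>' where "\<kappa>' m = (if m = 0 then \<kappa>0 else \<kappa> m)" for m
    \<comment> \<open>The residue prescribed for \<open>T (zm m) - C\<close> at a position
      \<open>i \<le> \<gamma> m\<close>: zero before \<open>\<gamma> m\<close> and the recorded
      digit at \<open>\<gamma> m\<close>. Later positions carry no condition.\<close>
    define \<rho> where "\<rho> m i = (if enat i = \<gamma> m then \<kappa> m else 0)" for m i
    define \<rho>' where "\<rho>' m i = (if enat i = \<gamma>' m then \<kappa>' m else 0)" for m i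
    have TC: "int m dvd T (zm m) i - C i - \<rho> m i" if "enat i \<le> \<gamma> m" for m i
    proof (cases "enat i = \<gamma> m")
      case True
      then show ?thesis by (simp add: \<rho>_def \<kappa>_def \<gamma>_def lead_eq[of _ _ i])
    next
      case False
      then have "enat i < \<gamma> m" using that by simp
      then show ?thesis using False mval_dvd[of i m "\<lambda>k. T (zm m) k - C k"] by (simp add: \<rho>_def \<gamma>_def)
    qed
    have \<kappa>\<kappa>': "int g dvd \<kappa> m - \<kappa>' m" if "g \<ge> 1" "g \<le> B" "\<gamma> m \<noteq> \<infinity>" for g m
      using dvd_trans[OF M(2)[OF that(1,2)] \<kappa>0(1)] that(3) by (cases "m = 0") (auto simp: \<kappa>'_def)
    have "\<exists>c. \<forall>m\<le>B. enat i \<le> \<gamma>' m \<longrightarrow> int m dvd T' (zm m) i - c - \<rho>' m i" for i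
    proof -
      let ?r = "\<lambda>m. T' (zm (nat m)) i - \<rho>' (nat m) i"
      let ?A = "int ` {m. m \<le> B \<and> enat i \<le> \<gamma>' m}"
      have "\<exists>x. \<forall>m\<in>?A. m dvd x - ?r m"
      proof (rule crt_finite)
        show "finite ?A" by auto
        fix a b assume "a \<in> ?A" "b \<in> ?A"
        then obtain m m' where mm: "a = int m" "b = int m'" "m \<le> B" "m' \<le> B" "enat i \<le> \<gamma>' m" "enat i \<le> \<gamma>' m'"
          by auto
        define g where "g = gcd m m'"
        have "int g dvd ?r a - ?r b"
        proof (cases "m = m'")
          case True then show ?thesis using mm by simp
        next
          case False
          have g: "int g dvd int m" "int g dvd int m'" by (auto simp: g_def)
          have g0: "g \<ge> 1" using False by (cases "m = 0") (auto simp: g_def Suc_le_eq)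
          have gB: "g \<le> B"
          proof (cases "m = 0")
            case True then show ?thesis using mm by (simp add: g_def)
          next
            case False
            then have "g \<le> m" by (simp add: g_def)
            then show ?thesis using mm by simp
          qed
          define zz where "zz = (\<lambda>i. zm m i - zm m' i)"
          have zz: "zz \<in> coefs n (2 * B)" unfolding zz_def using diff zm(1) by blast
          have unprimed: "int g dvd T zz j - (\<rho> m j - \<rho> m' j)" if "enat j \<le> \<gamma> m" "enat j \<le> \<gamma> m'" for j
          proof -
            have "int g dvd (T (zm m) j - C j - \<rho> m j) - (T (zm m') j - C j - \<rho> m' j)"
              using dvd_trans[OF g(1) TC[OF that(1)]] dvd_trans[OF g(2) TC[OF that(2)]] by (rule dvd_diff)
            then show ?thesis by (simp add: zz_def T_diff algebra_simps)
          qed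
          \<comment> \<open>The modulus whose position comes first. Before that position both
            prescribed residues are zero; at it the digits of \<open>zz\<close> in the two tuples
            are known to agree modulo \<open>g\<close>.\<close>
          obtain a0 where a0: "a0 \<in> {m, m'}" "\<gamma>' a0 \<le> \<gamma>' m" "\<gamma>' a0 \<le> \<gamma>' m'"
            by (metis insertCI linear order_refl)
          have a0B: "a0 \<le> B" using a0(1) mm by auto
          have \<gamma>a0: "\<gamma> a0 \<le> \<gamma> m" "\<gamma> a0 \<le> \<gamma> m'"
            using near_le[OF nr NewI NewI] a0 mm a0B by (auto simp: pNew)
          have le: "\<gamma> a0 \<le> mval g (T zz)"
          proof (rule le_mvalI)
            fix j assume j: "enat j < \<gamma> a0"
            then have j': "enat j < \<gamma> m" "enat j < \<gamma> m'" using \<gamma>a0 by (auto intro: less_le_trans)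
            then have "\<rho> m j = 0" "\<rho> m' j = 0" by (auto simp: \<rho>_def)
            then show "int g dvd T zz j" using unprimed[of j] j' by (simp add: less_imp_le)
          qed
          have "int g dvd T' zz i - (\<rho>' m i - \<rho>' m' i)"
          proof (cases "enat i = \<gamma>' a0")
            case False
            then have i: "enat i < \<gamma>' a0" using mm a0(1) by auto
            then have "enat i < \<gamma>' m" "enat i < \<gamma>' m'" using a0 by (auto intro: less_le_trans)
            moreover have "\<gamma>' a0 \<le> mval g (T' zz)"
              using near_le[OF nr NewI[OF a0B] pOld(3)[OF zz gB]] le by (simp add: pNew pOld zz gB)
            then have "int g dvd T' zz i" using i by (intro mval_dvd) (auto intro: less_le_trans)
            ultimately show ?thesis by (auto simp: \<rho>'_def)
          next
            case True
            then obtain \<delta> where \<delta>: "\<gamma> a0 = enat \<delta>" using \<gamma>inf[OF a0B] by (cases "\<gamma> a0") auto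
            have "dig_eq B' g (T zz \<delta>) (T' zz i)"
              using dig[OF zz gB NewI[OF a0B]] \<delta> True le by (simp add: pNew)
            then have 1: "int g dvd T zz \<delta> - T' zz i" using g0 by (simp add: dig_eq_def)
            have \<rho>\<rho>: "int g dvd \<rho> m1 \<delta> - \<rho>' m1 i" if "m1 \<le> B" for m1
            proof -
              have "\<gamma> a0 = \<gamma> m1 \<longleftrightarrow> \<gamma>' a0 = \<gamma>' m1"
                using near_eq[OF nr NewI[OF a0B] NewI[OF that]] by (simp add: pNew)
              then show ?thesis using \<delta> True \<kappa>\<kappa>'[OF g0 gB, of m1]
                by (cases "\<gamma> m1") (auto simp: \<rho>_def \<rho>'_def)
            qed
            have "int g dvd (T zz \<delta> - (\<rho> m \<delta> - \<rho> m' \<delta>)) - (T zz \<delta> - T' zz i)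
               + ((\<rho> m \<delta> - \<rho>' m i) - (\<rho> m' \<delta> - \<rho>' m' i))"
              using dvd_add[OF dvd_diff[OF unprimed[of \<delta>] 1] dvd_diff[OF \<rho>\<rho>[OF mm(3)] \<rho>\<rho>[OF mm(4)]]]
                \<gamma>a0 \<delta> by simp
            then show ?thesis by (simp add: algebra_simps)
          qed
          then show ?thesis using mm by (simp add: zz_def T_diff algebra_simps)
        qed
        then show "gcd a b dvd ?r a - ?r b" using mm by (simp add: g_def)
      qed
      then obtain x where x: "\<forall>m\<in>?A. m dvd x - ?r m" by blast
      have "int m dvd T' (zm m) i - x - \<rho>' m i" if "m \<le> B" "enat i \<le> \<gamma>' m" for m
      proof -
        have "int m dvd x - (T' (zm m) i - \<rho>' m i)" using x that by auto
        then show ?thesis by (subst (asm) dvd_diff_commute) (simp add: algebra_simps)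
      qed
      then show ?thesis by blast
    qed
    then obtain C' where C': "\<And>i m. m \<le> B \<Longrightarrow> enat i \<le> \<gamma>' m \<Longrightarrow> int m dvd T' (zm m) i - C' i - \<rho>' m i"
      by metis
    \<comment> \<open>If the difference to the best combination shows before
      \<open>\<gamma> m\<close>, it decides the position; otherwise maximality of
      \<open>zm m\<close> puts \<open>z - C\<close> exactly at \<open>\<gamma> m\<close>.\<close>
    define \<iota> where "\<iota> z m = (if mval m (T (zd z m)) < \<gamma> m then OldPos (zd z m) m else NewPos m)" for z m
    have "\<iota> z m \<in> ?I \<union> ?N \<and>
        mval m (\<lambda>k. T z k - C k) = p (\<iota> z m) \<and> mval m (\<lambda>k. T' z k - C' k) = p' (\<iota> z m) \<and>
        (p (\<iota> z m) \<noteq> \<infinity> \<longrightarrow> dig_eq B m (lead m (\<lambda>k. T z k - C k)) (lead m (\<lambda>k. T' z k - C' k)))"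
      if z: "z \<in> coefs n B" and m: "m \<le> B" for z m
    proof -
      note zdz = zd[OF z, of m]
      have split: "(\<lambda>k. T z k - C k) = (\<lambda>k. T (zd z m) k + (T (zm m) k - C k))"
        "(\<lambda>k. T' z k - C' k) = (\<lambda>k. T' (zd z m) k + (T' (zm m) k - C' k))"
        by (auto simp: zd_def T_diff)
      have ge': "\<gamma>' m \<le> mval m (\<lambda>k. T' (zm m) k - C' k)"
      proof (rule le_mvalI)
        fix i assume "enat i < \<gamma>' m"
        then show "int m dvd T' (zm m) i - C' i" using C'[OF m, of i] by (auto simp: \<rho>'_def less_le)
      qed
      show ?thesis
      proof (cases "mval m (T (zd z m)) < \<gamma> m")
        case True
        have 1: "mval m (\<lambda>k. T z k - C k) = mval m (T (zd z m))"
          "int m dvd lead m (\<lambda>k. T z k - C k) - lead m (T (zd z m))"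
          unfolding split using True by (auto simp: \<gamma>_def intro!: mval_diff_less)
        have "mval m (T' (zd z m)) < \<gamma>' m"
          using near_less[OF nr pOld(3)[OF zdz m] NewI[OF m]] True by (simp add: pOld zdz m pNew)
        then have "mval m (T' (zd z m)) < mval m (\<lambda>k. T' (zm m) k - C' k)" using ge' by simp
        then have 2: "mval m (\<lambda>k. T' z k - C' k) = mval m (T' (zd z m))"
          "int m dvd lead m (\<lambda>k. T' z k - C' k) - lead m (T' (zd z m))"
          unfolding split by (auto intro!: mval_diff_less)
        have mB: "m \<le> B'" using m by (simp add: B'_def)
        have "dig_eq B m (lead m (T (zd z m))) (lead m (T' (zd z m)))"
        proof (rule dig_eq_mono)
          have "mval m (T (zd z m)) \<noteq> \<infinity>" using True by (cases "mval m (T (zd z m))") auto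
          then show "dig_eq B' m (lead m (T (zd z m))) (lead m (T' (zd z m)))"
            using data3[OF _ mB] zdz sub(1) by blast
        qed (simp add: B'_def)
        then have "dig_eq B m (lead m (\<lambda>k. T z k - C k)) (lead m (\<lambda>k. T' z k - C' k))"
          by (rule dvd_dig_eq[OF _ iffD1[OF dvd_diff_commute 1(2)] iffD1[OF dvd_diff_commute 2(2)]])
        then show ?thesis using True 1 2 pOld[OF zdz m] by (simp add: \<iota>_def)
      next
        case False
        then have ge: "\<gamma> m \<le> mval m (T (zd z m))" by simp
        have \<gamma>le: "\<gamma> m \<le> mval m (\<lambda>k. T z k - C k)"
        proof (rule le_mvalI)
          fix i assume i: "enat i < \<gamma> m"
          then show "int m dvd T z i - C i"
            using mval_dvd[of i m "T (zd z m)"] mval_dvd[of i m "\<lambda>k. T (zm m) k - C k"] ge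
            unfolding fun_cong[OF split(1)] by (intro dvd_add) (auto simp: \<gamma>_def)
        qed
        then have 1: "mval m (\<lambda>k. T z k - C k) = \<gamma> m" using zm(2)[OF z, of m] by (simp add: \<gamma>_def)
        have le': "\<gamma>' m \<le> mval m (T' (zd z m))"
          using near_le[OF nr NewI[OF m] pOld(3)[OF zdz m]] ge by (simp add: pOld zdz m pNew)
        have \<gamma>le': "\<gamma>' m \<le> mval m (\<lambda>k. T' z k - C' k)"
        proof (rule le_mvalI)
          fix i assume i: "enat i < \<gamma>' m"
          then show "int m dvd T' z i - C' i"
            using mval_dvd[of i m "T' (zd z m)"] mval_dvd[of i m "\<lambda>k. T' (zm m) k - C' k"] le' ge'
            unfolding fun_cong[OF split(2)] by (intro dvd_add) auto
        qed
        show ?thesis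
        proof (cases "\<gamma> m")
          case infinity
          then have "\<gamma>' m = \<infinity>" using \<gamma>inf[OF m] by simp
          then show ?thesis using infinity 1 \<gamma>le' False NewI[OF m] by (simp add: \<iota>_def pNew)
        next
          case \<delta>: (enat \<delta>)
          then obtain \<delta>' where \<delta>': "\<gamma>' m = enat \<delta>'" using \<gamma>inf[OF m] by (cases "\<gamma>' m") auto
          have d1: "int m dvd (\<kappa> m + T (zd z m) \<delta>) - (T z \<delta> - C \<delta>)"
            using TC[of \<delta> m] \<delta> by (simp add: \<rho>_def zd_def T_diff dvd_diff_commute algebra_simps)
          have d2: "int m dvd (\<kappa>' m + T' (zd z m) \<delta>') - (T' z \<delta>' - C' \<delta>')"
            using C'[OF m, of \<delta>'] \<delta>' by (simp add: \<rho>'_def zd_def T_diff dvd_diff_commute algebra_simps)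
          have "dig_eq B m (\<kappa> m + T (zd z m) \<delta>) (\<kappa>' m + T' (zd z m) \<delta>')"
          proof (cases "m = 0")
            case True
            have "z \<in> Z0" using z ge True by (simp add: Z0_def)
            then show ?thesis using \<kappa>0(2)[of z] True \<delta> \<delta>' by (simp add: dig_eq_def \<kappa>'_def)
          next
            case m0: False
            have "dig_eq B' m (T (zd z m) \<delta>) (T' (zd z m) \<delta>')"
              using dig[OF zdz m NewI[OF m]] \<delta> \<delta>' ge by (simp add: pNew)
            then show ?thesis using m0 by (simp add: dig_eq_def \<kappa>'_def)
          qed
          then have dd: "dig_eq B m (T z \<delta> - C \<delta>) (T' z \<delta>' - C' \<delta>')"
            by (rule dvd_dig_eq[OF _ d1 d2])
          \<comment> \<open>Divisibility before \<open>\<gamma>' m\<close> is already known. That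
            the position is no larger carries over from the unprimed side, because
            \<open>dig_eq\<close> preserves divisibility by \<open>m\<close>.\<close>
          have "\<not> int m dvd T z \<delta> - C \<delta>" using 1 \<delta> by (simp add: mval_eq_enat_iff)
          then have "\<not> int m dvd T' z \<delta>' - C' \<delta>'" using dig_eq_0[OF dd] by simp
          then have 2: "mval m (\<lambda>k. T' z k - C' k) = \<gamma>' m"
            using \<gamma>le' \<delta>' by (simp add: mval_eq_enat_iff enat_le_mval_iff)
          show ?thesis using 1 2 dd False NewI[OF m] \<delta> \<delta>' by (simp add: \<iota>_def pNew lead_eq)
        qed
      qed
    qed
    then show ?thesis
      using nr pOrigin pOld(1,2) unfolding T_def T'_def by blast
  qed
  then show ?thesis by (intro exI[of _ B']) (auto simp: B'_def)
qed

text \<open>Every nonzero coefficient of absolute value at most \<open>B\<close> divides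
  \<open>\<Lambda> = B!\<close>. Scaling by the cofactor \<open>q\<close> and a sign turns each
  combination that involves \<open>c\<close> into an old combination minus
  \<open>\<Lambda> c\<close>, the only shape that \<open>data_extend_raw\<close> treats. Since
  \<open>q \<le> \<Lambda>\<close>, coefficients and moduli stay below
  \<open>\<Lambda> * B\<close>.\<close>

lemma data_extend:
  assumes B: "B \<ge> 1"
  shows "\<exists>B'. \<forall>s s'. data_eq n B' s s' \<longrightarrow> (\<forall>i<n. \<forall>c. \<exists>c'. data_eq n B (s(i := c)) (s'(i := c')))"
proof -
  define \<Lambda> :: nat where "\<Lambda> = fact B"
  have \<Lambda>: "\<Lambda> \<ge> 1" "\<And>l. 1 \<le> l \<Longrightarrow> l \<le> B \<Longrightarrow> l dvd \<Lambda>"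
    unfolding \<Lambda>_def by (auto simp: dvd_fact Suc_le_eq)
  define B1 where "B1 = \<Lambda> * B"
  have B1: "B \<le> B1" "\<Lambda> \<le> B1" "B1 \<ge> 1" using \<Lambda>(1) B by (auto simp: B1_def Suc_le_eq)
  obtain B' where B': "B' \<ge> 2 * B1" and ext: "\<And>s s' C. data_eq n B' s s' \<Longrightarrow> (\<exists>C' p p' \<iota>.
     near B1 (old_positions n B1 \<union> NewPos ` {..B1}) p p' \<and> p Origin = 0 \<and> p' Origin = 0 \<and>
     (\<forall>z\<in>coefs n (2 * B1). \<forall>m\<le>B1. p (OldPos z m) = mval m (lin n z s) \<and> p' (OldPos z m) = mval m (lin n z s')) \<and>
     (\<forall>z\<in>coefs n B1. \<forall>m\<le>B1. \<iota> z m \<in> old_positions n B1 \<union> NewPos ` {..B1} \<and>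
        mval m (\<lambda>k. lin n z s k - C k) = p (\<iota> z m) \<and> mval m (\<lambda>k. lin n z s' k - C' k) = p' (\<iota> z m) \<and>
        (p (\<iota> z m) \<noteq> \<infinity> \<longrightarrow>
           dig_eq B1 m (lead m (\<lambda>k. lin n z s k - C k)) (lead m (\<lambda>k. lin n z s' k - C' k)))))"
    using data_extend_raw[OF B1(3), of n] by blast
  have "\<exists>c'. data_eq n B (s(i := c)) (s'(i := c'))" if data: "data_eq n B' s s'" and i: "i < n" for s s' i c
  proof -
    let ?J = "old_positions n B1 \<union> NewPos ` {..B1}"
    define C where "C k = int \<Lambda> * c k" for k
    obtain C' p p' \<iota> where nr: "near B1 ?J p p'" and Org: "p Origin = 0" "p' Origin = 0"
      and Old: "\<forall>z\<in>coefs n (2 * B1). \<forall>m\<le>B1. p (OldPos z m) = mval m (lin n z s) \<and> p' (OldPos z m) = mval m (lin n z s')"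
      and New: "\<forall>z\<in>coefs n B1. \<forall>m\<le>B1. \<iota> z m \<in> ?J \<and>
        mval m (\<lambda>k. lin n z s k - C k) = p (\<iota> z m) \<and> mval m (\<lambda>k. lin n z s' k - C' k) = p' (\<iota> z m) \<and>
        (p (\<iota> z m) \<noteq> \<infinity> \<longrightarrow>
           dig_eq B1 m (lead m (\<lambda>k. lin n z s k - C k)) (lead m (\<lambda>k. lin n z s' k - C' k)))"
      using ext[OF data, of C] by blast
    \<comment> \<open>the zero combination modulo \<open>\<Lambda>\<close> forces \<open>C'\<close> to be divisible by \<open>\<Lambda>\<close>\<close>
    have dvd: "int \<Lambda> dvd C' k" for k
    proof -
      note N = New[rule_format, OF zero_in_coefs B1(2), unfolded lin_zero]
      have "mval \<Lambda> (\<lambda>k. 0 - C k) = \<infinity>" by (simp add: mval_eq_infinity_iff C_def)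
      then have "p (\<iota> (\<lambda>_. 0) \<Lambda>) = \<infinity>" using N by simp
      then have "p' (\<iota> (\<lambda>_. 0) \<Lambda>) = \<infinity>" using near_infinity[OF nr B1(3)] N by blast
      then have "mval \<Lambda> (\<lambda>k. 0 - C' k) = \<infinity>" using N by simp
      then show ?thesis by (simp add: mval_eq_infinity_iff)
    qed
    define c' where "c' k = C' k div int \<Lambda>" for k
    have c': "C' k = int \<Lambda> * c' k" for k using dvd by (simp add: c'_def)
    have idx: "\<exists>j\<in>?J. mval m (lin n z (s(i := c))) = p j \<and> mval m (lin n z (s'(i := c'))) = p' j \<and>
        (p j \<noteq> \<infinity> \<longrightarrow> dig_eq B m (lead m (lin n z (s(i := c)))) (lead m (lin n z (s'(i := c')))))"
      if z: "z \<in> coefs n B" and m: "m \<le> B" for z m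
    proof (cases "z i = 0")
      case True
      then have eq: "lin n z (s(i := c)) = lin n z s" "lin n z (s'(i := c')) = lin n z s'"
        by (auto simp: lin_upd[OF i] fun_upd_idem)
      have z1: "z \<in> coefs n (2 * B1)" "z \<in> coefs n B'" and m1: "m \<le> B1" "m \<le> B'"
        using z m B1 B' coefs_mono[of B "2 * B1" n] coefs_mono[of B B' n] by auto
      have "mval m (lin n z s) \<noteq> \<infinity> \<Longrightarrow> dig_eq B' m (lead m (lin n z s)) (lead m (lin n z s'))"
        using data z1 m1 unfolding data_eq_def by blast
      then show ?thesis unfolding eq using Old z1 m1 B1 B'
        by (intro bexI[of _ "OldPos z m"]) (auto intro: old_positionsI dig_eq_mono[of B'])
    next
      case False
      define q where "q = \<Lambda> div nat \<bar>z i\<bar>"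
      \<comment> \<open>The sign makes the coefficient of \<open>c\<close> equal to
        \<open>- \<Lambda>\<close>, whatever the sign of \<open>z i\<close>.\<close>
      define \<sigma> where "\<sigma> = - sgn (z i)"
      have "nat \<bar>z i\<bar> dvd \<Lambda>" using False z by (intro \<Lambda>(2)) (auto simp: coefs_def le_nat_iff nat_le_iff)
      then have q: "\<Lambda> = q * nat \<bar>z i\<bar>" by (simp add: q_def)
      then have q0: "q > 0" using \<Lambda>(1) by (auto intro!: Nat.gr0I)
      have \<sigma>: "\<bar>\<sigma>\<bar> = 1" using False by (simp add: \<sigma>_def sgn_if)
      have q\<Lambda>: "q \<le> \<Lambda>" using q False by (simp add: q_def div_le_dividend)
      have "int \<Lambda> = int q * \<bar>z i\<bar>" using q by simp
      then have qz: "\<sigma> * int q * z i = - int \<Lambda>" by (simp add: \<sigma>_def sgn_if abs_if)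
      define \<zeta> where "\<zeta> = (\<lambda>j. (\<sigma> * int q) * (z(i := 0)) j)"
      have qB1: "q * B \<le> B1" "q * m \<le> B1" using q\<Lambda> m by (auto simp: B1_def intro: mult_mono)
      have \<zeta>: "\<zeta> \<in> coefs n B1"
      proof -
        have "\<zeta> \<in> coefs n (q * B)" unfolding \<zeta>_def using \<sigma>
          by (intro coefs_scale coefs_upd0 z) (simp add: abs_mult)
        then show ?thesis using coefs_mono[OF qB1(1)] by blast
      qed
      have eq: "(\<lambda>k. lin n \<zeta> s k - C k) = (\<lambda>k. \<sigma> * int q * lin n z (s(i := c)) k)"
        "(\<lambda>k. lin n \<zeta> s' k - C' k) = (\<lambda>k. \<sigma> * int q * lin n z (s'(i := c')) k)"
        unfolding lin_upd[OF i] \<zeta>_def lin_scale C_def c'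
        by (auto simp: distrib_left mult.assoc[symmetric] qz fun_upd_def)
      note N = New[rule_format, OF \<zeta> qB1(2), unfolded eq mval_scale[OF q0 \<sigma>]]
      have "dig_eq B m (lead m (lin n z (s(i := c)))) (lead m (lin n z (s'(i := c'))))"
        if "p (\<iota> \<zeta> (q * m)) \<noteq> \<infinity>"
      proof -
        have "dig_eq B1 (q * m) (\<sigma> * int q * lead m (lin n z (s(i := c)))) (\<sigma> * int q * lead m (lin n z (s'(i := c'))))"
          using N that unfolding lead_def mval_scale[OF q0 \<sigma>] by blast
        then show ?thesis by (rule dig_eq_scale_imp[OF _ \<sigma> q0 qB1(1)])
      qed
      then show ?thesis using N by blast
    qed
    have "data_eq n B (s(i := c)) (s'(i := c'))"
      unfolding data_eq_def
    proof (intro conjI ballI allI impI)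
      fix z z' m m' e assume *: "z \<in> coefs n B" "z' \<in> coefs n B" "m \<le> B" "m' \<le> B" "e \<le> B"
      from idx[OF *(1,3)] idx[OF *(2,4)] obtain j j' where
        j: "j \<in> ?J" "mval m (lin n z (s(i := c))) = p j" "mval m (lin n z (s'(i := c'))) = p' j" and
        j': "j' \<in> ?J" "mval m' (lin n z' (s(i := c))) = p j'" "mval m' (lin n z' (s'(i := c'))) = p' j'"
        by blast
      have "e \<le> B1" using *(5) B1(1) by simp
      from nearD[OF nr j(1) j'(1) this] show "(mval m (lin n z (s(i := c))) + enat e \<le> mval m' (lin n z' (s(i := c)))) =
        (mval m (lin n z (s'(i := c'))) + enat e \<le> mval m' (lin n z' (s'(i := c'))))"
        by (simp only: j j')
    next
      fix z m d assume *: "z \<in> coefs n B" "m \<le> B" "d \<le> B"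
      have "Origin \<in> ?J" by (simp add: old_positions_def)
      then have "0 + enat d \<le> p j \<longleftrightarrow> 0 + enat d \<le> p' j" if "j \<in> ?J" for j
        using nearD[OF nr _ that, of Origin d] Org *(3) B1(1) by simp
      with idx[OF *(1,2)] show "(enat d \<le> mval m (lin n z (s(i := c)))) = (enat d \<le> mval m (lin n z (s'(i := c'))))"
        by auto
    next
      fix z m assume "z \<in> coefs n B" "m \<le> B" "mval m (lin n z (s(i := c))) \<noteq> \<infinity>"
      with idx[of z m] show "dig_eq B m (lead m (lin n z (s(i := c)))) (lead m (lin n z (s'(i := c'))))"
        by auto
    qed
    then show ?thesis by blast
  qed
  then show ?thesis by blast
qed

text \<open>Only the guard on leading digits is one-sided. Shift \<open>1\<close> carries infinity
  across, and for \<open>B = 0\<close> the sole combination is zero.\<close>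

lemma data_eq_sym: "data_eq n B s s' \<Longrightarrow> data_eq n B s' s"
proof -
  assume data: "data_eq n B s s'"
  have "mval m (lin n z s) \<noteq> \<infinity>" if "z \<in> coefs n B" "m \<le> B" "mval m (lin n z s') \<noteq> \<infinity>" for z m
  proof (cases "B = 0")
    case True
    then have "z = (\<lambda>_. 0)" using that by (auto simp: coefs_def)
    then show ?thesis using that by (simp add: lin_zero mval_eq_infinity_iff)
  next
    case False
    then have "mval m (lin n z s) + enat 1 \<le> mval m (lin n z s) \<longleftrightarrow> mval m (lin n z s') + enat 1 \<le> mval m (lin n z s')"
      using data that unfolding data_eq_def by simp
    then show ?thesis using that(3) by (auto simp: zero_enat_def)
  qed
  then show ?thesis using data unfolding data_eq_def dig_eq_def
    by (auto simp: dvd_diff_commute split: if_splits)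
qed

lemma data_eq_mono: "data_eq n B' s s' \<Longrightarrow> B \<le> B' \<Longrightarrow> data_eq n B s s'"
  using coefs_mono[of B B' n] unfolding data_eq_def
  by (meson dig_eq_mono order_trans subsetD)

section \<open>Formulas depend on finitely much data\<close>

fun term_coef :: "oag_term \<Rightarrow> nat \<Rightarrow> int" where
  "term_coef (Var i) = (\<lambda>j. if j = i then 1 else 0)"
| "term_coef ZeroT = (\<lambda>_. 0)"
| "term_coef (PlusT t u) = (\<lambda>j. term_coef t j + term_coef u j)"
| "term_coef (MinusT t) = (\<lambda>j. - term_coef t j)"

lemma term_coef_outside: "i \<notin> term_vars t \<Longrightarrow> term_coef t i = 0"
  by (induction t) auto

lemma val_G1: "term_vars t \<subseteq> {..<n} \<Longrightarrow> val G1 s t k = lin n (term_coef t) s k"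
proof (induction t)
  case (Var i)
  then show ?case by (simp add: lin_def if_distrib[of "\<lambda>x. x * _"] cong: if_cong)
qed (auto simp: G1_def lin_def sum.distrib sum_negf distrib_right)

lemma finite_term_vars: "finite (term_vars t)"
  by (induction t) auto

lemma lex_pos_iff: "lex_pos x \<longleftrightarrow> (\<exists>i. (\<forall>j<i. x j = 0) \<and> x i > 0)"
proof
  assume "lex_pos x"
  then have *: "\<exists>i. x i \<noteq> 0" "x (LEAST i. x i \<noteq> 0) > 0" by (auto simp: lex_pos_def)
  show "\<exists>i. (\<forall>j<i. x j = 0) \<and> x i > 0"
    using *(2) not_less_Least[of _ "\<lambda>i. x i \<noteq> 0"] by blast
next
  assume "\<exists>i. (\<forall>j<i. x j = 0) \<and> x i > 0"
  then obtain i where i: "\<forall>j<i. x j = 0" "x i > 0" by blast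
  then have "(LEAST i. x i \<noteq> 0) = i" by (intro Least_equality) (auto simp: not_le[symmetric])
  then show "lex_pos x" using i by (auto simp: lex_pos_def)
qed

lemma lex_pos_lead: "lex_pos x \<longleftrightarrow> mval 0 x \<noteq> \<infinity> \<and> lead 0 x > 0"
proof
  assume "lex_pos x"
  then obtain i where i: "\<forall>j<i. x j = 0" "x i > 0" by (auto simp: lex_pos_iff)
  then have "mval 0 x = enat i" by (simp add: mval_eq_enat_iff)
  then show "mval 0 x \<noteq> \<infinity> \<and> lead 0 x > 0" using i by (simp add: lead_eq)
next
  assume *: "mval 0 x \<noteq> \<infinity> \<and> lead 0 x > 0"
  then obtain i where "mval 0 x = enat i" by auto
  then show "lex_pos x" using * by (auto simp: lex_pos_iff lead_eq mval_eq_enat_iff)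
qed

lemma data_eq_infinity:
  assumes "data_eq n B s s'" "B \<ge> 1" "z \<in> coefs n B" "m \<le> B"
  shows "mval m (lin n z s) = \<infinity> \<longleftrightarrow> mval m (lin n z s') = \<infinity>"
proof -
  have "mval m (lin n z s) + enat 1 \<le> mval m (lin n z s) \<longleftrightarrow> mval m (lin n z s') + enat 1 \<le> mval m (lin n z s')"
    using assms unfolding data_eq_def by simp
  then show ?thesis by (cases "mval m (lin n z s)"; cases "mval m (lin n z s')") auto
qed

lemma data_eq_lex_pos:
  assumes "data_eq n B s s'" "B \<ge> 1" "z \<in> coefs n B"
  shows "lex_pos (lin n z s) \<longleftrightarrow> lex_pos (lin n z s')"
proof (cases "mval 0 (lin n z s) = \<infinity>")
  case True
  then show ?thesis using data_eq_infinity[OF assms, of 0] by (simp add: lex_pos_lead)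
next
  case False
  then have "dig_eq B 0 (lead 0 (lin n z s)) (lead 0 (lin n z s'))"
    using assms unfolding data_eq_def by blast
  then have "lead 0 (lin n z s) > 0 \<longleftrightarrow> lead 0 (lin n z s') > 0"
    unfolding dig_eq_def clip_eq_iff by auto
  then show ?thesis using False data_eq_infinity[OF assms, of 0] by (simp add: lex_pos_lead)
qed

lemma Univ_G1 [simp]: "Univ G1 = UNIV"
  by (simp add: G1_def)

lemma lessS_G1: "lessS G1 x y \<longleftrightarrow> lex_pos (\<lambda>i. y i - x i)"
  by (simp add: G1_def)

lemma sat_determined_atomic:
  assumes "term_vars t \<union> term_vars u \<subseteq> {..<n}"
  shows "\<exists>B\<ge>1. \<forall>s s'. data_eq n B s s' \<longrightarrow>
     (sat G1 s (EqF t u) \<longleftrightarrow> sat G1 s' (EqF t u)) \<and> (sat G1 s (LessF t u) \<longleftrightarrow> sat G1 s' (LessF t u))"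
proof -
  let ?z = "\<lambda>i. term_coef u i - term_coef t i"
  have "\<exists>B. \<forall>i<n. nat \<bar>?z i\<bar> \<le> B"
    using finite_nat_set_iff_bounded_le[of "(\<lambda>i. nat \<bar>?z i\<bar>) ` {..<n}"] by auto
  then obtain B0 where "\<forall>i<n. nat \<bar>?z i\<bar> \<le> B0" by blast
  moreover have "term_coef u i = 0 \<and> term_coef t i = 0" if "i \<ge> n" for i
    using assms that by (intro conjI term_coef_outside) auto
  ultimately have "?z \<in> coefs n B0"
    unfolding coefs_def by (auto simp: nat_le_iff) (metis abs_zero diff_self not_less of_nat_0_le_iff)
  then have z: "?z \<in> coefs n (max 1 B0)" using coefs_mono[of B0 "max 1 B0" n] by auto
  have val: "val G1 s u k - val G1 s t k = lin n ?z s k" for s k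
    using assms val_G1[of t n s k] val_G1[of u n s k] by (simp add: lin_diff)
  have eq: "sat G1 s (EqF t u) \<longleftrightarrow> mval 0 (lin n ?z s) = \<infinity>" for s
    by (auto simp: mval_eq_infinity_iff fun_eq_iff simp flip: val)
  have lt: "sat G1 s (LessF t u) \<longleftrightarrow> lex_pos (lin n ?z s)" for s
    by (simp add: lessS_G1 val)
  have "(sat G1 s (EqF t u) \<longleftrightarrow> sat G1 s' (EqF t u)) \<and> (sat G1 s (LessF t u) \<longleftrightarrow> sat G1 s' (LessF t u))"
    if "data_eq n (max 1 B0) s s'" for s s'
    unfolding eq lt using data_eq_infinity[OF that _ z, of 0] data_eq_lex_pos[OF that _ z] by simp
  then show ?thesis by (intro exI[of _ "max 1 B0"]) auto
qed

text \<open>Bound variables count as well, so that one \<open>n\<close> serves for all subformulas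
  and a quantifier becomes a change of a coordinate below \<open>n\<close>.\<close>

fun all_vars :: "oag_fm \<Rightarrow> nat set" where
  "all_vars (EqF t u) = term_vars t \<union> term_vars u"
| "all_vars (LessF t u) = term_vars t \<union> term_vars u"
| "all_vars (NotF \<phi>) = all_vars \<phi>"
| "all_vars (AndF \<phi> \<psi>) = all_vars \<phi> \<union> all_vars \<psi>"
| "all_vars (ExF i \<phi>) = insert i (all_vars \<phi>)"

lemma finite_all_vars: "finite (all_vars \<phi>)"
  by (induction \<phi>) (auto simp: finite_term_vars)

text \<open>The quantifier case is one back-and-forth step by \<open>data_extend\<close>;
  \<open>data_eq_sym\<close> supplies the other direction.\<close>

lemma sat_determined:
  assumes "all_vars \<phi> \<subseteq> {..<n}"
  shows "\<exists>B\<ge>1. \<forall>s s'. data_eq n B s s' \<longrightarrow> (sat G1 s \<phi> \<longleftrightarrow> sat G1 s' \<phi>)"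
  using assms
proof (induction \<phi>)
  case (EqF t u) then show ?case using sat_determined_atomic[of t u n] by auto
next
  case (LessF t u) then show ?case using sat_determined_atomic[of t u n] by auto
next
  case (NotF \<phi>) then show ?case by auto
next
  case (AndF \<phi> \<psi>)
  then obtain B1 B2 where "B1 \<ge> 1" "\<forall>s s'. data_eq n B1 s s' \<longrightarrow> (sat G1 s \<phi> \<longleftrightarrow> sat G1 s' \<phi>)"
    "B2 \<ge> 1" "\<forall>s s'. data_eq n B2 s s' \<longrightarrow> (sat G1 s \<psi> \<longleftrightarrow> sat G1 s' \<psi>)" by auto
  then show ?case
    by (intro exI[of _ "max B1 B2"]) (auto dest: data_eq_mono[OF _ max.cobounded1] data_eq_mono[OF _ max.cobounded2])
next
  case (ExF i \<phi>)
  then obtain B where B: "B \<ge> 1" "\<forall>s s'. data_eq n B s s' \<longrightarrow> (sat G1 s \<phi> \<longleftrightarrow> sat G1 s' \<phi>)" and i: "i < n" by auto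
  obtain B' where B': "\<And>s s' c. data_eq n B' s s' \<Longrightarrow> \<exists>c'. data_eq n B (s(i := c)) (s'(i := c'))"
    using data_extend[OF B(1), of n] i by blast
  have imp: "sat G1 s' (ExF i \<phi>)" if data: "data_eq n B' s s'" and ex: "sat G1 s (ExF i \<phi>)" for s s'
  proof -
    obtain c where "sat G1 (s(i := c)) \<phi>" using ex by auto
    moreover obtain c' where "data_eq n B (s(i := c)) (s'(i := c'))" using B' data by blast
    ultimately show ?thesis using B(2) by auto
  qed
  have "sat G1 s (ExF i \<phi>) \<longleftrightarrow> sat G1 s' (ExF i \<phi>)" if "data_eq n (max 1 B') s s'" for s s'
  proof -
    have "data_eq n B' s s'" using data_eq_mono[OF that] by simp
    with imp[of s s'] imp[of s' s] data_eq_sym show ?thesis by blast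
  qed
  then show ?case by (intro exI[of _ "max 1 B'"]) auto
qed

section \<open>Definability of the data\<close>

definition TrueF :: oag_fm where "TrueF = EqF ZeroT ZeroT"
definition AllF :: "nat \<Rightarrow> oag_fm \<Rightarrow> oag_fm" where "AllF i \<phi> = NotF (ExF i (NotF \<phi>))"
definition OrF :: "oag_fm \<Rightarrow> oag_fm \<Rightarrow> oag_fm" where "OrF \<phi> \<psi> = NotF (AndF (NotF \<phi>) (NotF \<psi>))"
definition ImpF :: "oag_fm \<Rightarrow> oag_fm \<Rightarrow> oag_fm" where "ImpF \<phi> \<psi> = NotF (AndF \<phi> (NotF \<psi>))"

fun AndL :: "oag_fm list \<Rightarrow> oag_fm" where
  "AndL [] = TrueF"
| "AndL (\<phi> # \<phi>s) = AndF \<phi> (AndL \<phi>s)"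

fun ExL :: "nat list \<Rightarrow> oag_fm \<Rightarrow> oag_fm" where
  "ExL [] \<phi> = \<phi>"
| "ExL (i # is) \<phi> = ExF i (ExL is \<phi>)"

lemma sat_TrueF [simp]: "sat M s TrueF"
  by (simp add: TrueF_def)

lemma sat_AllF [simp]: "sat M s (AllF i \<phi>) \<longleftrightarrow> (\<forall>x\<in>Univ M. sat M (s(i := x)) \<phi>)"
  by (simp add: AllF_def)

lemma sat_OrF [simp]: "sat M s (OrF \<phi> \<psi>) \<longleftrightarrow> sat M s \<phi> \<or> sat M s \<psi>"
  by (simp add: OrF_def)

lemma sat_ImpF [simp]: "sat M s (ImpF \<phi> \<psi>) \<longleftrightarrow> (sat M s \<phi> \<longrightarrow> sat M s \<psi>)"
  by (simp add: ImpF_def)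

lemma sat_AndL [simp]: "sat M s (AndL \<phi>s) \<longleftrightarrow> (\<forall>\<phi>\<in>set \<phi>s. sat M s \<phi>)"
  by (induction \<phi>s) auto

lemma val_cong: "(\<And>i. i \<in> term_vars t \<Longrightarrow> s i = s' i) \<Longrightarrow> val M s t = val M s' t"
  by (induction t) auto

lemma sat_cong: "(\<And>i. i \<in> free_vars \<phi> \<Longrightarrow> s i = s' i) \<Longrightarrow> sat M s \<phi> \<longleftrightarrow> sat M s' \<phi>"
proof (induction \<phi> arbitrary: s s')
  case (EqF t u)
  then show ?case using val_cong[of t s s'] val_cong[of u s s'] by simp
next
  case (LessF t u)
  then show ?case using val_cong[of t s s'] val_cong[of u s s'] by simp
next
  case (NotF \<phi>)
  have "sat M s \<phi> \<longleftrightarrow> sat M s' \<phi>" using NotF.prems by (intro NotF.IH) auto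
  then show ?case by simp
next
  case (AndF \<phi> \<psi>)
  have "sat M s \<phi> \<longleftrightarrow> sat M s' \<phi>" using AndF.prems by (intro AndF.IH) auto
  moreover have "sat M s \<psi> \<longleftrightarrow> sat M s' \<psi>" using AndF.prems by (intro AndF.IH) auto
  ultimately show ?case by simp
next
  case (ExF i \<phi>)
  have "sat M (s(i := x)) \<phi> \<longleftrightarrow> sat M (s'(i := x)) \<phi>" for x
    using ExF.prems by (intro ExF.IH) auto
  then show ?case by simp
qed

lemma val_upd: "i \<notin> term_vars t \<Longrightarrow> val M (s(i := x)) t = val M s t"
  by (intro val_cong) auto

lemma free_vars_subset: "free_vars \<phi> \<subseteq> all_vars \<phi>"
  by (induction \<phi>) auto

lemma sat_ExL:
  "sat M s (ExL is \<phi>) \<longleftrightarrow> (\<exists>f. (\<forall>i\<in>set is. f i \<in> Univ M) \<and> sat M (\<lambda>i. if i \<in> set is then f i else s i) \<phi>)"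
proof (induction "is" arbitrary: s)
  case (Cons a "is")
  show ?case
  proof
    assume "sat M s (ExL (a # is) \<phi>)"
    then obtain x f where x: "x \<in> Univ M" "\<forall>i\<in>set is. f i \<in> Univ M"
      "sat M (\<lambda>i. if i \<in> set is then f i else (s(a := x)) i) \<phi>" using Cons by auto
    have eq: "(\<lambda>i. if i \<in> set is then f i else (s(a := x)) i) =
       (\<lambda>i. if i \<in> set (a # is) then (if i \<in> set is then f i else x) else s i)" by auto
    show "\<exists>f. (\<forall>i\<in>set (a # is). f i \<in> Univ M) \<and> sat M (\<lambda>i. if i \<in> set (a # is) then f i else s i) \<phi>"
      using x unfolding eq by (intro exI[of _ "\<lambda>i. if i \<in> set is then f i else x"]) auto
  next
    assume "\<exists>f. (\<forall>i\<in>set (a # is). f i \<in> Univ M) \<and> sat M (\<lambda>i. if i \<in> set (a # is) then f i else s i) \<phi>"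
    then obtain f where f: "\<forall>i\<in>set (a # is). f i \<in> Univ M" "sat M (\<lambda>i. if i \<in> set (a # is) then f i else s i) \<phi>" by blast
    have "(\<lambda>i. if i \<in> set (a # is) then f i else s i) = (\<lambda>i. if i \<in> set is then f i else (s(a := f a)) i)" by auto
    then show "sat M s (ExL (a # is) \<phi>)" using f Cons by auto
  qed
qed simp

definition smaller :: "'a oag_struct \<Rightarrow> 'a \<Rightarrow> 'a \<Rightarrow> bool" where
  "smaller M x u \<longleftrightarrow> lessS M (plusS M x x) u \<and> lessS M (plusS M (minusS M x) (minusS M x)) u"

text \<open>In \<open>G1\<close> the units are the elements with leading digit \<open>1\<close>, and \<open>smaller M x u\<close> says that the
  valuation of \<open>x\<close> exceeds that of the unit \<open>u\<close>. Both notions avoid the index set and the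
  digits, which are not part of the structure.\<close>

definition unit_elem :: "'a oag_struct \<Rightarrow> 'a \<Rightarrow> bool" where
  "unit_elem M e \<longleftrightarrow> lessS M (zeroS M) e \<and>
     (\<forall>x\<in>Univ M. lessS M (zeroS M) (plusS M x x) \<and> lessS M (plusS M x x) e \<longrightarrow>
        lessS M (plusS M (plusS M x x) (plusS M x x)) e)"

definition smallerF :: "oag_term \<Rightarrow> oag_term \<Rightarrow> oag_fm" where
  "smallerF t u = AndF (LessF (PlusT t t) u) (LessF (PlusT (MinusT t) (MinusT t)) u)"

definition unitF :: "nat \<Rightarrow> oag_term \<Rightarrow> oag_fm" where
  "unitF i t = AndF (LessF ZeroT t)
     (AllF i (ImpF (AndF (LessF ZeroT (PlusT (Var i) (Var i))) (LessF (PlusT (Var i) (Var i)) t))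
        (LessF (PlusT (PlusT (Var i) (Var i)) (PlusT (Var i) (Var i))) t)))"

lemma sat_smallerF [simp]: "sat M s (smallerF t u) \<longleftrightarrow> smaller M (val M s t) (val M s u)"
  by (simp add: smallerF_def smaller_def)

lemma sat_unitF [simp]: "i \<notin> term_vars t \<Longrightarrow> sat M s (unitF i t) \<longleftrightarrow> unit_elem M (val M s t)"
  by (auto simp: unitF_def unit_elem_def val_upd)

definition unit_at :: "nat \<Rightarrow> (nat \<Rightarrow> int) \<Rightarrow> bool" where
  "unit_at i e \<longleftrightarrow> (\<forall>j<i. e j = 0) \<and> e i = 1"

lemma G1_simps [simp]: "zeroS G1 = (\<lambda>_. 0)" "plusS G1 x y = (\<lambda>i. x i + y i)" "minusS G1 x = (\<lambda>i. - x i)"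
  by (simp_all add: G1_def)

lemma lessS_G1_iff: "lessS G1 x y \<longleftrightarrow> (\<exists>i. (\<forall>j<i. x j = y j) \<and> x i < y i)"
  unfolding lessS_G1 lex_pos_iff by (metis diff_gt_0_iff_gt eq_iff_diff_eq_0)

lemma lessS_G1_zero_iff: "lessS G1 (\<lambda>_. 0) y \<longleftrightarrow> (\<exists>i. (\<forall>j<i. y j = 0) \<and> 0 < y i)"
  unfolding lessS_G1_iff by metis

text \<open>If the leading digit of \<open>e\<close> is \<open>1\<close>, then
  \<open>0 < 2x < e\<close> forces \<open>x\<close> to vanish through that position, so
  \<open>4x\<close> stays below \<open>e\<close>. If it is \<open>k \<ge> 2\<close>, an element with
  digit \<open>h = k div 2\<close> there violates the condition, as
  \<open>2 * h \<le> k < 4 * h\<close>.\<close>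

lemma unit_elem_G1: "unit_elem G1 e \<longleftrightarrow> (\<exists>i. unit_at i e)"
proof
  assume "\<exists>i. unit_at i e"
  then obtain i where i: "\<forall>j<i. e j = 0" "e i = 1" by (auto simp: unit_at_def)
  have "lessS G1 (\<lambda>k. x k + x k + (x k + x k)) e"
    if x: "lessS G1 (\<lambda>_. 0) (\<lambda>k. x k + x k)" "lessS G1 (\<lambda>k. x k + x k) e" for x
  proof -
    obtain a where a: "\<forall>j<a. x j = 0" "x a > 0" using x(1) by (auto simp: lessS_G1_zero_iff)
    obtain b where b: "\<forall>j<b. x j + x j = e j" "x b + x b < e b" using x(2) by (auto simp: lessS_G1_iff)
    have "a > i"
    proof (rule ccontr)
      assume "\<not> a > i"
      then have ai: "a \<le> i" by simp
      have ea: "e a \<le> 1" using i ai by (cases "a = i") auto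
      consider "b < a" | "b = a" | "b > a" by linarith
      then show False
      proof cases
        case 1 then show ?thesis using a(1) b(2) i(1) ai by auto
      next
        case 2 then show ?thesis using a(2) b(2) ea by auto
      next
        case 3
        then have "x a + x a = e a" using b(1) by blast
        then show ?thesis using a(2) ea by linarith
      qed
    qed
    then show ?thesis using a(1) i unfolding lessS_G1_iff by (intro exI[of _ i]) auto
  qed
  moreover have "lessS G1 (\<lambda>_. 0) e" using i unfolding lessS_G1_zero_iff by (intro exI[of _ i]) auto
  ultimately show "unit_elem G1 e" by (simp add: unit_elem_def)
next
  assume unit: "unit_elem G1 e"
  then obtain i where i: "\<forall>j<i. e j = 0" "e i > 0" by (auto simp: unit_elem_def lessS_G1_zero_iff)
  have "e i = 1"
  proof (rule ccontr)
    assume "e i \<noteq> 1"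
    then have k: "e i \<ge> 2" using i by linarith
    define h where "h = e i div 2"
    have h: "h \<ge> 1" "2 * h \<le> e i" "4 * h > e i" using k unfolding h_def by presburger+
    \<comment> \<open>The tail is negative enough for \<open>2x < e\<close> to hold also when
      \<open>2 * h = e i\<close>; the decision then falls at position \<open>i + 1\<close>.\<close>
    define x where "x = (\<lambda>j. if j < i then 0 else if j = i then h else - (\<bar>e j\<bar> + 1))"
    have "lessS G1 (\<lambda>_. 0) (\<lambda>k. x k + x k)"
      unfolding lessS_G1_zero_iff using h by (intro exI[of _ i]) (auto simp: x_def)
    moreover have "lessS G1 (\<lambda>k. x k + x k) e"
    proof (cases "2 * h = e i")
      case True
      then show ?thesis unfolding lessS_G1_iff using i
        by (intro exI[of _ "Suc i"]) (auto simp: x_def less_Suc_eq)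
    next
      case False
      then show ?thesis unfolding lessS_G1_iff using i h
        by (intro exI[of _ i]) (auto simp: x_def)
    qed
    ultimately have "lessS G1 (\<lambda>k. x k + x k + (x k + x k)) e"
      using unit by (simp add: unit_elem_def)
    then obtain b where b: "\<forall>j<b. x j + x j + (x j + x j) = e j" "x b + x b + (x b + x b) < e b"
      by (auto simp: lessS_G1_iff)
    consider "b < i" | "b = i" | "b > i" by linarith
    then show False
    proof cases
      case 1 then show ?thesis using b(2) i by (simp add: x_def)
    next
      case 2 then show ?thesis using b(2) h by (simp add: x_def)
    next
      case 3
      then have "x i + x i + (x i + x i) = e i" using b(1) by blast
      then show ?thesis using h by (simp add: x_def)
    qed
  qed
  then show "\<exists>i. unit_at i e" using i by (auto simp: unit_at_def)
qed

text \<open>The doubling in \<open>smaller\<close> matters: bounding \<open>x\<close> and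
  \<open>- x\<close> by \<open>u\<close> would still allow digit \<open>1\<close> at
  \<open>i\<close> with a smaller tail, whereas \<open>2 * x i = 1\<close> has no solution.\<close>

lemma smaller_G1: "unit_at i u \<Longrightarrow> smaller G1 x u \<longleftrightarrow> (\<forall>j\<le>i. x j = 0)"
proof
  assume u: "unit_at i u" and "\<forall>j\<le>i. x j = 0"
  then show "smaller G1 x u" unfolding smaller_def lessS_G1_iff
    by (auto simp: unit_at_def intro!: exI[of _ i])
next
  assume u: "unit_at i u" and "smaller G1 x u"
  then obtain a b where a: "\<forall>j<a. x j + x j = u j" "x a + x a < u a"
    and b: "\<forall>j<b. - x j + - x j = u j" "- x b + - x b < u b"
    by (auto simp: smaller_def lessS_G1_iff)
  \<comment> \<open>At a first difference \<open>c < i\<close> the unit vanishes, so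
    \<open>y c\<close> would be negative, and then \<open>- 2y\<close> would exceed \<open>u\<close>
    at \<open>c\<close>.\<close>
  have ge: "c \<ge> i" if "\<forall>j<c. y j + y j = u j" "\<forall>j<d. - y j + - y j = u j" "- y d + - y d < u d" "y c + y c < u c"
    for c d y
  proof (rule ccontr)
    assume "\<not> c \<ge> i"
    then have c: "c < i" "y c < 0" using that(4) u by (auto simp: unit_at_def)
    consider "d < c" | "d = c" | "d > c" by linarith
    then show False
    proof cases
      case 1
      then have "y d + y d = u d" "u d = 0" using that(1) c u by (auto simp: unit_at_def)
      then show ?thesis using that(3) by simp
    next
      case 2 then show ?thesis using that(3) c u by (auto simp: unit_at_def)
    next
      case 3
      then have "- y c + - y c = u c" using that(2) by blast
      then show ?thesis using c u by (auto simp: unit_at_def)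
    qed
  qed
  have "a \<ge> i" using ge[OF a(1) b a(2)] .
  have "b \<ge> i" using ge[of b "\<lambda>j. - x j" a] a b by simp
  have x0: "\<forall>j<i. x j = 0"
  proof (intro allI impI)
    fix j assume "j < i"
    then have "x j + x j = u j" "u j = 0" using a(1) \<open>a \<ge> i\<close> u by (auto simp: unit_at_def)
    then show "x j = 0" by simp
  qed
  have even: "y + y \<noteq> (1::int)" for y by presburger
  have "a = i" using \<open>a \<ge> i\<close> a(1) u even by (metis le_neq_implies_less unit_at_def)
  moreover have "b = i" using \<open>b \<ge> i\<close> b(1) u even by (metis le_neq_implies_less unit_at_def)
  ultimately have "x i = 0" using a(2) b(2) u by (auto simp: unit_at_def)
  then show "\<forall>j\<le>i. x j = 0" using x0 by (auto simp: le_less)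
qed

section \<open>Terms for integer multiples and combinations\<close>

fun nmulT :: "nat \<Rightarrow> oag_term \<Rightarrow> oag_term" where
  "nmulT 0 t = ZeroT"
| "nmulT (Suc k) t = PlusT t (nmulT k t)"

definition mulT :: "int \<Rightarrow> oag_term \<Rightarrow> oag_term" where
  "mulT k t = (if k \<ge> 0 then nmulT (nat k) t else MinusT (nmulT (nat (- k)) t))"

fun linT :: "nat \<Rightarrow> (nat \<Rightarrow> int) \<Rightarrow> oag_term" where
  "linT 0 z = ZeroT"
| "linT (Suc n) z = PlusT (linT n z) (mulT (z n) (Var n))"

definition DiffT :: "oag_term \<Rightarrow> oag_term \<Rightarrow> oag_term" where "DiffT t u = PlusT t (MinusT u)"

lemma val_nmulT: "val G1 s (nmulT k t) = (\<lambda>i. int k * val G1 s t i)"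
  by (induction k) (auto simp: distrib_right)

lemma val_mulT [simp]: "val G1 s (mulT k t) = (\<lambda>i. k * val G1 s t i)"
  by (auto simp: mulT_def val_nmulT)

lemma val_linT [simp]: "val G1 s (linT n z) = lin n z s"
  by (induction n) (auto simp: lin_def)

lemma val_DiffT [simp]: "val G1 s (DiffT t u) = (\<lambda>i. val G1 s t i - val G1 s u i)"
  by (simp add: DiffT_def)

lemma term_vars_nmulT: "term_vars (nmulT k t) \<subseteq> term_vars t"
  by (induction k) auto

lemma term_vars_mulT: "term_vars (mulT k t) \<subseteq> term_vars t"
  using term_vars_nmulT by (auto simp: mulT_def)

lemma term_vars_linT: "term_vars (linT n z) \<subseteq> {..<n}"
proof (induction n)
  case (Suc n)
  then show ?case using term_vars_mulT[of "z n" "Var n"] by auto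
qed simp

lemma term_vars_DiffT [simp]: "term_vars (DiffT t u) = term_vars t \<union> term_vars u"
  by (simp add: DiffT_def)

text \<open>In the following formulas the variable \<open>u\<close> stands for a unit, whose position plays the role
  of a natural number; all variables from \<open>u + 1\<close> on may be bound.\<close>

definition gtF :: "nat \<Rightarrow> oag_term \<Rightarrow> nat \<Rightarrow> oag_fm" where
  "gtF m t u = ExF (Suc u) (smallerF (DiffT t (mulT (int m) (Var (Suc u)))) (Var u))"

text \<open>Positions cannot be added inside a formula. The shift \<open>e\<close> is realized by a
  chain of \<open>e\<close> further units, each at a strictly earlier position than the one
  before.\<close>

fun leF :: "nat \<Rightarrow> nat \<Rightarrow> oag_term \<Rightarrow> nat \<Rightarrow> oag_fm" where
  "leF 0 m t u = NotF (gtF m t u)"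
| "leF (Suc e) m t u = ExF (Suc u) (AndF (unitF (u + 2) (Var (Suc u)))
     (AndF (smallerF (Var u) (Var (Suc u))) (leF e m t (Suc u))))"

fun lvlF :: "nat \<Rightarrow> nat \<Rightarrow> oag_fm" where
  "lvlF 0 u = TrueF"
| "lvlF (Suc d) u = ExF (Suc u) (AndF (unitF (u + 2) (Var (Suc u)))
     (AndF (smallerF (Var u) (Var (Suc u))) (lvlF d (Suc u))))"

text \<open>Being \<open>m\<close> times some element through position \<open>i\<close> is a
  condition on each entry separately, because any integer sequence may serve as the
  quotient.\<close>

lemma sat_gtF:
  assumes "term_vars t \<subseteq> {..u}" "unit_at i (s u)"
  shows "sat G1 s (gtF m t u) \<longleftrightarrow> enat i < mval m (val G1 s t)"
proof -
  have v: "val G1 (s(Suc u := y)) t = val G1 s t" for y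
    using assms by (intro val_upd) auto
  have "sat G1 s (gtF m t u) \<longleftrightarrow> (\<exists>y. \<forall>j\<le>i. val G1 s t j = int m * y j)"
    using assms(2) by (simp add: gtF_def v smaller_G1)
  also have "\<dots> \<longleftrightarrow> (\<forall>j\<le>i. int m dvd val G1 s t j)"
    unfolding dvd_def by metis
  finally show ?thesis by (simp add: enat_less_mval_iff)
qed

lemma unit_at_exists: "\<exists>c. unit_at i c"
  by (intro exI[of _ "\<lambda>j. if j = i then 1 else 0"]) (simp add: unit_at_def)

lemma smaller_unit_G1: "unit_at i u \<Longrightarrow> unit_at j c \<Longrightarrow> smaller G1 u c \<longleftrightarrow> j < i"
  by (auto simp: smaller_G1) (auto simp: unit_at_def not_less[symmetric])

lemma sat_leF:
  "term_vars t \<subseteq> {..<u} \<Longrightarrow> unit_at i (s u) \<Longrightarrow>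
     sat G1 s (leF e m t u) \<longleftrightarrow> mval m (val G1 s t) + enat e \<le> enat i"
proof (induction e arbitrary: u s i)
  case 0
  then have "term_vars t \<subseteq> {..u}" by auto
  then show ?case using sat_gtF[of t u i s m] 0(2) by (simp add: zero_enat_def[symmetric] not_less)
next
  case (Suc e)
  have v: "val G1 (s(Suc u := c)) t = val G1 s t" for c
    using Suc.prems by (intro val_upd) auto
  have sub: "term_vars t \<subseteq> {..<Suc u}" using Suc.prems by auto
  have "sat G1 s (leF (Suc e) m t u) \<longleftrightarrow>
     (\<exists>c j. unit_at j c \<and> j < i \<and> mval m (val G1 s t) + enat e \<le> enat j)" (is "?L = ?R")
  proof
    assume ?L
    then obtain c where c: "unit_elem G1 c" "smaller G1 (s u) c" "sat G1 (s(Suc u := c)) (leF e m t (Suc u))"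
      by auto
    then obtain j where j: "unit_at j c" by (auto simp: unit_elem_G1)
    then show ?R using c smaller_unit_G1[OF Suc.prems(2) j] Suc.IH[OF sub, of j "s(Suc u := c)"]
      by (simp only: v fun_upd_same) blast
  next
    assume ?R
    then obtain c j where j: "unit_at j c" "j < i" "mval m (val G1 s t) + enat e \<le> enat j" by blast
    then have "sat G1 (s(Suc u := c)) (leF e m t (Suc u))"
      using Suc.IH[OF sub, of j "s(Suc u := c)"] by (simp only: v fun_upd_same)
    then show ?L using smaller_unit_G1[OF Suc.prems(2) j(1)] j
      by (auto simp: unit_elem_G1 simp del: fun_upd_apply simp add: fun_upd_same fun_upd_other intro!: exI[of _ c])
  qed
  also have "\<dots> \<longleftrightarrow> (\<exists>j<i. mval m (val G1 s t) + enat e \<le> enat j)" using unit_at_exists by blast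
  also have "\<dots> \<longleftrightarrow> mval m (val G1 s t) + enat (Suc e) \<le> enat i"
  proof (cases "mval m (val G1 s t)")
    case (enat p)
    have "(\<exists>j<i. p + e \<le> j) \<longleftrightarrow> p + Suc e \<le> i" by (auto intro: exI[of _ "p + e"])
    then show ?thesis using enat by simp
  qed simp
  finally show ?case .
qed

lemma sat_lvlF: "unit_at i (s u) \<Longrightarrow> sat G1 s (lvlF d u) \<longleftrightarrow> d \<le> i"
proof (induction d arbitrary: u s i)
  case 0
  then show ?case by simp
next
  case (Suc d)
  have "sat G1 s (lvlF (Suc d) u) \<longleftrightarrow> (\<exists>c j. unit_at j c \<and> j < i \<and> d \<le> j)" (is "?L = ?R")
  proof
    assume ?L
    then obtain c where c: "unit_elem G1 c" "smaller G1 (s u) c" "sat G1 (s(Suc u := c)) (lvlF d (Suc u))"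
      by auto
    then obtain j where j: "unit_at j c" by (auto simp: unit_elem_G1)
    then show ?R using c smaller_unit_G1[OF Suc.prems j] Suc.IH[of j "s(Suc u := c)" "Suc u"]
      by (simp only: fun_upd_same) blast
  next
    assume ?R
    then obtain c j where j: "unit_at j c" "j < i" "d \<le> j" by blast
    then have "sat G1 (s(Suc u := c)) (lvlF d (Suc u))"
      using Suc.IH[of j "s(Suc u := c)" "Suc u"] by (simp only: fun_upd_same)
    then show ?L using smaller_unit_G1[OF Suc.prems j(1)] j
      by (auto simp: unit_elem_G1 simp del: fun_upd_apply simp add: fun_upd_same fun_upd_other intro!: exI[of _ c])
  qed
  also have "\<dots> \<longleftrightarrow> Suc d \<le> i" using unit_at_exists
    by (auto simp: Suc_le_eq) (metis order_refl)
  finally show ?case .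
qed

text \<open>The inequality is tested at the finite positions: there must be none that is at or after
  the valuation on the right but before the shifted one on the left. Infinite valuations then need
  no separate clause.\<close>

definition compF :: "nat \<Rightarrow> nat \<Rightarrow> oag_term \<Rightarrow> nat \<Rightarrow> nat \<Rightarrow> oag_term \<Rightarrow> oag_fm" where
  "compF n m t e m' t' = NotF (ExF n (AndF (unitF (Suc n) (Var n)) (AndF (NotF (gtF m' t' n)) (NotF (leF e m t n)))))"

definition atleastF :: "nat \<Rightarrow> nat \<Rightarrow> nat \<Rightarrow> oag_term \<Rightarrow> oag_fm" where
  "atleastF n d m t = NotF (ExF n (AndF (unitF (Suc n) (Var n)) (AndF (NotF (gtF m t n)) (NotF (lvlF d n)))))"

text \<open>The two divisibility conditions force the unit to sit exactly at the position of
  \<open>t\<close>.\<close>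

definition leadF :: "nat \<Rightarrow> nat \<Rightarrow> int \<Rightarrow> oag_term \<Rightarrow> oag_fm" where
  "leadF n m k t = ExF n (AndF (unitF (Suc n) (Var n))
     (AndF (gtF m (DiffT t (mulT k (Var n))) n) (NotF (gtF m t n))))"

lemma sat_compF:
  assumes "term_vars t \<subseteq> {..<n}" "term_vars t' \<subseteq> {..<n}"
  shows "sat G1 s (compF n m t e m' t') \<longleftrightarrow> mval m (val G1 s t) + enat e \<le> mval m' (val G1 s t')"
proof -
  have v: "val G1 (s(n := c)) t = val G1 s t" "val G1 (s(n := c)) t' = val G1 s t'" for c
    using assms by (auto intro!: val_upd)
  have sub: "term_vars t' \<subseteq> {..n}" using assms by auto
  have "sat G1 s (compF n m t e m' t') \<longleftrightarrow> (\<forall>c i. unit_at i c \<longrightarrow> mval m' (val G1 s t') \<le> enat i \<longrightarrow> mval m (val G1 s t) + enat e \<le> enat i)"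
    using sat_gtF[OF sub, of _ "s(n := _)" m'] sat_leF[OF assms(1), of _ "s(n := _)" e m]
    by (auto simp: compF_def unit_elem_G1 v not_less)
  also have "\<dots> \<longleftrightarrow> (\<forall>i. mval m' (val G1 s t') \<le> enat i \<longrightarrow> mval m (val G1 s t) + enat e \<le> enat i)"
    using unit_at_exists by blast
  also have "\<dots> \<longleftrightarrow> mval m (val G1 s t) + enat e \<le> mval m' (val G1 s t')"
    by (cases "mval m' (val G1 s t')") (auto intro: order_trans)
  finally show ?thesis .
qed

lemma sat_atleastF:
  assumes "term_vars t \<subseteq> {..<n}"
  shows "sat G1 s (atleastF n d m t) \<longleftrightarrow> enat d \<le> mval m (val G1 s t)"
proof -
  have v: "val G1 (s(n := c)) t = val G1 s t" for c
    using assms by (auto intro!: val_upd)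
  have sub: "term_vars t \<subseteq> {..n}" using assms by auto
  have "sat G1 s (atleastF n d m t) \<longleftrightarrow> (\<forall>c i. unit_at i c \<longrightarrow> mval m (val G1 s t) \<le> enat i \<longrightarrow> d \<le> i)"
    using sat_gtF[OF sub, of _ "s(n := _)" m] sat_lvlF[of _ "s(n := _)" n d]
    by (auto simp: atleastF_def unit_elem_G1 v not_less)
  also have "\<dots> \<longleftrightarrow> (\<forall>i. mval m (val G1 s t) \<le> enat i \<longrightarrow> d \<le> i)"
    using unit_at_exists by blast
  also have "\<dots> \<longleftrightarrow> enat d \<le> mval m (val G1 s t)"
    by (cases "mval m (val G1 s t)") (auto intro: order_trans)
  finally show ?thesis .
qed

lemma sat_leadF:
  assumes "term_vars t \<subseteq> {..<n}"
  shows "sat G1 s (leadF n m k t) \<longleftrightarrow> mval m (val G1 s t) \<noteq> \<infinity> \<and> int m dvd lead m (val G1 s t) - k"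
proof -
  define x where "x = val G1 s t"
  have v: "val G1 (s(n := c)) t = x" for c
    unfolding x_def using assms by (auto intro!: val_upd)
  have sub: "term_vars t \<subseteq> {..n}" "term_vars (DiffT t (mulT k (Var n))) \<subseteq> {..n}"
    using assms term_vars_mulT[of k "Var n"] by auto
  have "sat G1 s (leadF n m k t) \<longleftrightarrow>
      (\<exists>c i. unit_at i c \<and> enat i < mval m (\<lambda>j. x j - k * c j) \<and> \<not> enat i < mval m x)"
    using sat_gtF[OF sub(1), of _ "s(n := _)" m] sat_gtF[OF sub(2), of _ "s(n := _)" m]
    by (auto simp: leadF_def unit_elem_G1 v) blast+
  also have "\<dots> \<longleftrightarrow> mval m x \<noteq> \<infinity> \<and> int m dvd lead m x - k" (is "?L = ?R")
  proof
    assume ?L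
    then obtain c i where c: "unit_at i c" "\<forall>j\<le>i. int m dvd x j - k * c j" "\<not> (\<forall>j\<le>i. int m dvd x j)"
      by (auto simp: enat_less_mval_iff)
    have d: "int m dvd x j" if "j < i" for j
    proof -
      have "c j = 0" using c(1) that by (simp add: unit_at_def)
      then show ?thesis using c(2)[rule_format, of j] that by simp
    qed
    then have "mval m x = enat i" using c(3) by (auto simp: mval_eq_enat_iff le_less)
    then show ?R using c(1,2) by (auto simp: lead_eq unit_at_def)
  next
    assume R: ?R
    then obtain i where i: "mval m x = enat i" by auto
    then have "int m dvd x i - k" "\<forall>j<i. int m dvd x j" using R by (auto simp: lead_eq mval_eq_enat_iff)
    then show ?L using i
      by (intro exI[of _ "\<lambda>j. if j = i then 1 else 0"] exI[of _ i]) (auto simp: unit_at_def enat_less_mval_iff)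
  qed
  finally show ?thesis by (simp add: x_def)
qed

text \<open>Finitely many test values suffice: for \<open>m > 0\<close> they contain all residues,
  and for \<open>m = 0\<close> all visible digits, beyond which only the sign counts.\<close>

lemma dig_eqI:
  assumes "\<And>k. \<bar>k\<bar> \<le> int B \<Longrightarrow> int m dvd a - k \<longleftrightarrow> int m dvd b - k" "m = 0 \<Longrightarrow> 0 < a \<longleftrightarrow> 0 < b"
    "m \<le> B"
  shows "dig_eq B m a b"
proof (cases "m = 0")
  case True
  then have "a = k \<longleftrightarrow> b = k" if "\<bar>k\<bar> \<le> int B" for k using assms(1)[OF that] by simp
  from this[of a] this[of b] have "\<bar>a\<bar> \<le> int B \<Longrightarrow> a = b" "\<bar>b\<bar> \<le> int B \<Longrightarrow> a = b" by blast+
  moreover have "0 < a \<longleftrightarrow> 0 < b" using assms(2) True by simp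
  ultimately have "clip B a = clip B b" unfolding clip_eq_iff by linarith
  then show ?thesis using True by (simp add: dig_eq_def)
next
  case False
  let ?k = "a mod int m"
  have "0 \<le> ?k" "?k < int m" using False by simp_all
  then have "\<bar>?k\<bar> \<le> int B" using assms(3) by linarith
  moreover have "int m dvd a - ?k" by (simp add: minus_mod_eq_mult_div)
  ultimately have "int m dvd b - ?k" using assms(1) by blast
  with \<open>int m dvd a - ?k\<close> have "int m dvd (a - ?k) - (b - ?k)" by (rule dvd_diff)
  then show ?thesis using False by (simp add: dig_eq_def)
qed

lemma data_eq_formulas:
  "\<exists>\<Delta>. finite \<Delta> \<and> (\<forall>s s'. (\<forall>\<delta>\<in>\<Delta>. sat G1 s \<delta> \<longleftrightarrow> sat G1 s' \<delta>) \<longrightarrow> data_eq n B s s')"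
proof -
  let ?Z = "coefs n B"
  define \<Delta>1 where "\<Delta>1 = (\<lambda>(z, z', m, m', e). compF n m (linT n z) e m' (linT n z')) `
     (?Z \<times> ?Z \<times> {..B} \<times> {..B} \<times> {..B})"
  define \<Delta>2 where "\<Delta>2 = (\<lambda>(z, m, d). atleastF n d m (linT n z)) ` (?Z \<times> {..B} \<times> {..B})"
  define \<Delta>3 where "\<Delta>3 = (\<lambda>(z, m, k). leadF n m k (linT n z)) ` (?Z \<times> {..B} \<times> {- int B..int B})"
  define \<Delta>4 where "\<Delta>4 = (\<lambda>z. LessF ZeroT (linT n z)) ` ?Z"
  \<comment> \<open>Shift \<open>1\<close> detects infinite valuations. It is listed apart because
    \<open>B\<close> may be \<open>0\<close>.\<close>
  define \<Delta>5 where "\<Delta>5 = (\<lambda>(z, m). compF n m (linT n z) 1 m (linT n z)) ` (?Z \<times> {..B})"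
  have fin: "finite (\<Delta>1 \<union> \<Delta>2 \<union> \<Delta>3 \<union> \<Delta>4 \<union> \<Delta>5)"
    unfolding \<Delta>1_def \<Delta>2_def \<Delta>3_def \<Delta>4_def \<Delta>5_def using finite_coefs by auto
  have dat: "data_eq n B s s'" if eq: "\<forall>\<delta>\<in>\<Delta>1 \<union> \<Delta>2 \<union> \<Delta>3 \<union> \<Delta>4 \<union> \<Delta>5. sat G1 s \<delta> \<longleftrightarrow> sat G1 s' \<delta>" for s s'
    unfolding data_eq_def
  proof (intro conjI ballI allI impI)
    fix z z' m m' e assume *: "z \<in> ?Z" "z' \<in> ?Z" "m \<le> B" "m' \<le> B" "e \<le> B"
    then have "compF n m (linT n z) e m' (linT n z') \<in> \<Delta>1" unfolding \<Delta>1_def by force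
    then show "(mval m (lin n z s) + enat e \<le> mval m' (lin n z' s)) = (mval m (lin n z s') + enat e \<le> mval m' (lin n z' s'))"
      using eq unfolding sat_compF[OF term_vars_linT term_vars_linT, of _ n m z e m' z', unfolded val_linT, symmetric]
      by blast
  next
    fix z m d assume *: "z \<in> ?Z" "m \<le> B" "d \<le> B"
    then have "atleastF n d m (linT n z) \<in> \<Delta>2" unfolding \<Delta>2_def by force
    then show "(enat d \<le> mval m (lin n z s)) = (enat d \<le> mval m (lin n z s'))"
      using eq unfolding sat_atleastF[OF term_vars_linT, of _ n d m z, unfolded val_linT, symmetric]
      by blast
  next
    fix z m assume *: "z \<in> ?Z" "m \<le> B" "mval m (lin n z s) \<noteq> \<infinity>"
    have "compF n m (linT n z) 1 m (linT n z) \<in> \<Delta>5" using * unfolding \<Delta>5_def by force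
    then have "mval m (lin n z s) + enat 1 \<le> mval m (lin n z s) \<longleftrightarrow> mval m (lin n z s') + enat 1 \<le> mval m (lin n z s')"
      using eq unfolding sat_compF[OF term_vars_linT term_vars_linT, of _ n m z 1 m z, unfolded val_linT, symmetric]
      by blast
    then have inf': "mval m (lin n z s') \<noteq> \<infinity>" using *(3) by (auto simp: zero_enat_def)
    show "dig_eq B m (lead m (lin n z s)) (lead m (lin n z s'))"
    proof (rule dig_eqI[OF _ _ *(2)])
      fix k assume "\<bar>k\<bar> \<le> int B"
      then have "leadF n m k (linT n z) \<in> \<Delta>3" unfolding \<Delta>3_def using * by (force simp: abs_le_iff)
      then have "sat G1 s (leadF n m k (linT n z)) \<longleftrightarrow> sat G1 s' (leadF n m k (linT n z))"
        using eq by blast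
      then show "(int m dvd lead m (lin n z s) - k) = (int m dvd lead m (lin n z s') - k)"
        using *(3) inf' by (simp add: sat_leadF[OF term_vars_linT])
    next
      assume "m = 0"
      have "LessF ZeroT (linT n z) \<in> \<Delta>4" unfolding \<Delta>4_def using * by auto
      then have "sat G1 s (LessF ZeroT (linT n z)) \<longleftrightarrow> sat G1 s' (LessF ZeroT (linT n z))" using eq by blast
      then have "lex_pos (lin n z s) \<longleftrightarrow> lex_pos (lin n z s')" by (simp add: lessS_G1)
      then show "(0 < lead m (lin n z s)) = (0 < lead m (lin n z s'))"
        using *(3) inf' \<open>m = 0\<close> by (simp add: lex_pos_lead)
    qed
  qed
  show ?thesis by (rule exI, rule conjI, rule fin, intro allI impI, rule dat, assumption)
qed

text \<open>The finitely many formulas that fix the data split the tuples into finitely many truth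
  patterns. An invariant set is a union of patterns, and the disjunction of the patterns occurring
  in it defines it.\<close>

lemma definable_if_data_determined:
  assumes det: "\<And>xs ys. length xs = m \<Longrightarrow> length ys = m \<Longrightarrow>
     data_eq n B (\<lambda>i. if i < m then xs ! i else c i) (\<lambda>i. if i < m then ys ! i else c i) \<Longrightarrow> P xs \<Longrightarrow> P ys"
  shows "definable G1 m {xs \<in> tuples G1 m. P xs}"
proof -
  let ?s = "\<lambda>xs i. if i < m then xs ! i else c i"
  from data_eq_formulas[of n B] obtain \<Delta> where
    "finite \<Delta> \<and> (\<forall>s s'. (\<forall>\<delta>\<in>\<Delta>. sat G1 s \<delta> \<longleftrightarrow> sat G1 s' \<delta>) \<longrightarrow> data_eq n B s s')" ..
  note \<Delta> = conjunct1[OF this] mp[OF spec[OF spec[OF conjunct2[OF this]]]]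
  obtain \<delta>s where \<delta>s: "set \<delta>s = \<Delta>" using finite_list[OF \<Delta>(1)] by blast
  define pat where "pat A = AndL (map (\<lambda>\<delta>. if \<delta> \<in> A then \<delta> else NotF \<delta>) \<delta>s)" for A
  have sat_pat: "sat G1 s (pat A) \<longleftrightarrow> (\<forall>\<delta>\<in>\<Delta>. \<delta> \<in> A \<longleftrightarrow> sat G1 s \<delta>)" for s A
  proof -
    have "sat G1 s (if \<delta> \<in> A then \<delta> else NotF \<delta>) \<longleftrightarrow> (\<delta> \<in> A \<longleftrightarrow> sat G1 s \<delta>)" for \<delta> by simp
    then show ?thesis by (simp only: pat_def sat_AndL set_map \<delta>s ball_simps)
  qed
  define \<A> where "\<A> = (\<lambda>xs. {\<delta> \<in> \<Delta>. sat G1 (?s xs) \<delta>}) ` {xs. length xs = m \<and> P xs}"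
  have "finite \<A>" by (rule finite_subset[of _ "Pow \<Delta>"]) (auto simp: \<A>_def \<Delta>(1))
  then obtain As where As: "set As = \<A>" using finite_list by blast
  define \<Phi> where "\<Phi> = NotF (AndL (map (\<lambda>A. NotF (pat A)) As))"
  have sat\<Phi>: "sat G1 s \<Phi> \<longleftrightarrow> (\<exists>A\<in>\<A>. sat G1 s (pat A))" for s
    by (auto simp: \<Phi>_def As)
  have "P xs \<longleftrightarrow> sat G1 (?s xs) \<Phi>" if xs: "length xs = m" for xs
  proof
    assume "P xs"
    then show "sat G1 (?s xs) \<Phi>" unfolding sat\<Phi> \<A>_def using xs by (auto simp: sat_pat)
  next
    assume "sat G1 (?s xs) \<Phi>"
    then obtain ys where ys: "length ys = m" "P ys" "\<forall>\<delta>\<in>\<Delta>. sat G1 (?s ys) \<delta> \<longleftrightarrow> sat G1 (?s xs) \<delta>"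
      unfolding sat\<Phi> \<A>_def sat_pat by auto
    then show "P xs" using det[OF ys(1) xs \<Delta>(2)[OF ys(3)]] by blast
  qed
  then have "{xs \<in> tuples G1 m. P xs} = {xs \<in> tuples G1 m. sat G1 (?s xs) \<Phi>}"
    by (auto simp: tuples_def)
  then show ?thesis unfolding definable_def by (intro exI[of _ \<Phi>] exI[of _ c]) auto
qed

section \<open>Ultrafilters\<close>

definition ultrafilter :: "'a filter \<Rightarrow> bool" where
  "ultrafilter F \<longleftrightarrow> F \<noteq> bot \<and> (\<forall>P. eventually P F \<or> eventually (\<lambda>x. \<not> P x) F)"

text \<open>Ultrafilters are the minimal proper filters, so Zorn's lemma is applied to the reversed
  order.\<close>

lemma ultrafilter_exists:
  assumes "F \<noteq> bot"
  shows "\<exists>U\<le>F. ultrafilter U"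
proof -
  let ?A = "{G. G \<noteq> bot \<and> G \<le> F}"
  have "\<exists>U\<in>?A. \<forall>G\<in>?A. U \<ge> G \<longrightarrow> G = U"
  proof (rule predicate_Zorn)
    show "partial_order_on ?A (relation_of (\<ge>) ?A)"
      by (auto simp: partial_order_on_def preorder_on_def refl_on_def trans_def antisym_def relation_of_def)
  next
    fix C assume C: "C \<in> Chains (relation_of (\<ge>) ?A)"
    then have sub: "C \<subseteq> ?A" and lin: "\<And>G H. G \<in> C \<Longrightarrow> H \<in> C \<Longrightarrow> G \<le> H \<or> H \<le> G"
      by (auto simp: Chains_def relation_of_def)
    show "\<exists>u\<in>?A. \<forall>a\<in>C. a \<ge> u"
    proof (cases "C = {}")
      case True
      then show ?thesis using assms by auto
    next
      case False
      have "eventually (\<lambda>_. False) (Inf C) \<longleftrightarrow> (\<exists>G\<in>C. eventually (\<lambda>_. False) G)"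
      proof (rule eventually_Inf_base[OF False])
        fix G H assume GH: "G \<in> C" "H \<in> C"
        show "\<exists>x\<in>C. x \<le> inf G H"
          using lin[OF GH] GH by (elim disjE) (rule bexI[of _ G], simp, simp, rule bexI[of _ H], simp, simp)
      qed
      then have "Inf C \<noteq> bot" using sub by (auto simp: trivial_limit_def)
      moreover have "Inf C \<le> F" 
      proof -
        obtain H where "H \<in> C" using False by blast
        then show ?thesis using sub by (intro Inf_lower2[of H]) auto
      qed
      ultimately show ?thesis by (intro bexI[of _ "Inf C"]) (auto intro: Inf_lower)
    qed
  qed
  then obtain U where U: "U \<noteq> bot" "U \<le> F" and max: "\<And>G. G \<noteq> bot \<Longrightarrow> G \<le> F \<Longrightarrow> G \<le> U \<Longrightarrow> G = U" by blast
  have "eventually P U \<or> eventually (\<lambda>x. \<not> P x) U" for P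
  proof (rule disjCI)
    assume *: "\<not> eventually (\<lambda>x. \<not> P x) U"
    \<comment> \<open>Adjoining the set of \<open>P\<close> gives a finer proper filter, which
      minimality identifies with \<open>U\<close>.\<close>
    let ?G = "inf U (principal {x. P x})"
    have "?G \<noteq> bot" using * by (simp add: trivial_limit_def eventually_inf_principal)
    then have "?G = U" using U(2) by (intro max) (auto intro: le_infI1)
    moreover have "eventually P ?G" by (simp add: eventually_inf_principal)
    ultimately show "eventually P U" by simp
  qed
  then show ?thesis using U by (auto simp: ultrafilter_def)
qed

lemma ultrafilter_not: "ultrafilter U \<Longrightarrow> (\<forall>\<^sub>F x in U. \<not> P x) \<longleftrightarrow> \<not> (\<forall>\<^sub>F x in U. P x)"
proof -
  assume U: "ultrafilter U"
  have "\<not> (eventually (\<lambda>x. \<not> P x) U \<and> eventually P U)"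
  proof
    assume "eventually (\<lambda>x. \<not> P x) U \<and> eventually P U"
    then have "eventually (\<lambda>x. \<not> P x \<and> P x) U" by (simp only: eventually_conj_iff)
    then show False using U by (simp add: ultrafilter_def trivial_limit_def)
  qed
  moreover have "eventually P U \<or> eventually (\<lambda>x. \<not> P x) U" using U unfolding ultrafilter_def by blast
  ultimately show ?thesis by blast
qed

lemma ultrafilter_disj: "ultrafilter U \<Longrightarrow> (\<forall>\<^sub>F x in U. P x \<or> Q x) \<longleftrightarrow> (\<forall>\<^sub>F x in U. P x) \<or> (\<forall>\<^sub>F x in U. Q x)"
  using ultrafilter_not[of U "\<lambda>x. \<not> P x \<and> \<not> Q x"] ultrafilter_not[of U P] ultrafilter_not[of U Q]
  by (auto simp: eventually_conj_iff)

lemma ultrafilter_finite_values: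
  assumes "ultrafilter U" "finite S" "\<forall>\<^sub>F j in U. f j \<in> S"
  shows "\<exists>v\<in>S. \<forall>\<^sub>F j in U. f j = v"
  using assms(2,3)
proof (induction S rule: finite_induct)
  case empty
  then show ?case using assms(1) by (simp add: ultrafilter_def trivial_limit_def)
next
  case (insert a S)
  then have "(\<forall>\<^sub>F j in U. f j = a) \<or> (\<forall>\<^sub>F j in U. f j \<in> S)"
    using ultrafilter_disj[OF assms(1)] by simp
  then show ?case using insert.IH by auto
qed

section \<open>Limits of integer sequences along an ultrafilter\<close>

text \<open>\<open>g\<close> is minus the limit. Residues modulo \<open>m > 0\<close> take finitely
  many values and therefore always converge. At modulus \<open>0\<close> a digit lying between two
  bounds almost everywhere converges too, so one that does not converge tends to plus or minus
  infinity; \<open>i0\<close> is the first such position, or \<open>\<infinity>\<close> if there is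
  none.\<close>

lemma digit_limit:
  fixes \<beta> :: "'j \<Rightarrow> nat \<Rightarrow> int"
  assumes U: "ultrafilter U"
  shows "\<exists>g i0. (\<forall>i. enat i < i0 \<longrightarrow> (\<forall>\<^sub>F j in U. int m dvd \<beta> j i + g i)) \<and>
     (\<forall>i. i0 = enat i \<longrightarrow> m = 0 \<and> ((\<forall>C. \<forall>\<^sub>F j in U. \<beta> j i > C) \<or> (\<forall>C. \<forall>\<^sub>F j in U. \<beta> j i < C)))"
proof (cases "m = 0")
  case False
  have "\<exists>v. \<forall>\<^sub>F j in U. int m dvd \<beta> j i + v" for i
  proof -
    have "\<exists>v\<in>{0..<int m}. \<forall>\<^sub>F j in U. \<beta> j i mod int m = v"
      using False by (intro ultrafilter_finite_values[OF U]) auto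
    then obtain v where v: "\<forall>\<^sub>F j in U. \<beta> j i mod int m = v" by blast
    have "\<forall>\<^sub>F j in U. int m dvd \<beta> j i + (- v)"
      using v by eventually_elim (auto simp: minus_mod_eq_mult_div)
    then show ?thesis by blast
  qed
  then obtain g where "\<And>i. \<forall>\<^sub>F j in U. int m dvd \<beta> j i + g i" by metis
  then show ?thesis by (intro exI[of _ g] exI[of _ \<infinity>]) auto
next
  case True
  define conv where "conv i \<longleftrightarrow> (\<exists>v. \<forall>\<^sub>F j in U. \<beta> j i = v)" for i
  define g where "g i = (if conv i then - (SOME v. \<forall>\<^sub>F j in U. \<beta> j i = v) else 0)" for i
  have g: "\<forall>\<^sub>F j in U. \<beta> j i + g i = 0" if "conv i" for i
  proof -
    have "\<forall>\<^sub>F j in U. \<beta> j i = (SOME v. \<forall>\<^sub>F j in U. \<beta> j i = v)"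
      using that unfolding conv_def by (rule someI_ex)
    then show ?thesis by eventually_elim (simp add: g_def that)
  qed
  have unb: "(\<forall>C. \<forall>\<^sub>F j in U. \<beta> j i > C) \<or> (\<forall>C. \<forall>\<^sub>F j in U. \<beta> j i < C)" if "\<not> conv i" for i
  proof (rule ccontr)
    assume "\<not> ?thesis"
    then obtain C1 C2 where "\<not> (\<forall>\<^sub>F j in U. \<beta> j i > C1)" "\<not> (\<forall>\<^sub>F j in U. \<beta> j i < C2)" by blast
    then have "\<forall>\<^sub>F j in U. \<not> \<beta> j i > C1" "\<forall>\<^sub>F j in U. \<not> \<beta> j i < C2"
      by (simp_all only: ultrafilter_not[OF U] not_False_eq_True)
    then have "\<forall>\<^sub>F j in U. \<beta> j i \<in> {C2..C1}" by eventually_elim auto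
    then have "\<exists>v\<in>{C2..C1}. \<forall>\<^sub>F j in U. \<beta> j i = v" by (intro ultrafilter_finite_values[OF U]) auto
    then show False using that by (auto simp: conv_def)
  qed
  define i0 where "i0 = (if \<forall>i. conv i then \<infinity> else enat (LEAST i. \<not> conv i))"
  have "conv i" if "enat i < i0" for i
    using that not_less_Least[of i "\<lambda>i. \<not> conv i"] by (auto simp: i0_def split: if_splits)
  moreover have "\<not> conv i" if "i0 = enat i" for i
    using that LeastI_ex[of "\<lambda>i. \<not> conv i"] by (auto simp: i0_def split: if_splits)
  ultimately show ?thesis using g unb True by (intro exI[of _ g] exI[of _ i0]) auto
qed

lemma min_plus_le_min_iff:
  fixes a a' d d' e :: enat
  shows "min a d + e \<le> min a' d' \<longleftrightarrow> (a + e \<le> a' \<or> d + e \<le> a') \<and> (a + e \<le> d' \<or> d + e \<le> d')"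
proof -
  have "min a d + e = min (a + e) (d + e)"
    by (cases "a \<le> d") (auto simp: min_def dest: add_right_mono[of _ _ e])
  then show ?thesis by (simp add: min_le_iff_disj)
qed

lemma eventually_mval_const:
  assumes X: "mval m X < i0"
    and \<gamma>: "\<And>i. enat i < i0 \<Longrightarrow> \<forall>\<^sub>F j in U. int m dvd \<gamma> j i"
  shows "\<forall>\<^sub>F j in U. mval m (\<lambda>k. X k + \<gamma> j k) = mval m X \<and> int m dvd lead m (\<lambda>k. X k + \<gamma> j k) - lead m X"
proof -
  obtain i where i: "mval m X = enat i" using X by (cases "mval m X") auto
  have "\<forall>\<^sub>F j in U. \<forall>k\<in>{..i}. int m dvd \<gamma> j k"
  proof (intro eventually_ball_finite ballI)
    fix k assume "k \<in> {..i}"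
    then have "enat k < i0" using X i order.strict_trans1[of "enat k" "enat i" i0] by simp
    then show "\<forall>\<^sub>F j in U. int m dvd \<gamma> j k" by (rule \<gamma>)
  qed simp
  then show ?thesis
  proof eventually_elim
    case (elim j)
    then have "mval m X < mval m (\<gamma> j)" using i by (simp add: enat_less_mval_iff)
    then show ?case using mval_diff_less by blast
  qed
qed

lemma eventually_mval_ge:
  assumes \<gamma>: "\<And>i. \<forall>\<^sub>F j in U. int m dvd \<gamma> j i"
  shows "\<forall>\<^sub>F j in U. enat K \<le> mval m (\<gamma> j)"
proof -
  have "\<forall>\<^sub>F j in U. \<forall>k\<in>{..<K}. int m dvd \<gamma> j k"
    using \<gamma> by (intro eventually_ball_finite ballI) auto
  then show ?thesis by eventually_elim (simp add: enat_le_mval_iff)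
qed

text \<open>For each pair of a combination \<open>z\<close> and a modulus \<open>m\<close> the
  sequence \<open>g z m\<close> is appended as a parameter. \<open>X x z m\<close> is the limiting
  combination, and \<open>pv x z m\<close> its position, cut off at \<open>i0\<close> where the
  digits diverge. A finite \<open>pv\<close> is almost everywhere the true position; an infinite one
  means that the true position does not depend on \<open>x\<close> and exceeds every bound almost
  everywhere.\<close>

lemma limit_data:
  fixes b :: "'j \<Rightarrow> nat \<Rightarrow> nat \<Rightarrow> int"
  assumes U: "ultrafilter U" and m0: "m0 \<le> n" and B: "B \<ge> 1"
  shows "\<exists>n' B' c. \<forall>x x'. data_eq n' B' (\<lambda>i. if i < m0 then x i else c i) (\<lambda>i. if i < m0 then x' i else c i) \<longrightarrow>
     (\<forall>\<^sub>F j in U. data_eq n B (\<lambda>i. if i < m0 then x i else b j i) (\<lambda>i. if i < m0 then x' i else b j i))"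
proof -
  define Q where "Q = coefs n B \<times> {..B}"
  have finQ: "finite Q" by (simp add: Q_def finite_coefs)
  obtain qs where qs: "set qs = Q" using finite_list[OF finQ] by blast
  define \<beta> where "\<beta> z j = lin n (\<lambda>i. if i < m0 then 0 else z i) (b j)" for z j
  define is_limit where "is_limit z m g i0 \<longleftrightarrow>
     (\<forall>i. enat i < i0 \<longrightarrow> (\<forall>\<^sub>F j in U. int m dvd \<beta> z j i + g i)) \<and>
     (\<forall>i. i0 = enat i \<longrightarrow> m = 0 \<and> ((\<forall>C. \<forall>\<^sub>F j in U. \<beta> z j i > C) \<or> (\<forall>C. \<forall>\<^sub>F j in U. \<beta> z j i < C)))" for z m g i0
  have "\<exists>g i0. is_limit z m g i0" for z m
    unfolding is_limit_def by (rule digit_limit[OF U])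
  then obtain g i0 where lim: "\<And>z m. is_limit z m (g z m) (i0 z m)" by metis
  have g: "\<forall>\<^sub>F j in U. int m dvd \<beta> z j i + g z m i" if "enat i < i0 z m" for z m i
    using lim[of z m] that unfolding is_limit_def by blast
  have i0: "m = 0 \<and> ((\<forall>C. \<forall>\<^sub>F j in U. \<beta> z j i > C) \<or> (\<forall>C. \<forall>\<^sub>F j in U. \<beta> z j i < C))"
    if "i0 z m = enat i" for z m i
    using lim[of z m] that unfolding is_limit_def by blast
  have "\<exists>K. \<forall>q\<in>Q. the_enat (i0 (fst q) (snd q)) \<le> K"
    using finite_nat_set_iff_bounded_le[of "(\<lambda>q. the_enat (i0 (fst q) (snd q))) ` Q"] finQ by auto
  then obtain K where K: "\<And>z m. (z, m) \<in> Q \<Longrightarrow> the_enat (i0 z m) \<le> K" by fastforce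
  have "\<exists>r<length qs. qs ! r = q" if "q \<in> Q" for q using that qs by (metis in_set_conv_nth)
  then obtain idx where idx: "\<And>q. q \<in> Q \<Longrightarrow> idx q < length qs \<and> qs ! idx q = q" by metis
  define n' where "n' = n + length qs"
  \<comment> \<open>\<open>K\<close> bounds the finite cut-off positions, with which valuations must
    be compared; the \<open>+ 1\<close> pays for turning an upper bound into a negated lower
    bound.\<close>
  define B' where "B' = B + K + 1"
  \<comment> \<open>For \<open>m0 \<le> i < n\<close> the truncated index picks an arbitrary
    sequence; \<open>\<zeta>\<close> has coefficient \<open>0\<close> at these places.\<close>
  define c where "c i = (case qs ! (i - n) of (z, m) \<Rightarrow> g z m)" for i
  define \<zeta> where "\<zeta> z m i = (if i < m0 then z i else if i = n + idx (z, m) then - 1 else (0::int))" for z m i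
  have \<zeta>: "\<zeta> z m \<in> coefs n' B'" if "(z, m) \<in> Q" for z m
  proof -
    have z: "\<bar>z i\<bar> \<le> int B" for i using that by (auto simp: Q_def coefs_def)
    have "\<bar>\<zeta> z m i\<bar> \<le> int B'" for i using z[of i] B by (auto simp: \<zeta>_def B'_def)
    moreover have "\<zeta> z m i = 0" if "i \<ge> n'" for i
      using that m0 idx[OF \<open>(z, m) \<in> Q\<close>] by (auto simp: \<zeta>_def n'_def)
    ultimately show ?thesis by (simp add: coefs_def)
  qed
  define \<sigma> where "\<sigma> x = (\<lambda>i. if i < m0 then x i else c i)" for x
  define \<tau> where "\<tau> x j = (\<lambda>i. if i < m0 then x i else b j i)" for x j
  define X where "X x z m = lin n' (\<zeta> z m) (\<sigma> x)" for x z m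
  have X_eq: "X x z m k = (\<Sum>i<m0. z i * x i k) - g z m k" if q: "(z, m) \<in> Q" for x z m k
  proof -
    let ?r = "n + idx (z, m)"
    have fin: "finite {..<n'}" "?r \<in> {..<n'}" using idx[OF q] by (auto simp: n'_def)
    have r: "\<not> ?r < m0" "c ?r = g z m" using m0 idx[OF q] by (auto simp: c_def)
    have "X x z m k = \<zeta> z m ?r * \<sigma> x ?r k + (\<Sum>i\<in>{..<n'} - {?r}. \<zeta> z m i * \<sigma> x i k)"
      unfolding X_def lin_def by (rule sum.remove[OF fin])
    also have "(\<Sum>i\<in>{..<n'} - {?r}. \<zeta> z m i * \<sigma> x i k) = (\<Sum>i<m0. z i * x i k)"
      using r m0 by (intro sum.mono_neutral_cong_right) (auto simp: \<zeta>_def \<sigma>_def n'_def)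
    finally show ?thesis using r by (simp add: \<zeta>_def \<sigma>_def)
  qed
  have lin_eq: "lin n z (\<tau> x j) = (\<lambda>k. X x z m k + (\<beta> z j k + g z m k))" if q: "(z, m) \<in> Q" for x z m j
  proof
    fix k
    have "lin n z (\<tau> x j) k = (\<Sum>i<n. (if i < m0 then z i * x i k else 0) + (if i < m0 then 0 else z i) * b j i k)"
      unfolding lin_def \<tau>_def by (intro sum.cong) auto
    also have "\<dots> = (\<Sum>i<n. if i < m0 then z i * x i k else 0) + \<beta> z j k"
      by (simp add: sum.distrib \<beta>_def lin_def)
    also have "(\<Sum>i<n. if i < m0 then z i * x i k else 0) = (\<Sum>i<m0. z i * x i k)"
      using m0 by (intro sum.mono_neutral_cong_right) auto
    finally show "lin n z (\<tau> x j) k = X x z m k + (\<beta> z j k + g z m k)" by (simp add: X_eq[OF q])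
  qed
  define pv where "pv x z m = min (mval m (X x z m)) (i0 z m)" for x z m
  define h where "h z m j = (\<lambda>k. \<beta> z j k + g z m k)" for z m j
  have pv_fin: "\<forall>\<^sub>F j in U. mval m (lin n z (\<tau> x j)) = pv x z m" if q: "(z, m) \<in> Q" and fin: "pv x z m \<noteq> \<infinity>" for x z m
  proof (cases "mval m (X x z m) < i0 z m")
    case True
    then show ?thesis using eventually_mval_const[OF True, of "h z m" U] g unfolding lin_eq[OF q] h_def pv_def
      by (auto elim: eventually_mono)
  next
    case False
    then have pv: "pv x z m = i0 z m" by (simp add: pv_def)
    then obtain i where i: "i0 z m = enat i" using fin by auto
    have m: "m = 0" using i0[OF i] by blast
    have lt: "\<forall>\<^sub>F j in U. \<forall>k\<in>{..<i}. int m dvd \<beta> z j k + g z m k"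
      using g[of _ z m] i by (intro eventually_ball_finite ballI) auto
    \<comment> \<open>At the divergent position the digit of \<open>\<beta>\<close> leaves every
      fixed value, in particular the one that would cancel the rest.\<close>
    have "\<forall>\<^sub>F j in U. \<beta> z j i \<noteq> - (X x z m i + g z m i)"
      using i0[OF i] by (auto elim!: allE[of _ "- (X x z m i + g z m i)"] elim: eventually_mono)
    with lt show ?thesis
    proof eventually_elim
      case (elim j)
      have "\<forall>k<i. X x z m k = 0"
        using False i m enat_le_mval_iff[of i m "X x z m"] by (simp add: not_less)
      then have "mval m (lin n z (\<tau> x j)) = enat i"
        using elim m unfolding lin_eq[OF q] mval_eq_enat_iff by auto
      then show ?case using pv i by simp
    qed
  qed
  have pv_inf: "mval m (lin n z (\<tau> x j)) = mval m (h z m j) \<and> int m dvd lead m (lin n z (\<tau> x j)) - lead m (h z m j)"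
    "\<forall>\<^sub>F j in U. enat l \<le> mval m (h z m j)"
    if q: "(z, m) \<in> Q" and inf: "pv x z m = \<infinity>" for x z m j l
  proof -
    have inf: "mval m (X x z m) = \<infinity>" "i0 z m = \<infinity>" using inf by (auto simp: pv_def min_def split: if_splits)
    then have dvd: "int m dvd X x z m k" for k by (simp add: mval_eq_infinity_iff)
    have eq: "mval m (lin n z (\<tau> x j)) = mval m (h z m j)"
      unfolding lin_eq[OF q] h_def by (rule mval_cong) (simp add: dvd)
    then show "mval m (lin n z (\<tau> x j)) = mval m (h z m j) \<and> int m dvd lead m (lin n z (\<tau> x j)) - lead m (h z m j)"
      unfolding lead_def eq by (simp add: lin_eq[OF q] h_def dvd)
    show "\<forall>\<^sub>F j in U. enat l \<le> mval m (h z m j)"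
      using g[of _ z m] inf(2) by (intro eventually_mval_ge) (simp add: h_def)
  qed
  have "\<forall>\<^sub>F j in U. data_eq n B (\<tau> x j) (\<tau> x' j)" if data: "data_eq n' B' (\<sigma> x) (\<sigma> x')" for x x'
  proof -
    have BB': "B \<le> B'" "1 \<le> B'" by (auto simp: B'_def)
    have d1: "mval m (X x z m) + enat e \<le> mval m' (X x z' m') \<longleftrightarrow> mval m (X x' z m) + enat e \<le> mval m' (X x' z' m')"
      if "(z, m) \<in> Q" "(z', m') \<in> Q" "e \<le> B" for z m z' m' e
      using data \<zeta>[OF that(1)] \<zeta>[OF that(2)] that BB' unfolding data_eq_def X_def Q_def by auto
    have d2: "enat d \<le> mval m (X x z m) \<longleftrightarrow> enat d \<le> mval m (X x' z m)" if "(z, m) \<in> Q" "d \<le> B'" for z m d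
      using data \<zeta>[OF that(1)] that BB' unfolding data_eq_def X_def Q_def by auto
    have d3: "dig_eq B m (lead m (X x z m)) (lead m (X x' z m))" if "(z, m) \<in> Q" "mval m (X x z m) \<noteq> \<infinity>" for z m
    proof (rule dig_eq_mono[OF _ BB'(1)])
      have "m \<le> B'" using that BB' by (auto simp: Q_def)
      then show "dig_eq B' m (lead m (X x z m)) (lead m (X x' z m))"
        using data \<zeta>[OF that(1)] that(2) unfolding data_eq_def X_def by blast
    qed
    have dinf: "mval m (X x z m) = \<infinity> \<longleftrightarrow> mval m (X x' z m) = \<infinity>" if "(z, m) \<in> Q" for z m
      using data_eq_infinity[OF data BB'(2) \<zeta>[OF that]] that BB' by (auto simp: X_def Q_def)
    have pv: "pv x z m + enat e \<le> pv x z' m' \<longleftrightarrow> pv x' z m + enat e \<le> pv x' z' m'"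
      if q: "(z, m) \<in> Q" "(z', m') \<in> Q" "e \<le> B" for z m z' m' e
    proof -
      have "i0 z m + enat e \<le> mval m' (X x z' m') \<longleftrightarrow> i0 z m + enat e \<le> mval m' (X x' z' m')"
      proof (cases "i0 z m")
        case (enat d)
        then have "d + e \<le> B'" using K[OF q(1)] q(3) by (simp add: B'_def)
        then show ?thesis using d2[OF q(2)] enat by simp
      next
        case infinity
        then show ?thesis using dinf[OF q(2)] by simp
      qed
      moreover have "mval m (X x z m) + enat e \<le> i0 z' m' \<longleftrightarrow> mval m (X x' z m) + enat e \<le> i0 z' m'"
      proof (cases "i0 z' m'")
        case (enat d)
        \<comment> \<open>The second clause of the data compares with fixed numbers only from below,
          so an upper bound is read as a negated lower bound.\<close>
        have sw: "p + enat e \<le> enat d \<longleftrightarrow> e \<le> d \<and> \<not> enat (d - e + 1) \<le> p" for p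
          by (cases p) auto
        have "d - e + 1 \<le> B'" using K[OF q(2)] enat by (simp add: B'_def)
        then show ?thesis unfolding enat sw using d2[OF q(1)] by simp
      qed simp
      ultimately show ?thesis unfolding pv_def min_plus_le_min_iff using d1[OF q] by simp
    qed
    have pv_inf_iff: "pv x z m = \<infinity> \<longleftrightarrow> pv x' z m = \<infinity>" if "(z, m) \<in> Q" for z m
      using dinf[OF that] by (auto simp: pv_def min_def split: if_splits)
    have 1: "\<forall>\<^sub>F j in U. mval m (lin n z (\<tau> x j)) + enat e \<le> mval m' (lin n z' (\<tau> x j)) \<longleftrightarrow>
        mval m (lin n z (\<tau> x' j)) + enat e \<le> mval m' (lin n z' (\<tau> x' j))"
      if q: "(z, m) \<in> Q" "(z', m') \<in> Q" "e \<le> B" for z m z' m' e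
    \<comment> \<open>Two infinite limits give the same pair of positions for \<open>x\<close> and
      \<open>x'\<close> at every \<open>j\<close>. A single infinite limit eventually exceeds
      whatever the finite one demands, and two finite limits are compared through
      \<open>pv\<close>.\<close>
    proof (cases "pv x z m = \<infinity>"; cases "pv x z' m' = \<infinity>")
      assume A: "pv x z m = \<infinity>" "pv x z' m' = \<infinity>"
      then have "pv x' z m = \<infinity>" "pv x' z' m' = \<infinity>" using pv_inf_iff q by auto
      then show ?thesis using pv_inf(1)[OF q(1)] pv_inf(1)[OF q(2)] A by simp
    next
      assume A: "pv x z m = \<infinity>" "pv x z' m' \<noteq> \<infinity>"
      then have A': "pv x' z m = \<infinity>" "pv x' z' m' \<noteq> \<infinity>" using pv_inf_iff q by auto
      obtain p p' where p: "pv x z' m' = enat p" "pv x' z' m' = enat p'" using A A' by auto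
      from pv_fin[OF q(2) A(2)] pv_fin[OF q(2) A'(2)] pv_inf(2)[OF q(1) A(1), of "p + p' + 1"]
      show ?thesis
      proof eventually_elim
        case (elim j)
        have "\<not> y + enat e \<le> enat p" "\<not> y + enat e \<le> enat p'" if "enat (p + p' + 1) \<le> y" for y
          using that by (cases y; simp)+
        then show ?case using elim pv_inf(1)[OF q(1) A(1)] pv_inf(1)[OF q(1) A'(1)] p by simp
      qed
    next
      assume A: "pv x z m \<noteq> \<infinity>" "pv x z' m' = \<infinity>"
      then have A': "pv x' z m \<noteq> \<infinity>" "pv x' z' m' = \<infinity>" using pv_inf_iff q by auto
      obtain p p' where p: "pv x z m = enat p" "pv x' z m = enat p'" using A A' by auto
      from pv_fin[OF q(1) A(1)] pv_fin[OF q(1) A'(1)] pv_inf(2)[OF q(2) A(2), of "p + p' + e"]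
      show ?thesis
      proof eventually_elim
        case (elim j)
        have "enat p + enat e \<le> y" "enat p' + enat e \<le> y" if "enat (p + p' + e) \<le> y" for y
          using that by (cases y; simp)+
        then show ?case using elim pv_inf(1)[OF q(2) A(2)] pv_inf(1)[OF q(2) A'(2)] p by simp
      qed
    next
      assume A: "pv x z m \<noteq> \<infinity>" "pv x z' m' \<noteq> \<infinity>"
      then have A': "pv x' z m \<noteq> \<infinity>" "pv x' z' m' \<noteq> \<infinity>" using pv_inf_iff q by auto
      from pv_fin[OF q(1) A(1)] pv_fin[OF q(1) A'(1)] pv_fin[OF q(2) A(2)] pv_fin[OF q(2) A'(2)]
      show ?thesis by eventually_elim (simp add: pv[OF q])
    qed
    have 2: "\<forall>\<^sub>F j in U. enat d \<le> mval m (lin n z (\<tau> x j)) \<longleftrightarrow> enat d \<le> mval m (lin n z (\<tau> x' j))"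
      if q: "(z, m) \<in> Q" "d \<le> B" for z m d
    proof (cases "pv x z m = \<infinity>")
      case True
      then have "pv x' z m = \<infinity>" using pv_inf_iff q by auto
      then show ?thesis using pv_inf(1)[OF q(1)] True by simp
    next
      case False
      then have *: "pv x' z m \<noteq> \<infinity>" using pv_inf_iff q by auto
      have le: "enat d \<le> pv x z m \<longleftrightarrow> enat d \<le> pv x' z m" using d2[OF q(1), of d] q(2) BB' by (simp add: pv_def)
      from pv_fin[OF q(1) False] pv_fin[OF q(1) *] show ?thesis by eventually_elim (simp add: le)
    qed
    have 3: "\<forall>\<^sub>F j in U. mval m (lin n z (\<tau> x j)) \<noteq> \<infinity> \<longrightarrow> dig_eq B m (lead m (lin n z (\<tau> x j))) (lead m (lin n z (\<tau> x' j)))"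
      if q: "(z, m) \<in> Q" for z m
    proof (cases "mval m (X x z m) < i0 z m")
      case True
      have "mval m (X x' z m) < i0 z m"
      proof (cases "i0 z m")
        case (enat d)
        then show ?thesis using True d2[OF q, of d] K[OF q] by (simp add: B'_def not_le[symmetric])
      next
        case infinity
        then show ?thesis using True dinf[OF q] by simp
      qed
      from eventually_mval_const[OF True, of "h z m" U] eventually_mval_const[OF this, of "h z m" U] g
      have "\<forall>\<^sub>F j in U. int m dvd lead m (lin n z (\<tau> x j)) - lead m (X x z m)"
        "\<forall>\<^sub>F j in U. int m dvd lead m (lin n z (\<tau> x' j)) - lead m (X x' z m)"
        unfolding lin_eq[OF q] h_def by (auto elim: eventually_mono)
      then show ?thesis
      proof eventually_elim
        case (elim j)
        have "mval m (X x z m) \<noteq> \<infinity>" using True by (cases "mval m (X x z m)") auto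
        from dvd_dig_eq[OF d3[OF q this] iffD1[OF dvd_diff_commute elim(1)] iffD1[OF dvd_diff_commute elim(2)]]
        show ?case by simp
      qed
    next
      case False
      show ?thesis
      proof (cases "i0 z m")
        case infinity
        then have "pv x z m = \<infinity>" using False by (simp add: pv_def)
        then have *: "pv x z m = \<infinity>" "pv x' z m = \<infinity>" using pv_inf_iff q by auto
        \<comment> \<open>Both leading digits are congruent modulo \<open>m\<close> to that of
          \<open>h\<close>, which does not involve \<open>x\<close>.\<close>
        have "dig_eq B m (lead m (lin n z (\<tau> x j))) (lead m (lin n z (\<tau> x' j)))" for j
        proof (rule dvd_dig_eq)
          show "dig_eq B m (lead m (h z m j)) (lead m (h z m j))" by (simp add: dig_eq_def)
        qed (use pv_inf(1)[OF q *(1), of j] pv_inf(1)[OF q *(2), of j] in \<open>simp_all only: dvd_diff_commute[of _ "lead m (h z m j)"]\<close>)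
        then show ?thesis by simp
      next
        case (enat i)
        have m: "m = 0" using i0[OF enat] by blast
        have "enat i \<le> mval m (X x z m)" using False enat by simp
        then have "enat i \<le> mval m (X x' z m)" using d2[OF q, of i] K[OF q] enat by (simp add: B'_def)
        then have pvi: "pv x z m = enat i" "pv x' z m = enat i" using False enat by (auto simp: pv_def min_def)
        have ld: "\<forall>\<^sub>F j in U. lead m (lin n z (\<tau> y j)) = X y z m i + g z m i + \<beta> z j i" if "pv y z m = enat i" for y
        proof -
          have "pv y z m \<noteq> \<infinity>" using that by simp
          from pv_fin[OF q this] show ?thesis
          proof eventually_elim
            case (elim j)
            then have "lead m (lin n z (\<tau> y j)) = lin n z (\<tau> y j) i" using that by (simp add: lead_eq)
            then show ?case by (simp add: lin_eq[OF q])
          qed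
        qed
        \<comment> \<open>Large enough for the divergent summand to push both digits beyond the
          truncation bound, with the same sign.\<close>
        define C where "C = \<bar>X x z m i + g z m i\<bar> + \<bar>X x' z m i + g z m i\<bar> + int B + 1"
        from i0[OF enat] have "(\<forall>\<^sub>F j in U. \<beta> z j i > C) \<or> (\<forall>\<^sub>F j in U. \<beta> z j i < - C)" by blast
        then show ?thesis
        proof
          assume "\<forall>\<^sub>F j in U. \<beta> z j i > C"
          with ld[OF pvi(1)] ld[OF pvi(2)] show ?thesis
          proof eventually_elim
            case (elim j)
            then have "clip B (lead m (lin n z (\<tau> x j))) = clip B (lead m (lin n z (\<tau> x' j)))"
              unfolding clip_eq_iff C_def by linarith
            then show ?case using m by (simp add: dig_eq_def)
          qed
        next
          assume "\<forall>\<^sub>F j in U. \<beta> z j i < - C"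
          with ld[OF pvi(1)] ld[OF pvi(2)] show ?thesis
          proof eventually_elim
            case (elim j)
            then have "clip B (lead m (lin n z (\<tau> x j))) = clip B (lead m (lin n z (\<tau> x' j)))"
              unfolding clip_eq_iff C_def by linarith
            then show ?case using m by (simp add: dig_eq_def)
          qed
        qed
      qed
    qed
    have "\<forall>\<^sub>F j in U. \<forall>q\<in>Q. \<forall>q'\<in>Q. \<forall>e\<in>{..B}.
        mval (snd q) (lin n (fst q) (\<tau> x j)) + enat e \<le> mval (snd q') (lin n (fst q') (\<tau> x j)) \<longleftrightarrow>
        mval (snd q) (lin n (fst q) (\<tau> x' j)) + enat e \<le> mval (snd q') (lin n (fst q') (\<tau> x' j))"
      using 1 finQ by (intro eventually_ball_finite ballI) auto
    moreover have "\<forall>\<^sub>F j in U. \<forall>q\<in>Q. \<forall>d\<in>{..B}. enat d \<le> mval (snd q) (lin n (fst q) (\<tau> x j)) \<longleftrightarrow>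
        enat d \<le> mval (snd q) (lin n (fst q) (\<tau> x' j))"
      using 2 finQ by (intro eventually_ball_finite ballI) auto
    moreover have "\<forall>\<^sub>F j in U. \<forall>q\<in>Q. mval (snd q) (lin n (fst q) (\<tau> x j)) \<noteq> \<infinity> \<longrightarrow>
        dig_eq B (snd q) (lead (snd q) (lin n (fst q) (\<tau> x j))) (lead (snd q) (lin n (fst q) (\<tau> x' j)))"
      using 3 finQ by (intro eventually_ball_finite ballI) auto
    ultimately show ?thesis
      unfolding data_eq_def by eventually_elim (auto simp: Q_def)
  qed
  then show ?thesis unfolding \<sigma>_def \<tau>_def by blast
qed

section \<open>The Hahn product is stably embedded\<close>

text \<open>Replaces the first \<open>m\<close> variables by those from \<open>k\<close> on, through
  quantifiers and equations; a substitution operation on formulas with its capture problems is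
  avoided.\<close>

definition instF :: "nat \<Rightarrow> nat \<Rightarrow> oag_fm \<Rightarrow> oag_fm" where
  "instF m k \<phi> = ExL [0..<m] (AndF (AndL (map (\<lambda>i. EqF (Var i) (Var (k + i))) [0..<m])) \<phi>)"

lemma sat_instF:
  assumes "range s \<subseteq> Univ M" "m \<le> k"
  shows "sat M s (instF m k \<phi>) \<longleftrightarrow> sat M (\<lambda>i. if i < m then s (k + i) else s i) \<phi>"
proof -
  have "sat M s (instF m k \<phi>) \<longleftrightarrow>
      (\<exists>f. (\<forall>i<m. f i \<in> Univ M) \<and> (\<forall>i<m. f i = s (k + i)) \<and> sat M (\<lambda>i. if i < m then f i else s i) \<phi>)"
  proof -
    have ball: "(\<forall>i\<in>{0..<m}. Q i) \<longleftrightarrow> (\<forall>i<m. Q i)" for Q by auto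
    show ?thesis unfolding instF_def sat_ExL using assms(2) by (simp add: ball)
  qed
  also have "\<dots> \<longleftrightarrow> sat M (\<lambda>i. if i < m then s (k + i) else s i) \<phi>" (is "?L = ?R")
  proof
    assume ?L
    then obtain f where f: "\<forall>i<m. f i = s (k + i)" "sat M (\<lambda>i. if i < m then f i else s i) \<phi>" by blast
    moreover have "(\<lambda>i. if i < m then f i else s i) = (\<lambda>i. if i < m then s (k + i) else s i)"
      using f(1) by auto
    ultimately show ?R by simp
  next
    assume ?R
    then show ?L using assms(1) by (intro exI[of _ "\<lambda>i. s (k + i)"]) auto
  qed
  finally show ?thesis .
qed

text \<open>The truth values at finitely many tuples are recorded by one existential formula about
  the parameters. It holds in \<open>N\<close> with witnesses \<open>b\<close>, so elementarity
  provides witnesses in \<open>M\<close>.\<close>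

lemma finite_approximation:
  fixes fs :: "'a list list"
  assumes emb: "elementary_embedding M N e" and M: "z \<in> Univ M"
    and b: "range b \<subseteq> Univ N" and vars: "all_vars \<phi> \<subseteq> {..<n}" "m \<le> n"
    and fs: "\<And>xs. xs \<in> set fs \<Longrightarrow> xs \<in> tuples M m"
  shows "\<exists>c. range c \<subseteq> Univ M \<and> (\<forall>xs\<in>set fs. sat M (\<lambda>i. if i < m then xs ! i else c i) \<phi> \<longleftrightarrow>
     sat N (\<lambda>i. if i < m then e (xs ! i) else b i) \<phi>)"
proof -
  define P where "P xs \<longleftrightarrow> sat N (\<lambda>i. if i < m then e (xs ! i) else b i) \<phi>" for xs
  define K where "K r = n + r * m" for r
  \<comment> \<open>All tuples are stored in one assignment: tuple \<open>r\<close> occupies the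
    variables from \<open>K r\<close> on, beyond those of the formula.\<close>
  define s where "s i = (if n \<le> i \<and> (i - n) div m < length fs \<and> m > 0 then fs ! ((i - n) div m) ! ((i - n) mod m) else z)" for i
  have fs_el: "fs ! r ! i \<in> Univ M" if "r < length fs" "i < m" for r i
    using fs[OF nth_mem[OF that(1)]] that(2) by (auto simp: tuples_def intro: nth_mem)
  have s: "range s \<subseteq> Univ M" using M fs_el by (auto simp: s_def)
  have sK: "s (K r + i) = fs ! r ! i" if "r < length fs" "i < m" for r i
  proof -
    have "K r + i - n = i + r * m" by (simp add: K_def)
    then show ?thesis using that by (simp add: s_def K_def)
  qed
  have mK: "m \<le> K r" "n \<le> K r" for r using vars(2) by (auto simp: K_def)
  define lit where "lit r = (if P (fs ! r) then instF m (K r) \<phi> else NotF (instF m (K r) \<phi>))" for r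
  define \<psi> where "\<psi> = ExL [m..<n] (AndL (map lit [0..<length fs]))"
  have sat_lit: "sat M' t (lit r) \<longleftrightarrow> (sat M' (\<lambda>i. if i < m then t (K r + i) else t i) \<phi> \<longleftrightarrow> P (fs ! r))"
    if "range t \<subseteq> Univ M'" for M' :: "'c oag_struct" and t r
    using sat_instF[OF that mK(1)] by (auto simp: lit_def)
  have es: "range (e \<circ> s) \<subseteq> Univ N" using emb s by (auto simp: elementary_embedding_def)
  have "sat N (e \<circ> s) \<psi>"
  proof -
    let ?t = "\<lambda>i. if i \<in> set [m..<n] then b i else (e \<circ> s) i"
    have t: "range ?t \<subseteq> Univ N" using b es by auto
    have "sat N ?t (lit r)" if r: "r < length fs" for r
    proof -
      have "sat N (\<lambda>i. if i < m then ?t (K r + i) else ?t i) \<phi> \<longleftrightarrow> P (fs ! r)"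
        unfolding P_def
      proof (rule sat_cong)
        fix i assume "i \<in> free_vars \<phi>"
        then have "i < n" using free_vars_subset vars(1) by blast
        then show "(if i < m then ?t (K r + i) else ?t i) = (if i < m then e (fs ! r ! i) else b i)"
          using sK[OF r, of i] mK(2)[of r] by auto
      qed
      then show ?thesis using sat_lit[OF t] by blast
    qed
    then show ?thesis unfolding \<psi>_def sat_ExL using b by (intro exI[of _ b]) auto
  qed
  then have "sat M s \<psi>" using emb s unfolding elementary_embedding_def by blast
  then obtain f where f: "\<forall>i\<in>set [m..<n]. f i \<in> Univ M"
    and sat: "sat M (\<lambda>i. if i \<in> set [m..<n] then f i else s i) (AndL (map lit [0..<length fs]))"
    unfolding \<psi>_def sat_ExL by blast
  let ?t = "\<lambda>i. if i \<in> set [m..<n] then f i else s i"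
  have t: "range ?t \<subseteq> Univ M" using f s by auto
  have "sat M (\<lambda>i. if i < m then xs ! i else ?t i) \<phi> \<longleftrightarrow> P xs" if xs: "xs \<in> set fs" for xs
  proof -
    obtain r where r: "r < length fs" "xs = fs ! r" using xs by (metis in_set_conv_nth)
    have "sat M ?t (lit r)" using sat r(1) by auto
    then have "sat M (\<lambda>i. if i < m then ?t (K r + i) else ?t i) \<phi> \<longleftrightarrow> P (fs ! r)"
      using sat_lit[OF t] by blast
    moreover have "(\<lambda>i. if i < m then ?t (K r + i) else ?t i) = (\<lambda>i. if i < m then fs ! r ! i else ?t i)"
    proof
      fix i show "(if i < m then ?t (K r + i) else ?t i) = (if i < m then fs ! r ! i else ?t i)"
        using sK[OF r(1), of i] mK(2)[of r] by auto
    qed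
    ultimately show ?thesis unfolding r(2) by simp
  qed
  then show ?thesis using t unfolding P_def by blast
qed

lemma stably_embedded_G1: "stably_embedded TYPE('b) G1"
  unfolding stably_embedded_def
proof (intro allI impI)
  fix N :: "'b oag_struct" and e m D
  assume "is_structure N" and emb: "elementary_embedding G1 N e" and "definable N m D"
  then obtain \<phi> b where b: "range b \<subseteq> Univ N"
    and D: "D = {xs \<in> tuples N m. sat N (\<lambda>i. if i < m then xs ! i else b i) \<phi>}"
    unfolding definable_def by blast
  define P where "P xs \<longleftrightarrow> sat N (\<lambda>i. if i < m then e (xs ! i) else b i) \<phi>" for xs
  have D_iff: "map e xs \<in> D \<longleftrightarrow> P xs" if "xs \<in> tuples G1 m" for xs
  proof -
    have "map e xs \<in> tuples N m" using that emb by (auto simp: tuples_def elementary_embedding_def)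
    moreover have "(\<lambda>i. if i < m then map e xs ! i else b i) = (\<lambda>i. if i < m then e (xs ! i) else b i)"
      using that by (auto simp: tuples_def)
    ultimately show ?thesis by (simp add: D P_def)
  qed
  obtain n0 where n0: "all_vars \<phi> \<subseteq> {..<n0}" using finite_nat_iff_bounded finite_all_vars by blast
  define n where "n = max n0 m"
  have vars: "all_vars \<phi> \<subseteq> {..<n}" "m \<le> n" using n0 by (auto simp: n_def)
  have "\<exists>c. \<forall>xs\<in>F. sat G1 (\<lambda>i. if i < m then xs ! i else c i) \<phi> \<longleftrightarrow> P xs"
    if "finite F" "F \<subseteq> tuples G1 m" for F
  proof -
    obtain fs where fs: "set fs = F" using finite_list[OF \<open>finite F\<close>] by blast
    show ?thesis using finite_approximation[OF emb _ b vars, of "\<lambda>_. 0" fs] fs that(2)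
      unfolding P_def by auto
  qed
  then obtain c where c: "\<And>F xs. finite F \<Longrightarrow> F \<subseteq> tuples G1 m \<Longrightarrow> xs \<in> F \<Longrightarrow>
      sat G1 (\<lambda>i. if i < m then xs ! i else c F i) \<phi> \<longleftrightarrow> P xs" by metis
  \<comment> \<open>Each tuple lies in almost every finite set of tuples, so almost every
    \<open>c F\<close> decides it in the same way as \<open>b\<close>.\<close>
  obtain U where U: "U \<le> finite_subsets_at_top (tuples G1 m)" "ultrafilter U"
    using ultrafilter_exists[OF finite_subsets_at_top_neq_bot] by blast
  have ev: "\<forall>\<^sub>F F in U. sat G1 (\<lambda>i. if i < m then xs ! i else c F i) \<phi> \<longleftrightarrow> P xs" if "xs \<in> tuples G1 m" for xs
  proof -
    have "\<forall>\<^sub>F F in finite_subsets_at_top (tuples G1 m). finite F \<and> F \<subseteq> tuples G1 m \<and> xs \<in> F"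
      unfolding eventually_finite_subsets_at_top using that by (intro exI[of _ "{xs}"]) auto
    then have "\<forall>\<^sub>F F in U. finite F \<and> F \<subseteq> tuples G1 m \<and> xs \<in> F" using U(1) by (rule filter_leD[rotated])
    then show ?thesis by eventually_elim (simp add: c)
  qed
  obtain B where B: "B \<ge> 1" "\<And>s s'. data_eq n B s s' \<Longrightarrow> sat G1 s \<phi> \<longleftrightarrow> sat G1 s' \<phi>"
    using sat_determined[OF vars(1)] by blast
  obtain n' B' d where d: "\<And>x x'. data_eq n' B' (\<lambda>i. if i < m then x i else d i) (\<lambda>i. if i < m then x' i else d i) \<Longrightarrow>
     (\<forall>\<^sub>F F in U. data_eq n B (\<lambda>i. if i < m then x i else c F i) (\<lambda>i. if i < m then x' i else c F i))"
    using limit_data[OF U(2) vars(2) B(1), of c] by blast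
  have "definable G1 m {xs \<in> tuples G1 m. P xs}"
  proof (rule definable_if_data_determined)
    fix xs ys :: "(nat \<Rightarrow> int) list"
    assume len: "length xs = m" "length ys = m" and "P xs"
      and data: "data_eq n' B' (\<lambda>i. if i < m then xs ! i else d i) (\<lambda>i. if i < m then ys ! i else d i)"
    have tup: "xs \<in> tuples G1 m" "ys \<in> tuples G1 m" using len by (auto simp: tuples_def)
    from ev[OF tup(1)] ev[OF tup(2)] d[OF data]
    have "\<forall>\<^sub>F F in U. P xs \<longleftrightarrow> P ys"
    proof eventually_elim
      case (elim F)
      then show ?case using B(2) by blast
    qed
    moreover have "U \<noteq> bot" using U(2) by (simp add: ultrafilter_def)
    ultimately show "P ys" using \<open>P xs\<close> by (simp add: eventually_const)
  qed
  moreover have "{xs \<in> tuples G1 m. map e xs \<in> D} = {xs \<in> tuples G1 m. P xs}" using D_iff by blast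
  ultimately show "definable G1 m {xs \<in> tuples G1 m. map e xs \<in> D}" by simp
qed

section \<open>Ultrapowers\<close>

text \<open>Equality in formulas is interpreted by equality in HOL, so an ultrapower consists of chosen
  representatives instead of classes; this also keeps it inside the type \<open>nat \<Rightarrow> 'a\<close>.\<close>

definition rep :: "nat filter \<Rightarrow> 'a oag_struct \<Rightarrow> (nat \<Rightarrow> 'a) \<Rightarrow> nat \<Rightarrow> 'a" where
  "rep U H f = (SOME g. range g \<subseteq> Univ H \<and> (\<forall>\<^sub>F n in U. g n = f n))"

definition ultrapower :: "nat filter \<Rightarrow> 'a oag_struct \<Rightarrow> (nat \<Rightarrow> 'a) oag_struct" where
  "ultrapower U H = \<lparr> Univ = rep U H ` {f. range f \<subseteq> Univ H},
     zeroS = rep U H (\<lambda>_. zeroS H),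
     plusS = (\<lambda>f g. rep U H (\<lambda>n. plusS H (f n) (g n))),
     minusS = (\<lambda>f. rep U H (\<lambda>n. minusS H (f n))),
     lessS = (\<lambda>f g. \<forall>\<^sub>F n in U. lessS H (f n) (g n)) \<rparr>"

lemma rep:
  assumes "range f \<subseteq> Univ H"
  shows "range (rep U H f) \<subseteq> Univ H" "\<forall>\<^sub>F n in U. rep U H f n = f n"
proof -
  have "\<exists>g. range g \<subseteq> Univ H \<and> (\<forall>\<^sub>F n in U. g n = f n)" using assms by (intro exI[of _ f]) simp
  from someI_ex[OF this] show "range (rep U H f) \<subseteq> Univ H" "\<forall>\<^sub>F n in U. rep U H f n = f n"
    unfolding rep_def by auto
qed

lemma rep_cong:
  assumes "\<forall>\<^sub>F n in U. f n = g n"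
  shows "rep U H f = rep U H g"
proof -
  have "(\<forall>\<^sub>F n in U. h n = f n) \<longleftrightarrow> (\<forall>\<^sub>F n in U. h n = g n)" for h
  proof
    assume "\<forall>\<^sub>F n in U. h n = f n"
    with assms show "\<forall>\<^sub>F n in U. h n = g n" by eventually_elim simp
  next
    assume "\<forall>\<^sub>F n in U. h n = g n"
    with assms show "\<forall>\<^sub>F n in U. h n = f n" by eventually_elim simp
  qed
  then show ?thesis by (simp add: rep_def)
qed

lemma Univ_ultrapower: "Univ (ultrapower U H) = rep U H ` {f. range f \<subseteq> Univ H}"
  by (simp add: ultrapower_def)

lemma Univ_ultrapowerD:
  assumes "x \<in> Univ (ultrapower U H)"
  shows "range x \<subseteq> Univ H" "rep U H x = x"
proof -
  obtain f where f: "range f \<subseteq> Univ H" "x = rep U H f" using assms by (auto simp: Univ_ultrapower)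
  show "range x \<subseteq> Univ H" using rep(1)[OF f(1)] f(2) by simp
  show "rep U H x = x" using rep_cong[OF rep(2)[OF f(1)]] f(2) by simp
qed

lemma rep_in_ultrapower: "range f \<subseteq> Univ H \<Longrightarrow> rep U H f \<in> Univ (ultrapower U H)"
  by (auto simp: Univ_ultrapower)

lemma is_structure_ultrapower:
  assumes "is_structure H"
  shows "is_structure (ultrapower U H)"
proof -
  note op = assms[unfolded is_structure_def]
  have "zeroS (ultrapower U H) \<in> Univ (ultrapower U H)"
    using op by (auto simp: ultrapower_def intro!: imageI)
  moreover have "plusS (ultrapower U H) x y \<in> Univ (ultrapower U H)"
    if "x \<in> Univ (ultrapower U H)" "y \<in> Univ (ultrapower U H)" for x y
    using Univ_ultrapowerD(1)[OF that(1)] Univ_ultrapowerD(1)[OF that(2)] op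
    by (auto simp: ultrapower_def intro!: imageI)
  moreover have "minusS (ultrapower U H) x \<in> Univ (ultrapower U H)" if "x \<in> Univ (ultrapower U H)" for x
    using Univ_ultrapowerD(1)[OF that(1)] op by (auto simp: ultrapower_def intro!: imageI)
  ultimately show ?thesis by (auto simp: is_structure_def)
qed

lemma val_in_Univ: "is_structure M \<Longrightarrow> range s \<subseteq> Univ M \<Longrightarrow> val M s t \<in> Univ M"
  by (induction t) (auto simp: is_structure_def)

lemma val_ultrapower:
  assumes H: "is_structure H" and s: "range s \<subseteq> Univ (ultrapower U H)"
  shows "\<forall>\<^sub>F n in U. val (ultrapower U H) s t n = val H (\<lambda>i. s i n) t"
proof (induction t)
  case (Var i)
  then show ?case by simp
next
  case ZeroT
  have "range (\<lambda>_::nat. zeroS H) \<subseteq> Univ H" using H by (auto simp: is_structure_def)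
  then show ?case using rep(2)[of "\<lambda>_. zeroS H" H U] by (simp add: ultrapower_def)
next
  case (PlusT t u)
  let ?f = "\<lambda>n. plusS H (val (ultrapower U H) s t n) (val (ultrapower U H) s u n)"
  have "val (ultrapower U H) s v \<in> Univ (ultrapower U H)" for v
    by (rule val_in_Univ[OF is_structure_ultrapower[OF H] s])
  from Univ_ultrapowerD(1)[OF this] have "val (ultrapower U H) s v n \<in> Univ H" for v n by blast
  then have "range ?f \<subseteq> Univ H" using H by (auto simp: is_structure_def)
  from rep(2)[OF this, of U] PlusT.IH have "\<forall>\<^sub>F n in U. rep U H ?f n = plusS H (val H (\<lambda>i. s i n) t) (val H (\<lambda>i. s i n) u)"
    by eventually_elim simp
  then show ?case by (simp add: ultrapower_def)
next
  case (MinusT t)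
  let ?f = "\<lambda>n. minusS H (val (ultrapower U H) s t n)"
  have "val (ultrapower U H) s v \<in> Univ (ultrapower U H)" for v
    by (rule val_in_Univ[OF is_structure_ultrapower[OF H] s])
  from Univ_ultrapowerD(1)[OF this] have "val (ultrapower U H) s v n \<in> Univ H" for v n by blast
  then have "range ?f \<subseteq> Univ H" using H by (auto simp: is_structure_def)
  from rep(2)[OF this, of U] MinusT.IH have "\<forall>\<^sub>F n in U. rep U H ?f n = minusS H (val H (\<lambda>i. s i n) t)"
    by eventually_elim simp
  then show ?case by (simp add: ultrapower_def)
qed

theorem Los:
  assumes H: "is_structure H" and U: "ultrafilter U"
  shows "range s \<subseteq> Univ (ultrapower U H) \<Longrightarrow>
    sat (ultrapower U H) s \<phi> \<longleftrightarrow> (\<forall>\<^sub>F n in U. sat H (\<lambda>i. s i n) \<phi>)"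
proof (induction \<phi> arbitrary: s)
  case (EqF t u)
  let ?N = "ultrapower U H"
  note vs = val_in_Univ[OF is_structure_ultrapower[OF H] EqF]
  have "val ?N s t = val ?N s u \<longleftrightarrow> (\<forall>\<^sub>F n in U. val ?N s t n = val ?N s u n)"
    using rep_cong[of "val ?N s t" "val ?N s u" U H] Univ_ultrapowerD(2)[OF vs] by auto
  also have "\<dots> \<longleftrightarrow> (\<forall>\<^sub>F n in U. val H (\<lambda>i. s i n) t = val H (\<lambda>i. s i n) u)"
  proof (rule eventually_subst)
    from val_ultrapower[OF H EqF, of t] val_ultrapower[OF H EqF, of u]
    show "\<forall>\<^sub>F n in U. (val ?N s t n = val ?N s u n) = (val H (\<lambda>i. s i n) t = val H (\<lambda>i. s i n) u)"
      by eventually_elim simp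
  qed
  finally show ?case by simp
next
  case (LessF t u)
  let ?N = "ultrapower U H"
  have "(\<forall>\<^sub>F n in U. lessS H (val ?N s t n) (val ?N s u n)) \<longleftrightarrow>
     (\<forall>\<^sub>F n in U. lessS H (val H (\<lambda>i. s i n) t) (val H (\<lambda>i. s i n) u))"
  proof (rule eventually_subst)
    from val_ultrapower[OF H LessF, of t] val_ultrapower[OF H LessF, of u]
    show "\<forall>\<^sub>F n in U. lessS H (val ?N s t n) (val ?N s u n) = lessS H (val H (\<lambda>i. s i n) t) (val H (\<lambda>i. s i n) u)"
      by eventually_elim simp
  qed
  moreover have "lessS ?N f g \<longleftrightarrow> (\<forall>\<^sub>F n in U. lessS H (f n) (g n))" for f g
    by (simp add: ultrapower_def)
  ultimately show ?case by simp
next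
  case (NotF \<phi>)
  then show ?case by (simp add: ultrafilter_not[OF U])
next
  case (AndF \<phi> \<psi>)
  then show ?case by (simp add: eventually_conj_iff)
next
  case (ExF i \<phi>)
  let ?N = "ultrapower U H"
  have upd: "range (s(i := x)) \<subseteq> Univ ?N" if "x \<in> Univ ?N" for x using ExF.prems that by auto
  have pt: "(\<lambda>j. (s(i := x)) j n) = (\<lambda>j. s j n)(i := x n)" for x n by auto
  show ?case
  proof
    assume "sat ?N s (ExF i \<phi>)"
    then obtain x where x: "x \<in> Univ ?N" "sat ?N (s(i := x)) \<phi>" by auto
    then have "\<forall>\<^sub>F n in U. sat H ((\<lambda>j. s j n)(i := x n)) \<phi>" using ExF.IH[OF upd[OF x(1)]] by (simp only: pt)
    then show "\<forall>\<^sub>F n in U. sat H (\<lambda>j. s j n) (ExF i \<phi>)"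
      by (rule eventually_mono) (use Univ_ultrapowerD(1)[OF x(1)] in auto)
  next
    assume ev: "\<forall>\<^sub>F n in U. sat H (\<lambda>j. s j n) (ExF i \<phi>)"
    \<comment> \<open>The default \<open>zeroS H\<close> keeps \<open>f\<close> inside the universe
      at indices without a witness.\<close>
    define f where "f n = (if sat H (\<lambda>j. s j n) (ExF i \<phi>) then (SOME x. x \<in> Univ H \<and> sat H ((\<lambda>j. s j n)(i := x)) \<phi>)
      else zeroS H)" for n
    have f: "f n \<in> Univ H \<and> sat H ((\<lambda>j. s j n)(i := f n)) \<phi>" if "sat H (\<lambda>j. s j n) (ExF i \<phi>)" for n
    proof -
      have "\<exists>x. x \<in> Univ H \<and> sat H ((\<lambda>j. s j n)(i := x)) \<phi>" using that by auto
      from someI_ex[OF this] show ?thesis using that by (simp add: f_def)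
    qed
    have rf: "range f \<subseteq> Univ H"
    proof
      fix y assume "y \<in> range f"
      then obtain n where "y = f n" by blast
      then show "y \<in> Univ H" using f[of n] H by (cases "sat H (\<lambda>j. s j n) (ExF i \<phi>)") (auto simp: f_def is_structure_def)
    qed
    let ?x = "rep U H f"
    from ev rep(2)[OF rf, of U] have "\<forall>\<^sub>F n in U. sat H (\<lambda>j. (s(i := ?x)) j n) \<phi>"
      unfolding pt by eventually_elim (simp only: f)
    then have "sat ?N (s(i := ?x)) \<phi>" using ExF.IH[OF upd[OF rep_in_ultrapower[OF rf]]] by blast
    then show "sat ?N s (ExF i \<phi>)" using rep_in_ultrapower[OF rf] by auto
  qed
qed

lemma finite_free_vars: "finite (free_vars \<phi>)"
  using finite_subset[OF free_vars_subset finite_all_vars] .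

text \<open>The theorem of Los for arbitrary sequences instead of chosen representatives: finitely
  many variables are free, so the two agree at all of them simultaneously for almost every
  index.\<close>

lemma sat_ultrapower_cong:
  assumes H: "is_structure H" and U: "ultrafilter U" and s: "\<And>i. range (s i) \<subseteq> Univ H"
  shows "sat (ultrapower U H) (\<lambda>i. rep U H (s i)) \<phi> \<longleftrightarrow> (\<forall>\<^sub>F n in U. sat H (\<lambda>i. s i n) \<phi>)"
proof -
  have "range (\<lambda>i. rep U H (s i)) \<subseteq> Univ (ultrapower U H)" using rep_in_ultrapower[OF s] by auto
  note Los[OF H U this, of \<phi>]
  also have "(\<forall>\<^sub>F n in U. sat H (\<lambda>i. rep U H (s i) n) \<phi>) \<longleftrightarrow> (\<forall>\<^sub>F n in U. sat H (\<lambda>i. s i n) \<phi>)"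
  proof (rule eventually_subst)
    have "\<forall>\<^sub>F n in U. \<forall>i\<in>free_vars \<phi>. rep U H (s i) n = s i n"
      using rep(2)[OF s] by (intro eventually_ball_finite finite_free_vars) auto
    then show "\<forall>\<^sub>F n in U. sat H (\<lambda>i. rep U H (s i) n) \<phi> = sat H (\<lambda>i. s i n) \<phi>"
      by eventually_elim (rule sat_cong, simp)
  qed
  finally show ?thesis .
qed

lemma elementary_embedding_ultrapower:
  assumes H: "is_structure H" and U: "ultrafilter U"
  shows "elementary_embedding H (ultrapower U H) (\<lambda>a. rep U H (\<lambda>_. a))"
  unfolding elementary_embedding_def
proof (intro conjI allI impI)
  show "(\<lambda>a. rep U H (\<lambda>_. a)) ` Univ H \<subseteq> Univ (ultrapower U H)"
    by (auto intro!: rep_in_ultrapower)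
  fix \<phi> and s :: "nat \<Rightarrow> 'a" assume s: "range s \<subseteq> Univ H"
  have "sat (ultrapower U H) (\<lambda>i. rep U H (\<lambda>_. s i)) \<phi> \<longleftrightarrow> (\<forall>\<^sub>F n in U. sat H (\<lambda>i. s i) \<phi>)"
    using s by (intro sat_ultrapower_cong[OF H U]) auto
  moreover have "U \<noteq> bot" using U by (simp add: ultrafilter_def)
  ultimately show "sat H s \<phi> \<longleftrightarrow> sat (ultrapower U H) ((\<lambda>a. rep U H (\<lambda>_. a)) \<circ> s) \<phi>"
    by (simp add: comp_def eventually_const)
qed

section \<open>Models of the theory of the Hahn product\<close>

lemma free_vars_ExL: "free_vars (ExL is \<phi>) = free_vars \<phi> - set is"
  by (induction "is") auto

definition sub :: "'a oag_struct \<Rightarrow> 'a \<Rightarrow> 'a \<Rightarrow> 'a" where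
  "sub M x y = plusS M x (minusS M y)"

definition mul :: "'a oag_struct \<Rightarrow> int \<Rightarrow> 'a \<Rightarrow> 'a" where
  "mul M k u = val M (\<lambda>_. u) (mulT k (Var 0))"

lemma val_DiffT_sub: "val M s (DiffT t u) = sub M (val M s t) (val M s u)"
  by (simp add: DiffT_def sub_def)

lemma val_mulT_mul: "val M s (mulT k t) = mul M k (val M s t)"
proof -
  have "val M s (nmulT n t) = val M (\<lambda>_. val M s t) (nmulT n (Var 0))" for n by (induction n) auto
  then show ?thesis by (auto simp: mul_def mulT_def)
qed

lemma sub_G1 [simp]: "sub G1 x y = (\<lambda>i. x i - y i)"
  by (simp add: sub_def)

lemma mul_G1 [simp]: "mul G1 k u = (\<lambda>i. k * u i)"
  by (simp add: mul_def)

definition first_unit :: "'a oag_struct \<Rightarrow> 'a \<Rightarrow> bool" where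
  "first_unit M u \<longleftrightarrow> unit_elem M u \<and> (\<forall>d\<in>Univ M. unit_elem M d \<longrightarrow> \<not> smaller M u d)"

definition next_unit :: "'a oag_struct \<Rightarrow> 'a \<Rightarrow> 'a \<Rightarrow> bool" where
  "next_unit M u c \<longleftrightarrow> unit_elem M c \<and> smaller M c u \<and>
     (\<forall>d\<in>Univ M. unit_elem M d \<longrightarrow> \<not> (smaller M d u \<and> smaller M c d))"

text \<open>The valuation of \<open>x\<close> is at least that of the unit \<open>u\<close>.\<close>

definition infra :: "'a oag_struct \<Rightarrow> 'a \<Rightarrow> 'a \<Rightarrow> bool" where
  "infra M x u \<longleftrightarrow> (\<forall>d\<in>Univ M. unit_elem M d \<and> smaller M u d \<longrightarrow> smaller M x d)"

definition firstF :: "nat \<Rightarrow> oag_term \<Rightarrow> oag_fm" where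
  "firstF k u = AndF (unitF k u) (AllF k (ImpF (unitF (Suc k) (Var k)) (NotF (smallerF u (Var k)))))"

definition nextF :: "nat \<Rightarrow> oag_term \<Rightarrow> oag_term \<Rightarrow> oag_fm" where
  "nextF k u c = AndF (unitF k c) (AndF (smallerF c u) (AllF k (ImpF (unitF (Suc k) (Var k))
     (NotF (AndF (smallerF (Var k) u) (smallerF c (Var k)))))))"

definition infraF :: "nat \<Rightarrow> oag_term \<Rightarrow> oag_term \<Rightarrow> oag_fm" where
  "infraF k x u = AllF k (ImpF (AndF (unitF (Suc k) (Var k)) (smallerF u (Var k))) (smallerF x (Var k)))"

lemma sat_firstF [simp]: "k \<notin> term_vars u \<Longrightarrow> sat M s (firstF k u) \<longleftrightarrow> first_unit M (val M s u)"
  by (auto simp: firstF_def first_unit_def val_upd)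

lemma sat_nextF [simp]:
  "k \<notin> term_vars u \<Longrightarrow> k \<notin> term_vars c \<Longrightarrow> sat M s (nextF k u c) \<longleftrightarrow> next_unit M (val M s u) (val M s c)"
  by (auto simp: nextF_def next_unit_def val_upd)

lemma sat_infraF [simp]:
  "k \<notin> term_vars x \<Longrightarrow> k \<notin> term_vars u \<Longrightarrow> sat M s (infraF k x u) \<longleftrightarrow> infra M (val M s x) (val M s u)"
  by (auto simp: infraF_def infra_def val_upd)

lemma first_unit_G1: "first_unit G1 u \<longleftrightarrow> unit_at 0 u"
proof
  assume *: "first_unit G1 u"
  then obtain i where i: "unit_at i u" by (auto simp: first_unit_def unit_elem_G1)
  obtain d where "unit_at 0 d" using unit_at_exists by blast
  then have "\<not> 0 < i" using * smaller_unit_G1[OF i] by (auto simp: first_unit_def unit_elem_G1)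
  then show "unit_at 0 u" using i by simp
next
  assume *: "unit_at 0 u"
  have "\<not> smaller G1 u d" if "unit_elem G1 d" for d
    using that smaller_unit_G1[OF *] by (auto simp: unit_elem_G1)
  then show "first_unit G1 u" using * by (auto simp: first_unit_def unit_elem_G1)
qed

lemma next_unit_G1:
  assumes u: "unit_at i u" shows "next_unit G1 u c \<longleftrightarrow> unit_at (Suc i) c"
proof
  assume *: "next_unit G1 u c"
  then obtain j where j: "unit_at j c" by (auto simp: next_unit_def unit_elem_G1)
  have "i < j" using * smaller_unit_G1[OF j u] by (simp add: next_unit_def)
  obtain d where d: "unit_at (Suc i) d" using unit_at_exists by blast
  have "smaller G1 d u" using smaller_unit_G1[OF d u] by simp
  then have "\<not> smaller G1 c d" using * d by (auto simp: next_unit_def unit_elem_G1)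
  then have "\<not> Suc i < j" using smaller_unit_G1[OF j d] by simp
  with \<open>i < j\<close> have "j = Suc i" by simp
  then show "unit_at (Suc i) c" using j by simp
next
  assume c: "unit_at (Suc i) c"
  have "\<not> (smaller G1 d u \<and> smaller G1 c d)" if "unit_elem G1 d" for d
    using that smaller_unit_G1[OF _ u] smaller_unit_G1[OF c] by (auto simp: unit_elem_G1)
  then show "next_unit G1 u c" using c smaller_unit_G1[OF c u] by (auto simp: next_unit_def unit_elem_G1)
qed

lemma infra_G1:
  assumes u: "unit_at i u" shows "infra G1 x u \<longleftrightarrow> (\<forall>j<i. x j = 0)"
proof
  assume *: "infra G1 x u"
  show "\<forall>j<i. x j = 0"
  proof (intro allI impI)
    fix j assume j: "j < i"
    obtain d where d: "unit_at j d" using unit_at_exists by blast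
    then have "smaller G1 x d" using * j smaller_unit_G1[OF u d] by (auto simp: infra_def unit_elem_G1)
    then show "x j = 0" using smaller_G1[OF d] by simp
  qed
next
  assume "\<forall>j<i. x j = 0"
  then show "infra G1 x u" unfolding infra_def using smaller_unit_G1[OF u] smaller_G1
    by (auto simp: unit_elem_G1)
qed

definition assign :: "'a oag_struct \<Rightarrow> 'a list \<Rightarrow> nat \<Rightarrow> 'a" where
  "assign H xs i = (if i < length xs then xs ! i else zeroS H)"

text \<open>In \<open>G1\<close> this forces variable \<open>i\<close> to be a unit at position
  exactly \<open>i\<close>, so that statements about numerical positions become
  transferable.\<close>

fun chainF :: "nat \<Rightarrow> oag_fm" where
  "chainF 0 = firstF 1 (Var 0)"
| "chainF (Suc n) = AndF (chainF n) (nextF (n + 2) (Var n) (Var (Suc n)))"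

lemma sat_chainF: "sat M s (chainF n) \<longleftrightarrow> first_unit M (s 0) \<and> (\<forall>i<n. next_unit M (s i) (s (Suc i)))"
  by (induction n) (auto simp: less_Suc_eq)

lemma sat_chainF_G1: "sat G1 s (chainF n) \<longleftrightarrow> (\<forall>i\<le>n. unit_at i (s i))"
proof (induction n)
  case 0
  then show ?case by (simp add: first_unit_G1)
next
  case (Suc n)
  have "(\<forall>i\<le>Suc n. unit_at i (s i)) \<longleftrightarrow> (\<forall>i\<le>n. unit_at i (s i)) \<and> unit_at (Suc n) (s (Suc n))"
    by (auto simp: le_Suc_eq)
  then show ?case using Suc next_unit_G1[of n "s n" "s (Suc n)"] by auto
qed

text \<open>The units form a unitriangular matrix: row \<open>i\<close> vanishes before column
  \<open>i\<close> and has entry \<open>1\<close> there.\<close>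

lemma lin_triangular_zero:
  assumes s: "\<forall>i<m. unit_at i (s i)" and a: "\<forall>i<n. a i = 0" and j: "j < n"
  shows "lin m a s j = 0"
  unfolding lin_def
proof (intro sum.neutral ballI)
  fix i assume "i \<in> {..<m}"
  then show "a i * s i j = 0" using assms by (cases "i \<le> j") (auto simp: unit_at_def)
qed

lemma lin_triangular_lead:
  assumes s: "\<forall>i\<le>n. unit_at i (s i)" and a: "\<forall>i<n. a i = 0"
  shows "lin (Suc n) a s n = a n"
  unfolding lin_def using assms by (simp add: unit_at_def)

lemma lin_diff_len:
  assumes s: "\<forall>i\<le>m. unit_at i (s i)" and "n < m" "j \<le> n"
  shows "lin (Suc n) a s j = lin m a s j"
proof -
  have "lin (Suc n) a s j = (\<Sum>i\<in>{..<Suc n}. a i * s i j)" by (simp add: lin_def)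
  also have "\<dots> = (\<Sum>i\<in>{..<m}. a i * s i j)"
    using assms by (intro sum.mono_neutral_left) (auto simp: unit_at_def not_less)
  finally show ?thesis by (simp add: lin_def)
qed

locale G1_model =
  fixes H :: "'a oag_struct"
  assumes model: "is_model H (Th G1)"
begin

lemma is_structure_H: "is_structure H"
  using model by (simp add: is_model_def)

lemma closed: "zeroS H \<in> Univ H" "x \<in> Univ H \<Longrightarrow> y \<in> Univ H \<Longrightarrow> plusS H x y \<in> Univ H"
  "x \<in> Univ H \<Longrightarrow> minusS H x \<in> Univ H"
  using is_structure_H by (auto simp: is_structure_def)

lemma sub_closed: "x \<in> Univ H \<Longrightarrow> y \<in> Univ H \<Longrightarrow> sub H x y \<in> Univ H"
  by (simp add: sub_def closed)

lemma mul_closed: "u \<in> Univ H \<Longrightarrow> mul H k u \<in> Univ H"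
  unfolding mul_def by (rule val_in_Univ[OF is_structure_H]) auto

text \<open>Closing the formula universally over its free variables produces a sentence of the
  theory.\<close>

lemma transfer:
  assumes G1: "\<And>s. sat G1 s \<phi>" and s: "range s \<subseteq> Univ H"
  shows "sat H s \<phi>"
proof -
  obtain vs where vs: "set vs = free_vars \<phi>" using finite_list[OF finite_free_vars] by blast
  let ?\<chi> = "NotF (ExL vs (NotF \<phi>))"
  have "sentence ?\<chi>" by (simp add: sentence_def free_vars_ExL vs)
  moreover have "holds G1 ?\<chi>" by (simp add: holds_def sat_ExL G1)
  ultimately have "holds H ?\<chi>" using model by (simp add: is_model_def Th_def)
  then have "sat H s ?\<chi>" using s by (simp add: holds_def)
  then have "(\<forall>i\<in>set vs. s i \<in> Univ H) \<longrightarrow> sat H (\<lambda>i. if i \<in> set vs then s i else s i) \<phi>"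
    unfolding sat.simps sat_ExL by blast
  then show ?thesis using s by auto
qed

lemma transfer_assign:
  assumes "\<And>s. sat G1 s \<phi>" "set xs \<subseteq> Univ H"
  shows "sat H (assign H xs) \<phi>"
  using assms closed(1) by (intro transfer) (auto simp: assign_def intro: nth_mem)

section \<open>First-order facts about units, order and digits, checked in \<open>G1\<close> and
  transferred\<close>

lemma first_unit_exists: "\<exists>u\<in>Univ H. first_unit H u"
proof -
  have "sat H (assign H []) (ExF 0 (firstF 1 (Var 0)))"
    by (rule transfer_assign) (auto simp: first_unit_G1 unit_at_exists)
  then show ?thesis by simp
qed

lemma next_unit_exists:
  assumes "u \<in> Univ H" "unit_elem H u" shows "\<exists>c\<in>Univ H. next_unit H u c"
proof -
  have G1: "\<exists>c. next_unit G1 u c" if "unit_elem G1 u" for u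
    using that next_unit_G1 unit_at_exists unfolding unit_elem_G1 by blast
  have "sat H (assign H [u]) (ImpF (unitF 1 (Var 0)) (ExF 1 (nextF 2 (Var 0) (Var 1))))"
    using assms(1) by (intro transfer_assign) (auto intro: G1)
  then show ?thesis using assms by (simp add: assign_def)
qed

lemma pred_unit_exists:
  assumes "u \<in> Univ H" "d \<in> Univ H" "unit_elem H u" "unit_elem H d" "smaller H u d"
  shows "\<exists>c\<in>Univ H. unit_elem H c \<and> next_unit H c u"
proof -
  have G1: "\<exists>c. unit_elem G1 c \<and> next_unit G1 c u" if u: "unit_elem G1 u" "unit_elem G1 d" "smaller G1 u d" for u d
  proof -
    obtain i j where ij: "unit_at i u" "unit_at j d" using u by (auto simp: unit_elem_G1)
    then have "j < i" using u smaller_unit_G1 by blast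
    then obtain k where k: "i = Suc k" by (cases i) auto
    obtain c where "unit_at k c" using unit_at_exists by blast
    then show ?thesis using next_unit_G1[of k c u] ij k by (auto simp: unit_elem_G1)
  qed
  have "sat H (assign H [u, d]) (ImpF (AndF (unitF 2 (Var 0)) (AndF (unitF 2 (Var 1)) (smallerF (Var 0) (Var 1))))
     (ExF 2 (AndF (unitF 3 (Var 2)) (nextF 3 (Var 2) (Var 0)))))"
    using assms(1,2) by (intro transfer_assign) (auto intro: G1)
  then show ?thesis using assms by (simp add: assign_def)
qed

lemma smaller_mono:
  assumes "r \<in> Univ H" "u \<in> Univ H" "u' \<in> Univ H" "unit_elem H u" "unit_elem H u'" "\<not> smaller H u' u" "smaller H r u"
  shows "smaller H r u'"
proof -
  have G1: "smaller G1 r u'" if u: "unit_elem G1 u" "unit_elem G1 u'" "\<not> smaller G1 u' u" "smaller G1 r u" for r u u'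
  proof -
    obtain i j where ij: "unit_at i u" "unit_at j u'" using u by (auto simp: unit_elem_G1)
    then have "j \<le> i" using u smaller_unit_G1[of j u' i u] by simp
    then show ?thesis using u smaller_G1[OF ij(1)] smaller_G1[OF ij(2)] by simp
  qed
  have "sat H (assign H [r, u, u']) (ImpF (AndF (unitF 3 (Var 1)) (AndF (unitF 3 (Var 2))
     (AndF (NotF (smallerF (Var 2) (Var 1))) (smallerF (Var 0) (Var 1))))) (smallerF (Var 0) (Var 2)))"
    using assms(1-3) by (intro transfer_assign) (auto intro: G1)
  then show ?thesis using assms by (simp add: assign_def numeral_2_eq_2)
qed

lemma next_unit_mono:
  assumes "c \<in> Univ H" "u \<in> Univ H" "d \<in> Univ H" "d' \<in> Univ H" "unit_elem H c" "unit_elem H d"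
    "next_unit H c u" "next_unit H d d'" "\<not> smaller H c d"
  shows "\<not> smaller H u d'"
proof -
  have G1: False if u: "unit_elem G1 c" "unit_elem G1 d" "next_unit G1 c u" "next_unit G1 d d'" "\<not> smaller G1 c d" "smaller G1 u d'" for c u d d'
  proof -
    obtain i j where ij: "unit_at i c" "unit_at j d" using u by (auto simp: unit_elem_G1)
    then have "unit_at (Suc i) u" "unit_at (Suc j) d'" using u next_unit_G1 by blast+
    then show ?thesis using u(5,6) smaller_unit_G1 ij by blast
  qed
  have "sat H (assign H [c, u, d, d']) (ImpF (AndF (unitF 4 (Var 0)) (AndF (unitF 4 (Var 2)) (AndF (nextF 4 (Var 0) (Var 1))
     (AndF (nextF 4 (Var 2) (Var 3)) (NotF (smallerF (Var 0) (Var 2))))))) (NotF (smallerF (Var 1) (Var 3))))"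
    using assms(1-4) by (intro transfer_assign) (auto intro: G1)
  then show ?thesis using assms by (simp add: assign_def numeral_2_eq_2 numeral_3_eq_3)
qed

lemma infra_first: "first_unit H u \<Longrightarrow> infra H x u"
  by (auto simp: infra_def first_unit_def)

lemma infra_next:
  assumes "r \<in> Univ H" "u \<in> Univ H" "d \<in> Univ H" "unit_elem H d" "next_unit H d u" "smaller H r d"
  shows "infra H r u"
proof -
  have G1: "infra G1 r u" if u: "unit_elem G1 d" "next_unit G1 d u" "smaller G1 r d" for r u d
  proof -
    obtain i where i: "unit_at i d" using u by (auto simp: unit_elem_G1)
    then show ?thesis using u next_unit_G1[OF i] smaller_G1[OF i] by (simp add: infra_G1[of "Suc i"])
  qed
  have "sat H (assign H [r, u, d]) (ImpF (AndF (unitF 3 (Var 2)) (AndF (nextF 3 (Var 2) (Var 1))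
     (smallerF (Var 0) (Var 2)))) (infraF 3 (Var 0) (Var 1)))"
    using assms(1-3) by (intro transfer_assign) (auto intro: G1)
  then show ?thesis using assms by (simp add: assign_def numeral_2_eq_2)
qed

lemma smaller_sub:
  assumes "x \<in> Univ H" "y \<in> Univ H" "z \<in> Univ H" "u \<in> Univ H" "unit_elem H u"
  shows "smaller H (sub H x z) u \<Longrightarrow> smaller H (sub H y z) u \<Longrightarrow> smaller H (sub H x y) u"
    "smaller H (sub H x z) u \<Longrightarrow> smaller H (sub H y x) u \<Longrightarrow> smaller H (sub H y z) u"
proof -
  have "sat H (assign H [x, y, z, u]) (ImpF (unitF 4 (Var 3)) (AndF
     (ImpF (AndF (smallerF (DiffT (Var 0) (Var 2)) (Var 3)) (smallerF (DiffT (Var 1) (Var 2)) (Var 3))) (smallerF (DiffT (Var 0) (Var 1)) (Var 3)))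
     (ImpF (AndF (smallerF (DiffT (Var 0) (Var 2)) (Var 3)) (smallerF (DiffT (Var 1) (Var 0)) (Var 3))) (smallerF (DiffT (Var 1) (Var 2)) (Var 3)))))"
    using assms(1-4) by (intro transfer_assign) (auto simp: unit_elem_G1 smaller_G1)
  then have "(smaller H (sub H x z) u \<longrightarrow> smaller H (sub H y z) u \<longrightarrow> smaller H (sub H x y) u) \<and>
    (smaller H (sub H x z) u \<longrightarrow> smaller H (sub H y x) u \<longrightarrow> smaller H (sub H y z) u)"
    using assms by (simp add: assign_def numeral_2_eq_2 numeral_3_eq_3 val_DiffT_sub)
  then show "smaller H (sub H x z) u \<Longrightarrow> smaller H (sub H y z) u \<Longrightarrow> smaller H (sub H x y) u"
    "smaller H (sub H x z) u \<Longrightarrow> smaller H (sub H y x) u \<Longrightarrow> smaller H (sub H y z) u" by blast+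
qed

lemma separated:
  assumes "x \<in> Univ H" "y \<in> Univ H" "x \<noteq> y"
  shows "\<exists>u\<in>Univ H. unit_elem H u \<and> \<not> smaller H (sub H x y) u"
proof -
  have G1: "\<exists>u. unit_elem G1 u \<and> \<not> smaller G1 (\<lambda>i. x i - y i) u" if ne: "x \<noteq> y" for x y :: "nat \<Rightarrow> int"
  proof -
    obtain i where i: "x i \<noteq> y i" using ne by (auto simp: fun_eq_iff)
    obtain u where u: "unit_at i u" using unit_at_exists by blast
    then show ?thesis using i smaller_G1[OF u] by (intro exI[of _ u]) (auto simp: unit_elem_G1)
  qed
  have "sat H (assign H [x, y]) (ImpF (NotF (EqF (Var 0) (Var 1)))
     (ExF 2 (AndF (unitF 3 (Var 2)) (NotF (smallerF (DiffT (Var 0) (Var 1)) (Var 2))))))"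
    using assms(1,2) by (intro transfer_assign) (auto intro: G1)
  then show ?thesis using assms by (simp add: assign_def val_DiffT_sub)
qed

lemma less_trans_H:
  assumes "x \<in> Univ H" "y \<in> Univ H" "z \<in> Univ H" "lessS H x y" "lessS H y z"
  shows "lessS H x z"
proof -
  have G1: "lessS G1 x z" if less: "lessS G1 x y" "lessS G1 y z" for x y z
  proof -
    obtain i j where "\<forall>k<i. x k = y k" "x i < y i" "\<forall>k<j. y k = z k" "y j < z j"
      using less unfolding lessS_G1_iff by blast
    then show ?thesis unfolding lessS_G1_iff
      by (intro exI[of _ "min i j"]) (cases i j rule: linorder_cases; auto)
  qed
  have "sat H (assign H [x, y, z]) (ImpF (AndF (LessF (Var 0) (Var 1)) (LessF (Var 1) (Var 2))) (LessF (Var 0) (Var 2)))"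
    using assms(1-3) by (intro transfer_assign) (auto intro: G1)
  then show ?thesis using assms by (simp add: assign_def numeral_2_eq_2)
qed

lemma less_irrefl_H:
  assumes "x \<in> Univ H" shows "\<not> lessS H x x"
proof -
  have "sat H (assign H [x]) (NotF (LessF (Var 0) (Var 0)))"
    using assms by (intro transfer_assign) (auto simp: lessS_G1_iff)
  then show ?thesis by (simp add: assign_def)
qed

text \<open>Once the digit of \<open>x\<close> at \<open>u\<close> lies between two standard
  integers it has finitely many possible values, and the disjunction over them is
  first-order.\<close>

lemma digit_bound:
  assumes "x \<in> Univ H" "u \<in> Univ H" "unit_elem H u" "infra H x u"
    "lessS H x (mul H (int k) u)" "lessS H (minusS H x) (mul H (int k') u)"
  shows "\<exists>j. smaller H (sub H x (mul H j u)) u"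
proof -
  let ?js = "[- int k'..int k]"
  have G1: "\<exists>j\<in>{- int k'..int k}. smaller G1 (\<lambda>i. x i - j * u i) u"
    if u: "unit_elem G1 u" "infra G1 x u" "lessS G1 x (\<lambda>i. int k * u i)" "lessS G1 (\<lambda>i. - x i) (\<lambda>i. int k' * u i)" for x u
  proof -
    obtain i where i: "unit_at i u" using u by (auto simp: unit_elem_G1)
    have x: "\<forall>j<i. x j = 0" using u(2) infra_G1[OF i] by simp
    have le: "y i \<le> c" if y: "\<forall>j<i. y j = 0" "lessS G1 y (\<lambda>i. c * u i)" for y c
    proof -
      obtain j where j: "\<forall>k<j. y k = c * u k" "y j < c * u j" using y(2) by (auto simp: lessS_G1_iff)
      have "\<not> j < i" using j(2) y(1) i by (auto simp: unit_at_def)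
      then show ?thesis using j i by (cases "j = i") (auto simp: unit_at_def)
    qed
    have "x i \<le> int k" "- x i \<le> int k'" using le[of x "int k"] le[of "\<lambda>i. - x i" "int k'"] x u by auto
    then show ?thesis using i x smaller_G1[OF i]
      by (intro bexI[of _ "x i"]) (auto simp: unit_at_def le_less)
  qed
  have "sat H (assign H [x, u]) (ImpF (AndF (unitF 2 (Var 1)) (AndF (infraF 2 (Var 0) (Var 1))
    (AndF (LessF (Var 0) (mulT (int k) (Var 1))) (LessF (MinusT (Var 0)) (mulT (int k') (Var 1))))))
    (NotF (AndL (map (\<lambda>j. NotF (smallerF (DiffT (Var 0) (mulT j (Var 1))) (Var 1))) ?js))))"
    using assms(1,2) by (intro transfer_assign) (auto dest: G1)
  then show ?thesis using assms by (auto simp: assign_def val_DiffT_sub val_mulT_mul)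
qed

lemma mul_pos:
  assumes "u \<in> Univ H" "unit_elem H u" "k \<ge> 1" shows "lessS H (zeroS H) (mul H k u)"
proof -
  have "sat H (assign H [u]) (ImpF (unitF 1 (Var 0)) (LessF ZeroT (mulT k (Var 0))))"
    using assms(1,3) by (intro transfer_assign) (auto simp: unit_elem_G1 lessS_G1_zero_iff unit_at_def)
  then show ?thesis using assms by (simp add: assign_def val_mulT_mul)
qed

lemma mul_add:
  assumes "u \<in> Univ H" "y \<in> Univ H" "unit_elem H u" "lessS H y (mul H k u)" "k + 1 \<le> k'"
  shows "lessS H (plusS H y u) (mul H k' u)"
proof -
  have G1: "lessS G1 (\<lambda>i. y i + u i) (\<lambda>i. k' * u i)"
    if u: "unit_elem G1 u" "lessS G1 y (\<lambda>i. k * u i)" for u y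
  proof -
    obtain i where i: "unit_at i u" using u by (auto simp: unit_elem_G1)
    obtain j where j: "\<forall>l<j. y l = k * u l" "y j < k * u j" using u(2) by (auto simp: lessS_G1_iff)
    show ?thesis
    proof (cases "j \<le> i")
      case True
      then show ?thesis unfolding lessS_G1_iff using i j assms(5)
        by (intro exI[of _ j]) (cases "j = i"; auto simp: unit_at_def)
    next
      case False
      show ?thesis
      proof (cases "k' = k + 1")
        case True
        then show ?thesis unfolding lessS_G1_iff using j by (intro exI[of _ j]) (auto simp: algebra_simps)
      next
        case False
        then show ?thesis unfolding lessS_G1_iff using i j assms(5) \<open>\<not> j \<le> i\<close>
          by (intro exI[of _ i]) (auto simp: unit_at_def)
      qed
    qed
  qed
  have "sat H (assign H [u, y]) (ImpF (AndF (unitF 2 (Var 0)) (LessF (Var 1) (mulT k (Var 0))))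
     (LessF (PlusT (Var 1) (Var 0)) (mulT k' (Var 0))))"
    using assms(1,2) by (intro transfer_assign) (auto intro: G1)
  then show ?thesis using assms by (simp add: assign_def val_mulT_mul)
qed

lemma infra_minus:
  assumes "u \<in> Univ H" "x \<in> Univ H" "unit_elem H u" "infra H x u" shows "infra H (minusS H x) u"
proof -
  have "sat H (assign H [u, x]) (ImpF (AndF (unitF 2 (Var 0)) (infraF 2 (Var 1) (Var 0))) (infraF 2 (MinusT (Var 1)) (Var 0)))"
    using assms(1,2) by (intro transfer_assign) (auto simp: unit_elem_G1 infra_G1)
  then show ?thesis using assms by (simp add: assign_def)
qed

end

section \<open>Schemes on definable sets\<close>

definition inst1F :: "nat \<Rightarrow> oag_fm \<Rightarrow> oag_fm" where
  "inst1F k \<phi> = ExF 0 (AndF (EqF (Var 0) (Var k)) \<phi>)"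

definition inst2F :: "nat \<Rightarrow> nat \<Rightarrow> oag_fm \<Rightarrow> oag_fm" where
  "inst2F k l \<phi> = ExF 0 (ExF 1 (AndF (AndF (EqF (Var 0) (Var k)) (EqF (Var 1) (Var l))) \<phi>))"

text \<open>Well-ordering of the positions, relative to one set. Like the next two properties it
  holds in \<open>G1\<close> for every \<open>Y\<close>, hence as a scheme in all models for every
  definable \<open>Y\<close>.\<close>

definition well_ordered :: "'a oag_struct \<Rightarrow> ('a \<Rightarrow> bool) \<Rightarrow> bool" where
  "well_ordered M Y \<longleftrightarrow> ((\<exists>u\<in>Univ M. unit_elem M u \<and> Y u) \<longrightarrow>
     (\<exists>u\<in>Univ M. (unit_elem M u \<and> Y u) \<and> (\<forall>d\<in>Univ M. unit_elem M d \<and> Y d \<longrightarrow> \<not> smaller M u d)))"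

text \<open>The archimedean property of the digit at \<open>u\<close>, phrased as induction over
  initial segments. Zero and the sum enter through equations because \<open>inst1F\<close> can only
  insert a variable.\<close>

definition archimedean :: "'a oag_struct \<Rightarrow> ('a \<Rightarrow> bool) \<Rightarrow> bool" where
  "archimedean M Y \<longleftrightarrow> (\<forall>u\<in>Univ M. unit_elem M u \<and> (\<forall>y\<in>Univ M. y = zeroS M \<longrightarrow> Y y) \<and>
     (\<forall>y\<in>Univ M. \<forall>x\<in>Univ M. Y y \<and> x = plusS M y u \<longrightarrow> Y x) \<and>
     (\<forall>y\<in>Univ M. \<forall>x\<in>Univ M. lessS M x y \<and> Y y \<longrightarrow> Y x) \<longrightarrow> (\<forall>x\<in>Univ M. infra M x u \<longrightarrow> Y x))"

text \<open>Spherical completeness for a family with one ball per position: the fibre of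
  \<open>Y\<close> over \<open>u\<close> is a coset of the elements smaller than \<open>u\<close>,
  the fibres are nested, and a common point is claimed.\<close>

definition complete :: "'a oag_struct \<Rightarrow> ('a \<Rightarrow> 'a \<Rightarrow> bool) \<Rightarrow> bool" where
  "complete M Y \<longleftrightarrow>
     (\<forall>u\<in>Univ M. unit_elem M u \<longrightarrow> (\<exists>x\<in>Univ M. Y x u)) \<and>
     (\<forall>u\<in>Univ M. \<forall>x\<in>Univ M. \<forall>y\<in>Univ M. unit_elem M u \<and> Y x u \<and> Y y u \<longrightarrow> smaller M (sub M x y) u) \<and>
     (\<forall>u\<in>Univ M. \<forall>x\<in>Univ M. \<forall>y\<in>Univ M. unit_elem M u \<and> Y x u \<and> smaller M (sub M y x) u \<longrightarrow> Y y u) \<and>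
     (\<forall>u\<in>Univ M. \<forall>x\<in>Univ M. \<forall>v\<in>Univ M. unit_elem M u \<and> unit_elem M v \<and> \<not> smaller M v u \<and> Y x u \<longrightarrow> Y x v) \<longrightarrow>
     (\<exists>x\<in>Univ M. \<forall>u\<in>Univ M. unit_elem M u \<longrightarrow> Y x u)"

lemma well_ordered_G1: "well_ordered G1 Y"
  unfolding well_ordered_def
proof
  assume "\<exists>u\<in>Univ G1. unit_elem G1 u \<and> Y u"
  then have ex: "\<exists>i u. unit_at i u \<and> Y u" by (auto simp: unit_elem_G1)
  define i where "i = (LEAST i. \<exists>u. unit_at i u \<and> Y u)"
  obtain u where u: "unit_at i u" "Y u" using LeastI_ex[OF ex] unfolding i_def by blast
  have "\<not> smaller G1 u d" if d: "unit_elem G1 d" "Y d" for d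
  proof -
    obtain j where j: "unit_at j d" using d by (auto simp: unit_elem_G1)
    then have "i \<le> j" unfolding i_def using d(2) by (intro Least_le) blast
    then show ?thesis using smaller_unit_G1[OF u(1) j] by simp
  qed
  then show "\<exists>u\<in>Univ G1. (unit_elem G1 u \<and> Y u) \<and> (\<forall>d\<in>Univ G1. unit_elem G1 d \<and> Y d \<longrightarrow> \<not> smaller G1 u d)"
    using u by (intro bexI[of _ u]) (auto simp: unit_elem_G1)
qed

lemma archimedean_G1: "archimedean G1 Y"
  unfolding archimedean_def
proof (intro ballI impI)
  fix u x assume *: "unit_elem G1 u \<and> (\<forall>y\<in>Univ G1. y = zeroS G1 \<longrightarrow> Y y) \<and>
     (\<forall>y\<in>Univ G1. \<forall>x\<in>Univ G1. Y y \<and> x = plusS G1 y u \<longrightarrow> Y x) \<and>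
     (\<forall>y\<in>Univ G1. \<forall>x\<in>Univ G1. lessS G1 x y \<and> Y y \<longrightarrow> Y x)" and x: "infra G1 x u"
  obtain i where i: "unit_at i u" using * by (auto simp: unit_elem_G1)
  have x0: "\<forall>j<i. x j = 0" using x infra_G1[OF i] by simp
  have Yk: "Y (\<lambda>j. int k * u j)" for k
  proof (induction k)
    case 0 then show ?case using * by simp
  next
    case (Suc k)
    moreover have "\<forall>y. Y y \<longrightarrow> Y (plusS G1 y u)" using * unfolding Univ_G1 ball_UNIV by blast
    ultimately have "Y (plusS G1 (\<lambda>j. int k * u j) u)" by blast
    moreover have "plusS G1 (\<lambda>j. int k * u j) u = (\<lambda>j. int (Suc k) * u j)" by (auto simp: algebra_simps)
    ultimately show ?case by simp
  qed
  have "lessS G1 x (\<lambda>j. int (nat (x i + 1)) * u j)"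
    unfolding lessS_G1_iff using i x0 by (intro exI[of _ i]) (auto simp: unit_at_def)
  moreover have "\<forall>y x. lessS G1 x y \<and> Y y \<longrightarrow> Y x" using * unfolding Univ_G1 ball_UNIV by blast
  ultimately show "Y x" using Yk by blast
qed

text \<open>The ball at position \<open>i\<close> fixes the entries up to \<open>i\<close>, so the
  common point is the diagonal of a family of representatives.\<close>

lemma complete_G1: "complete G1 Y"
  unfolding complete_def
proof (rule impI, elim conjE)
  assume 1: "\<forall>u\<in>Univ G1. unit_elem G1 u \<longrightarrow> (\<exists>x\<in>Univ G1. Y x u)"
    and 2: "\<forall>u\<in>Univ G1. \<forall>x\<in>Univ G1. \<forall>y\<in>Univ G1. unit_elem G1 u \<and> Y x u \<and> Y y u \<longrightarrow> smaller G1 (sub G1 x y) u"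
    and 3: "\<forall>u\<in>Univ G1. \<forall>x\<in>Univ G1. \<forall>y\<in>Univ G1. unit_elem G1 u \<and> Y x u \<and> smaller G1 (sub G1 y x) u \<longrightarrow> Y y u"
    and 4: "\<forall>u\<in>Univ G1. \<forall>x\<in>Univ G1. \<forall>v\<in>Univ G1. unit_elem G1 u \<and> unit_elem G1 v \<and> \<not> smaller G1 v u \<and> Y x u \<longrightarrow> Y x v"
  define d :: "nat \<Rightarrow> nat \<Rightarrow> int" where "d i = (\<lambda>j. if j = i then 1 else 0)" for i
  have d: "unit_at i (d i)" "unit_elem G1 (d i)" for i by (auto simp: d_def unit_at_def unit_elem_G1)
  have "\<exists>x. Y x (d i)" for i using 1 d(2) by simp
  then obtain f where f: "\<And>i. Y (f i) (d i)" by metis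
  have eq: "f i j = f j j" if "j \<le> i" for i j
  proof -
    have "\<not> smaller G1 (d j) (d i)" using smaller_unit_G1[OF d(1) d(1)] that by simp
    then have "Y (f i) (d j)" using 4 d(2) f unfolding Univ_G1 ball_UNIV by blast
    then have "smaller G1 (sub G1 (f i) (f j)) (d j)" using 2 d(2) f unfolding Univ_G1 ball_UNIV by blast
    then show ?thesis using smaller_G1[OF d(1)] by simp
  qed
  have "Y (\<lambda>i. f i i) u" if u: "unit_elem G1 u" for u
  proof -
    obtain i where i: "unit_at i u" using u by (auto simp: unit_elem_G1)
    have "\<not> smaller G1 u (d i)" using smaller_unit_G1[OF i d(1)] by simp
    then have "Y (f i) u" using 4 d(2) u f unfolding Univ_G1 ball_UNIV by blast
    moreover have "smaller G1 (sub G1 (\<lambda>i. f i i) (f i)) u"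
      unfolding smaller_G1[OF i] sub_G1
    proof (intro allI impI)
      fix j assume "j \<le> i"
      then show "f j j - f i j = 0" using eq[of j i] by linarith
    qed
    moreover have "unit_elem G1 u \<and> Y (f i) u \<and> smaller G1 (sub G1 (\<lambda>i. f i i) (f i)) u \<longrightarrow> Y (\<lambda>i. f i i) u"
      by (rule 3[unfolded Univ_G1 ball_UNIV, THEN spec, THEN spec, THEN spec])
    ultimately show ?thesis using u by iprover
  qed
  then show "\<exists>x\<in>Univ G1. \<forall>u\<in>Univ G1. unit_elem G1 u \<longrightarrow> Y x u" by auto
qed

lemma sat_inst1F:
  assumes "all_vars \<phi> \<subseteq> {..<K}" "k \<ge> K" "K \<ge> 2" "\<And>i. i < K \<Longrightarrow> s i = b i"
  shows "sat M s (inst1F k \<phi>) \<longleftrightarrow> s k \<in> Univ M \<and> sat M (b(0 := s k)) \<phi>"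
proof -
  have "sat M s (inst1F k \<phi>) \<longleftrightarrow> s k \<in> Univ M \<and> sat M (s(0 := s k)) \<phi>"
    using assms(2,3) by (auto simp: inst1F_def)
  also have "sat M (s(0 := s k)) \<phi> \<longleftrightarrow> sat M (b(0 := s k)) \<phi>"
    using assms(1,4) free_vars_subset[of \<phi>] by (intro sat_cong) auto
  finally show ?thesis .
qed

lemma sat_inst2F:
  assumes "all_vars \<phi> \<subseteq> {..<K}" "k \<ge> K" "l \<ge> K" "K \<ge> 2" "\<And>i. i < K \<Longrightarrow> s i = b i"
  shows "sat M s (inst2F k l \<phi>) \<longleftrightarrow> s k \<in> Univ M \<and> s l \<in> Univ M \<and> sat M (b(0 := s k, 1 := s l)) \<phi>"
proof -
  have "sat M s (inst2F k l \<phi>) \<longleftrightarrow> s k \<in> Univ M \<and> s l \<in> Univ M \<and> sat M (s(0 := s k, 1 := s l)) \<phi>"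
    using assms(2-4) by (auto simp: inst2F_def)
  also have "sat M (s(0 := s k, 1 := s l)) \<phi> \<longleftrightarrow> sat M (b(0 := s k, 1 := s l)) \<phi>"
    using assms(1,5) free_vars_subset[of \<phi>] by (intro sat_cong) auto
  finally show ?thesis .
qed

lemma vars_bound: "\<exists>K\<ge>2. all_vars \<phi> \<subseteq> {..<K}"
proof -
  obtain k where "all_vars \<phi> \<subseteq> {..<k}" using finite_nat_iff_bounded finite_all_vars by blast
  then show ?thesis by (intro exI[of _ "max 2 k"]) auto
qed

text \<open>\<open>inst1F\<close> and \<open>inst2F\<close> also assert membership in the universe.
  This and the two following lemmas show that the three properties are insensitive to that
  conjunct.\<close>

lemma well_ordered_restrict: "well_ordered M (\<lambda>x. x \<in> Univ M \<and> Y x) \<longleftrightarrow> well_ordered M Y"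
  unfolding well_ordered_def by simp

lemma archimedean_restrict: "archimedean M (\<lambda>x. x \<in> Univ M \<and> Y x) \<longleftrightarrow> archimedean M Y"
proof -
  let ?U = "Univ M"
  have "(\<forall>y\<in>?U. y = zeroS M \<longrightarrow> y \<in> ?U \<and> Y y) \<longleftrightarrow> (\<forall>y\<in>?U. y = zeroS M \<longrightarrow> Y y)"
    "\<And>u. (\<forall>y\<in>?U. \<forall>x\<in>?U. (y \<in> ?U \<and> Y y) \<and> x = plusS M y u \<longrightarrow> x \<in> ?U \<and> Y x) \<longleftrightarrow>
       (\<forall>y\<in>?U. \<forall>x\<in>?U. Y y \<and> x = plusS M y u \<longrightarrow> Y x)"
    "(\<forall>y\<in>?U. \<forall>x\<in>?U. lessS M x y \<and> y \<in> ?U \<and> Y y \<longrightarrow> x \<in> ?U \<and> Y x) \<longleftrightarrow>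
       (\<forall>y\<in>?U. \<forall>x\<in>?U. lessS M x y \<and> Y y \<longrightarrow> Y x)"
    "\<And>u. (\<forall>x\<in>?U. infra M x u \<longrightarrow> x \<in> ?U \<and> Y x) \<longleftrightarrow> (\<forall>x\<in>?U. infra M x u \<longrightarrow> Y x)"
    by blast+
  then show ?thesis unfolding archimedean_def
    by (simp only:)
qed

lemma complete_restrict:
  "complete M (\<lambda>x u. x \<in> Univ M \<and> u \<in> Univ M \<and> Y x u) \<longleftrightarrow> complete M Y"
proof -
  let ?U = "Univ M" and ?Y = "\<lambda>x u. x \<in> Univ M \<and> u \<in> Univ M \<and> Y x u"
  have "(\<forall>u\<in>?U. unit_elem M u \<longrightarrow> (\<exists>x\<in>?U. ?Y x u)) \<longleftrightarrow> (\<forall>u\<in>?U. unit_elem M u \<longrightarrow> (\<exists>x\<in>?U. Y x u))"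
    "(\<forall>u\<in>?U. \<forall>x\<in>?U. \<forall>y\<in>?U. unit_elem M u \<and> ?Y x u \<and> ?Y y u \<longrightarrow> smaller M (sub M x y) u) \<longleftrightarrow>
       (\<forall>u\<in>?U. \<forall>x\<in>?U. \<forall>y\<in>?U. unit_elem M u \<and> Y x u \<and> Y y u \<longrightarrow> smaller M (sub M x y) u)"
    "(\<forall>u\<in>?U. \<forall>x\<in>?U. \<forall>y\<in>?U. unit_elem M u \<and> ?Y x u \<and> smaller M (sub M y x) u \<longrightarrow> ?Y y u) \<longleftrightarrow>
       (\<forall>u\<in>?U. \<forall>x\<in>?U. \<forall>y\<in>?U. unit_elem M u \<and> Y x u \<and> smaller M (sub M y x) u \<longrightarrow> Y y u)"
    "(\<forall>u\<in>?U. \<forall>x\<in>?U. \<forall>v\<in>?U. unit_elem M u \<and> unit_elem M v \<and> \<not> smaller M v u \<and> ?Y x u \<longrightarrow> ?Y x v) \<longleftrightarrow>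
       (\<forall>u\<in>?U. \<forall>x\<in>?U. \<forall>v\<in>?U. unit_elem M u \<and> unit_elem M v \<and> \<not> smaller M v u \<and> Y x u \<longrightarrow> Y x v)"
    "(\<exists>x\<in>?U. \<forall>u\<in>?U. unit_elem M u \<longrightarrow> ?Y x u) \<longleftrightarrow> (\<exists>x\<in>?U. \<forall>u\<in>?U. unit_elem M u \<longrightarrow> Y x u)"
    by blast+
  then show ?thesis unfolding complete_def
    by (simp only:)
qed

definition well_orderedF :: "nat \<Rightarrow> oag_fm \<Rightarrow> oag_fm" where
  "well_orderedF K \<phi> = ImpF (ExF K (AndF (unitF (K + 1) (Var K)) (inst1F K \<phi>)))
    (ExF K (AndF (AndF (unitF (K + 1) (Var K)) (inst1F K \<phi>))
       (AllF (K + 1) (ImpF (AndF (unitF (K + 2) (Var (K + 1))) (inst1F (K + 1) \<phi>))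
          (NotF (smallerF (Var K) (Var (K + 1))))))))"

definition archimedeanF :: "nat \<Rightarrow> oag_fm \<Rightarrow> oag_fm" where
  "archimedeanF K \<phi> = AllF K (ImpF
     (AndF (unitF (K + 1) (Var K))
     (AndF (AllF (K + 1) (ImpF (EqF (Var (K + 1)) ZeroT) (inst1F (K + 1) \<phi>)))
     (AndF (AllF (K + 1) (AllF (K + 2)
              (ImpF (AndF (inst1F (K + 1) \<phi>) (EqF (Var (K + 2)) (PlusT (Var (K + 1)) (Var K)))) (inst1F (K + 2) \<phi>))))
       (AllF (K + 1) (AllF (K + 2) (ImpF (AndF (LessF (Var (K + 2)) (Var (K + 1))) (inst1F (K + 1) \<phi>)) (inst1F (K + 2) \<phi>)))))))
     (AllF (K + 1) (ImpF (infraF (K + 2) (Var (K + 1)) (Var K)) (inst1F (K + 1) \<phi>))))"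

definition completeF :: "nat \<Rightarrow> oag_fm \<Rightarrow> oag_fm" where
  "completeF K \<phi> = ImpF
     (AndF (AllF K (ImpF (unitF (K + 1) (Var K)) (ExF (K + 1) (inst2F (K + 1) K \<phi>))))
     (AndF (AllF K (AllF (K + 1) (AllF (K + 2) (ImpF (AndF (unitF (K + 3) (Var K)) (AndF (inst2F (K + 1) K \<phi>) (inst2F (K + 2) K \<phi>)))
              (smallerF (DiffT (Var (K + 1)) (Var (K + 2))) (Var K))))))
     (AndF (AllF K (AllF (K + 1) (AllF (K + 2) (ImpF (AndF (unitF (K + 3) (Var K)) (AndF (inst2F (K + 1) K \<phi>)
              (smallerF (DiffT (Var (K + 2)) (Var (K + 1))) (Var K)))) (inst2F (K + 2) K \<phi>)))))
       (AllF K (AllF (K + 1) (AllF (K + 2) (ImpF (AndF (unitF (K + 3) (Var K)) (AndF (unitF (K + 3) (Var (K + 2)))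
              (AndF (NotF (smallerF (Var (K + 2)) (Var K))) (inst2F (K + 1) K \<phi>)))) (inst2F (K + 1) (K + 2) \<phi>))))))))
     (ExF (K + 1) (AllF K (ImpF (unitF (K + 2) (Var K)) (inst2F (K + 1) K \<phi>))))"

lemma sat_well_orderedF:
  assumes K: "all_vars \<phi> \<subseteq> {..<K}" "K \<ge> 2"
  shows "sat M s (well_orderedF K \<phi>) \<longleftrightarrow> well_ordered M (\<lambda>x. sat M (s(0 := x)) \<phi>)"
  unfolding well_ordered_restrict[of M "\<lambda>x. sat M (s(0 := x)) \<phi>", symmetric]
  unfolding well_orderedF_def well_ordered_def
  using K(2) by (simp add: sat_inst1F[OF K(1) _ K(2), of _ _ s])

lemma sat_archimedeanF:
  assumes K: "all_vars \<phi> \<subseteq> {..<K}" "K \<ge> 2"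
  shows "sat M s (archimedeanF K \<phi>) \<longleftrightarrow> archimedean M (\<lambda>x. sat M (s(0 := x)) \<phi>)"
  unfolding archimedean_restrict[of M "\<lambda>x. sat M (s(0 := x)) \<phi>", symmetric]
  unfolding archimedeanF_def archimedean_def
  using K(2) by (simp add: sat_inst1F[OF K(1) _ K(2), of _ _ s] cong del: imp_cong)

lemma sat_completeF:
  assumes K: "all_vars \<phi> \<subseteq> {..<K}" "K \<ge> 2"
  shows "sat M s (completeF K \<phi>) \<longleftrightarrow> complete M (\<lambda>x u. sat M (s(0 := x, 1 := u)) \<phi>)"
  unfolding complete_restrict[of M "\<lambda>x u. sat M (s(0 := x, 1 := u)) \<phi>", symmetric]
  unfolding completeF_def complete_def
  using K(2) by (simp add: sat_inst2F[OF K(1) _ _ K(2), of _ _ _ s] val_DiffT_sub cong del: imp_cong)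

context G1_model
begin

lemma well_ordered_definable:
  assumes b: "range b \<subseteq> Univ H"
  shows "well_ordered H (\<lambda>x. sat H (b(0 := x)) \<phi>)"
proof -
  obtain K where K: "K \<ge> 2" "all_vars \<phi> \<subseteq> {..<K}" using vars_bound by blast
  have "sat H b (well_orderedF K \<phi>)"
    by (rule transfer[OF _ b]) (simp add: sat_well_orderedF[OF K(2,1)] well_ordered_G1)
  then show ?thesis by (simp add: sat_well_orderedF[OF K(2,1)])
qed

lemma archimedean_definable:
  assumes b: "range b \<subseteq> Univ H"
  shows "archimedean H (\<lambda>x. sat H (b(0 := x)) \<phi>)"
proof -
  obtain K where K: "K \<ge> 2" "all_vars \<phi> \<subseteq> {..<K}" using vars_bound by blast
  have "sat H b (archimedeanF K \<phi>)"
    by (rule transfer[OF _ b]) (simp add: sat_archimedeanF[OF K(2,1)] archimedean_G1)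
  then show ?thesis by (simp add: sat_archimedeanF[OF K(2,1)])
qed

lemma complete_definable:
  assumes b: "range b \<subseteq> Univ H"
  shows "complete H (\<lambda>x u. sat H (b(0 := x, 1 := u)) \<phi>)"
proof -
  obtain K where K: "K \<ge> 2" "all_vars \<phi> \<subseteq> {..<K}" using vars_bound by blast
  have "sat H b (completeF K \<phi>)"
    by (rule transfer[OF _ b]) (simp add: sat_completeF[OF K(2,1)] complete_G1)
  then show ?thesis by (simp add: sat_completeF[OF K(2,1)])
qed

end

section \<open>Stably embedded models\<close>

lemma lessS_G1_total: "a \<noteq> b \<Longrightarrow> lessS G1 a b \<or> lessS G1 b a"
proof -
  assume "a \<noteq> b"
  then have ex: "\<exists>i. a i \<noteq> b i" by (auto simp: fun_eq_iff)
  define i where "i = (LEAST i. a i \<noteq> b i)"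
  have "a i \<noteq> b i" "\<forall>j<i. a j = b j"
    using LeastI_ex[OF ex] not_less_Least[of _ "\<lambda>i. a i \<noteq> b i"] unfolding i_def by blast+
  moreover from this(1) have "a i < b i \<or> b i < a i" by linarith
  ultimately show ?thesis unfolding lessS_G1_iff by (metis (no_types))
qed

locale stable_model = G1_model H for H :: "'a oag_struct" +
  assumes stable: "stably_embedded TYPE(nat \<Rightarrow> 'a) H"
begin

text \<open>The ultrapower is taken as the elementary extension, with the class of \<open>c\<close>
  assigned to every variable from \<open>m\<close> on. By the theorem of Los the trace consists of
  the tuples that satisfy \<open>\<psi>\<close> with parameter \<open>c n\<close> for almost all
  \<open>n\<close>.\<close>

lemma trace_definable:
  fixes U :: "nat filter"
  assumes U: "ultrafilter U" and c: "range c \<subseteq> Univ H"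
  shows "\<exists>\<phi> b. range b \<subseteq> Univ H \<and> (\<forall>xs\<in>tuples H m.
     sat H (\<lambda>i. if i < m then xs ! i else b i) \<phi> \<longleftrightarrow> (\<forall>\<^sub>F n in U. sat H (\<lambda>i. if i < m then xs ! i else c n) \<psi>))"
proof -
  let ?N = "ultrapower U H" and ?e = "\<lambda>a. rep U H (\<lambda>_. a)"
  let ?D = "{ys \<in> tuples ?N m. sat ?N (\<lambda>i. if i < m then ys ! i else rep U H c) \<psi>}"
  have "definable ?N m ?D"
    unfolding definable_def using rep_in_ultrapower[OF c]
    by (intro exI[of _ \<psi>] exI[of _ "\<lambda>_. rep U H c"]) auto
  then have "definable H m {xs \<in> tuples H m. map ?e xs \<in> ?D}"
    using stable is_structure_ultrapower[OF is_structure_H] elementary_embedding_ultrapower[OF is_structure_H U]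
    unfolding stably_embedded_def by blast
  then obtain \<phi> b where b: "range b \<subseteq> Univ H" and
    eq: "{xs \<in> tuples H m. map ?e xs \<in> ?D} = {xs \<in> tuples H m. sat H (\<lambda>i. if i < m then xs ! i else b i) \<phi>}"
    unfolding definable_def by blast
  have "sat H (\<lambda>i. if i < m then xs ! i else b i) \<phi> \<longleftrightarrow> (\<forall>\<^sub>F n in U. sat H (\<lambda>i. if i < m then xs ! i else c n) \<psi>)"
    if xs: "xs \<in> tuples H m" for xs
  proof -
    have el: "xs ! i \<in> Univ H" if "i < m" for i using xs that by (auto simp: tuples_def intro: nth_mem)
    have "sat H (\<lambda>i. if i < m then xs ! i else b i) \<phi> \<longleftrightarrow> map ?e xs \<in> ?D" using eq xs by blast
    also have "\<dots> \<longleftrightarrow> sat ?N (\<lambda>i. if i < m then map ?e xs ! i else rep U H c) \<psi>"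
    proof -
      have "map ?e xs \<in> tuples ?N m" using xs by (auto simp: tuples_def intro!: rep_in_ultrapower)
      then show ?thesis by simp
    qed
    also have "(\<lambda>i. if i < m then map ?e xs ! i else rep U H c) = (\<lambda>i. rep U H (\<lambda>n. if i < m then xs ! i else c n))"
      using xs by (auto simp: tuples_def)
    also have "sat ?N \<dots> \<psi> \<longleftrightarrow> (\<forall>\<^sub>F n in U. sat H (\<lambda>i. if i < m then xs ! i else c n) \<psi>)"
      using el c by (intro sat_ultrapower_cong[OF is_structure_H U]) auto
    finally show ?thesis .
  qed
  then show ?thesis using b by blast
qed

lemma trace_definable1:
  fixes U :: "nat filter"
  assumes "ultrafilter U" "range c \<subseteq> Univ H"
  obtains \<phi> b where "range b \<subseteq> Univ H"
    "\<And>x. x \<in> Univ H \<Longrightarrow> sat H (b(0 := x)) \<phi> \<longleftrightarrow> (\<forall>\<^sub>F n in U. sat H ((\<lambda>_. c n)(0 := x)) \<psi>)"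
proof -
  obtain \<phi> b where b: "range b \<subseteq> Univ H" and eq: "\<forall>xs\<in>tuples H 1.
     sat H (\<lambda>i. if i < 1 then xs ! i else b i) \<phi> \<longleftrightarrow> (\<forall>\<^sub>F n in U. sat H (\<lambda>i. if i < 1 then xs ! i else c n) \<psi>)"
    using trace_definable[OF assms, of 1 \<psi>] by blast
  have "(\<lambda>i. if i < 1 then [x] ! i else d i) = d(0 := x)" for d :: "nat \<Rightarrow> 'a" and x by auto
  from eq[unfolded tuples_def, rule_format, of "[_]", unfolded this] show thesis
    by (intro that[OF b]) auto
qed

lemma trace_definable2:
  fixes U :: "nat filter"
  assumes "ultrafilter U" "range c \<subseteq> Univ H"
  obtains \<phi> b where "range b \<subseteq> Univ H"
    "\<And>x y. x \<in> Univ H \<Longrightarrow> y \<in> Univ H \<Longrightarrow>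
       sat H (b(0 := x, 1 := y)) \<phi> \<longleftrightarrow> (\<forall>\<^sub>F n in U. sat H ((\<lambda>_. c n)(0 := x, 1 := y)) \<psi>)"
proof -
  obtain \<phi> b where b: "range b \<subseteq> Univ H" and eq: "\<forall>xs\<in>tuples H 2.
     sat H (\<lambda>i. if i < 2 then xs ! i else b i) \<phi> \<longleftrightarrow> (\<forall>\<^sub>F n in U. sat H (\<lambda>i. if i < 2 then xs ! i else c n) \<psi>)"
    using trace_definable[OF assms, of 2 \<psi>] by blast
  have "(\<lambda>i. if i < 2 then [x, y] ! i else d i) = d(0 := x, 1 := y)" for d :: "nat \<Rightarrow> 'a" and x y
    by (auto simp: less_2_cases_iff)
  from eq[unfolded tuples_def, rule_format, of "[_, _]", unfolded this] show thesis
    by (intro that[OF b]) auto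
qed

definition uf :: "nat filter" where
  "uf = (SOME uf. uf \<le> sequentially \<and> ultrafilter uf)"

lemma uf: "uf \<le> sequentially" "ultrafilter uf"
proof -
  have "\<exists>uf\<le>sequentially. ultrafilter uf" by (rule ultrafilter_exists) simp
  then have "\<exists>uf. uf \<le> sequentially \<and> ultrafilter uf" by blast
  from someI_ex[OF this] show "uf \<le> sequentially" "ultrafilter uf" unfolding uf_def by auto
qed

lemma eventually_U:
  assumes "\<And>n. n \<ge> N \<Longrightarrow> P n" shows "\<forall>\<^sub>F n in uf. P n"
  using filter_leD[OF uf(1) eventually_sequentiallyI[of N P]] assms by blast

lemma eventually_U_exists:
  assumes "\<forall>\<^sub>F n in uf. P n" shows "\<exists>n\<ge>N. P n"
proof -
  have "\<forall>\<^sub>F n in uf. n \<ge> N" by (rule eventually_U)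
  with assms have "\<forall>\<^sub>F n in uf. n \<ge> N \<and> P n" by eventually_elim simp
  then show ?thesis using uf(2) eventually_happens by (fastforce simp: ultrafilter_def)
qed

section \<open>The value set is \<omega>\<close>

lemma unit_chain_exists:
  "\<exists>unit_seq. (\<forall>n. unit_seq n \<in> Univ H \<and> unit_elem H (unit_seq n)) \<and> first_unit H (unit_seq 0) \<and> (\<forall>n. next_unit H (unit_seq n) (unit_seq (Suc n)))"
proof -
  have "\<exists>unit_seq. \<forall>n. (unit_seq n \<in> Univ H \<and> unit_elem H (unit_seq n) \<and> (n = 0 \<longrightarrow> first_unit H (unit_seq n))) \<and> next_unit H (unit_seq n) (unit_seq (Suc n))"
  proof (rule dependent_nat_choice[where Q = "\<lambda>n x y. next_unit H x y"])
    show "\<exists>x. x \<in> Univ H \<and> unit_elem H x \<and> (0 = (0::nat) \<longrightarrow> first_unit H x)"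
      using first_unit_exists by (auto simp: first_unit_def)
    show "\<exists>y. (y \<in> Univ H \<and> unit_elem H y \<and> (Suc n = 0 \<longrightarrow> first_unit H y)) \<and> next_unit H x y"
      if "x \<in> Univ H \<and> unit_elem H x \<and> (n = 0 \<longrightarrow> first_unit H x)" for x n
      using next_unit_exists[of x] that by (auto simp: next_unit_def)
  qed
  then show ?thesis by blast
qed

definition unit_seq :: "nat \<Rightarrow> 'a" where
  "unit_seq = (SOME unit_seq. (\<forall>n. unit_seq n \<in> Univ H \<and> unit_elem H (unit_seq n)) \<and> first_unit H (unit_seq 0) \<and> (\<forall>n. next_unit H (unit_seq n) (unit_seq (Suc n))))"

lemma unit_seq: "unit_seq n \<in> Univ H" "unit_elem H (unit_seq n)" "first_unit H (unit_seq 0)" "next_unit H (unit_seq n) (unit_seq (Suc n))"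
  using someI_ex[OF unit_chain_exists] unfolding unit_seq_def by blast+

lemma range_unit_seq: "range unit_seq \<subseteq> Univ H"
  using unit_seq(1) by auto

lemma transfer_chain:
  assumes G1: "\<And>s. (\<forall>i\<le>n. unit_at i (s i)) \<Longrightarrow> sat G1 s \<phi>"
    and s: "range s \<subseteq> Univ H" "\<And>i. i \<le> n \<Longrightarrow> s i = unit_seq i"
  shows "sat H s \<phi>"
proof -
  have "sat H s (ImpF (chainF n) \<phi>)"
    using G1 s(1) by (intro transfer) (simp_all add: sat_chainF_G1)
  moreover have "sat H s (chainF n)" using unit_seq s(2) by (simp add: sat_chainF)
  ultimately show ?thesis by simp
qed

lemma smaller_unit_seq_mono:
  assumes "x \<in> Univ H" "smaller H x (unit_seq n)" "m \<le> n" shows "smaller H x (unit_seq m)"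
proof -
  have "sat H (unit_seq(Suc n := x)) (ImpF (smallerF (Var (Suc n)) (Var n)) (smallerF (Var (Suc n)) (Var m)))"
  proof (rule transfer_chain[of n])
    fix s :: "nat \<Rightarrow> nat \<Rightarrow> int" assume "\<forall>i\<le>n. unit_at i (s i)"
    then have "unit_at n (s n)" "unit_at m (s m)" using assms(3) by auto
    then show "sat G1 s (ImpF (smallerF (Var (Suc n)) (Var n)) (smallerF (Var (Suc n)) (Var m)))"
      using assms(3) by (simp add: smaller_G1[of n "s n"] smaller_G1[of m "s m"])
  qed (use assms(1) range_unit_seq in auto)
  then show ?thesis using assms by simp
qed

text \<open>The elements beyond all \<open>unit_seq n\<close> are a trace and hence definable. A
  unit of least position among them has a predecessor outside the set, which is therefore not after
  some \<open>unit_seq n\<close>; then the unit itself is not after \<open>unit_seq (Suc n)\<close>,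
  a contradiction.\<close>

lemma levels:
  assumes "u \<in> Univ H" "unit_elem H u"
  shows "\<exists>n. \<not> smaller H u (unit_seq n)"
proof (rule ccontr)
  assume "\<not> ?thesis"
  then have u: "\<And>n. smaller H u (unit_seq n)" by blast
  obtain \<phi> b where b: "range b \<subseteq> Univ H" and
    "\<And>x. x \<in> Univ H \<Longrightarrow> sat H (b(0 := x)) \<phi> \<longleftrightarrow> (\<forall>\<^sub>F n in uf. sat H ((\<lambda>_. unit_seq n)(0 := x)) (smallerF (Var 0) (Var 1)))"
    by (rule trace_definable1[OF uf(2) range_unit_seq, where \<psi> = "smallerF (Var 0) (Var 1)"]) (rule that)
  then have Y: "sat H (b(0 := x)) \<phi> \<longleftrightarrow> (\<forall>\<^sub>F n in uf. smaller H x (unit_seq n))" if "x \<in> Univ H" for x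
    using that by simp
  have all: "\<forall>n. smaller H x (unit_seq n)" if "x \<in> Univ H" "sat H (b(0 := x)) \<phi>" for x
  proof
    fix n
    have "\<exists>m\<ge>n. smaller H x (unit_seq m)" using Y that eventually_U_exists by blast
    then show "smaller H x (unit_seq n)" using smaller_unit_seq_mono[OF that(1)] by blast
  qed
  have "sat H (b(0 := u)) \<phi>" using Y[OF assms(1)] u by simp
  then obtain v where v: "v \<in> Univ H" "unit_elem H v" "sat H (b(0 := v)) \<phi>"
    and min: "\<And>d. d \<in> Univ H \<Longrightarrow> unit_elem H d \<Longrightarrow> sat H (b(0 := d)) \<phi> \<Longrightarrow> \<not> smaller H v d"
    using well_ordered_definable[OF b, of \<phi>] assms unfolding well_ordered_def by blast
  have "\<exists>c\<in>Univ H. unit_elem H c \<and> next_unit H c v"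
    by (rule pred_unit_exists[OF v(1) unit_seq(1) v(2) unit_seq(2)]) (use all[OF v(1,3)] in blast)
  then obtain c where c: "c \<in> Univ H" "unit_elem H c" "next_unit H c v" by blast
  have "smaller H v c" using c(3) by (simp add: next_unit_def)
  then have "\<not> sat H (b(0 := c)) \<phi>" using min c by blast
  then obtain n where "\<not> smaller H c (unit_seq n)" using Y[OF c(1)] eventually_U[of 0 "\<lambda>n. smaller H c (unit_seq n)"] by blast
  then have "\<not> smaller H v (unit_seq (Suc n))"
    using next_unit_mono[OF c(1) v(1) unit_seq(1) unit_seq(1) c(2) unit_seq(2) c(3) unit_seq(4)] by blast
  then show False using all[OF v(1,3)] by blast
qed

text \<open>The elements below some standard multiple of \<open>u\<close> are the trace of those
  below the multiple by an infinite number, hence definable. They form an initial segment closed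
  under adding \<open>u\<close>, so the archimedean scheme applies.\<close>

lemma multiples_cofinal:
  assumes u: "u \<in> Univ H" "unit_elem H u" and x: "x \<in> Univ H" "infra H x u"
  shows "\<exists>k. lessS H x (mul H (int k) u)"
proof -
  have range_mul: "range (\<lambda>n. mul H (int n) u) \<subseteq> Univ H" using mul_closed[OF u(1)] by auto
  obtain \<phi> b where b: "range b \<subseteq> Univ H" and
    "\<And>x. x \<in> Univ H \<Longrightarrow> sat H (b(0 := x)) \<phi> \<longleftrightarrow>
       (\<forall>\<^sub>F n in uf. sat H ((\<lambda>_. mul H (int n) u)(0 := x)) (LessF (Var 0) (Var 1)))"
    by (rule trace_definable1[OF uf(2) range_mul, where \<psi> = "LessF (Var 0) (Var 1)"]) (rule that)
  then have Y: "sat H (b(0 := x)) \<phi> \<longleftrightarrow> (\<forall>\<^sub>F n in uf. lessS H x (mul H (int n) u))" if "x \<in> Univ H" for x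
    using that by simp
  have zero: "sat H (b(0 := y)) \<phi>" if "y \<in> Univ H" "y = zeroS H" for y
    unfolding Y[OF that(1)] by (rule eventually_U[of 1]) (use mul_pos[OF u] that in auto)
  have plus: "sat H (b(0 := z)) \<phi>" if yz: "y \<in> Univ H" "z \<in> Univ H" "sat H (b(0 := y)) \<phi> \<and> z = plusS H y u" for y z
  proof -
    obtain n where n: "lessS H y (mul H (int n) u)" using yz Y eventually_U_exists by blast
    show ?thesis
      unfolding Y[OF yz(2)] using mul_add[OF u(1) yz(1) u(2) n] yz(3) by (intro eventually_U[of "n + 1"]) auto
  qed
  have down: "sat H (b(0 := z)) \<phi>" if "y \<in> Univ H" "z \<in> Univ H" "lessS H z y \<and> sat H (b(0 := y)) \<phi>" for y z
  proof -
    have "\<forall>\<^sub>F n in uf. lessS H y (mul H (int n) u)" using that Y by blast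
    then show ?thesis unfolding Y[OF that(2)]
      by eventually_elim (use less_trans_H[OF that(2,1) mul_closed[OF u(1)]] that(3) in blast)
  qed
  have "sat H (b(0 := x)) \<phi>"
    using archimedean_definable[OF b, of \<phi>, unfolded archimedean_def, THEN bspec, OF u(1), THEN mp] u(2) zero plus down x
    by blast
  then show ?thesis using Y[OF x(1)] eventually_U_exists by blast
qed

lemma digit_exists:
  assumes "u \<in> Univ H" "unit_elem H u" "x \<in> Univ H" "infra H x u"
  shows "\<exists>j. smaller H (sub H x (mul H j u)) u"
proof -
  obtain k where k: "lessS H x (mul H (int k) u)" using multiples_cofinal[OF assms] by blast
  have "infra H (minusS H x) u" by (rule infra_minus[OF assms(1,3,2,4)])
  then obtain k' where k': "lessS H (minusS H x) (mul H (int k') u)"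
    using multiples_cofinal[OF assms(1,2) closed(3)[OF assms(3)]] by blast
  show ?thesis by (rule digit_bound[OF assms(3,1,2,4) k k'])
qed

section \<open>Expansions along the standard units\<close>

definition psum :: "nat \<Rightarrow> (nat \<Rightarrow> int) \<Rightarrow> 'a" where
  "psum n a = val H unit_seq (linT n a)"

lemma psum_closed: "psum n a \<in> Univ H"
  unfolding psum_def by (rule val_in_Univ[OF is_structure_H range_unit_seq])

lemma val_linT_psum: "(\<And>i. i < n \<Longrightarrow> s i = unit_seq i) \<Longrightarrow> val H s (linT n a) = psum n a"
  unfolding psum_def using term_vars_linT[of n a] by (intro val_cong) auto

lemma linT_cong: "(\<And>i. i < n \<Longrightarrow> a i = a' i) \<Longrightarrow> linT n a = linT n a'"
  by (induction n) auto

lemma psum_cong: "(\<And>i. i < n \<Longrightarrow> a i = a' i) \<Longrightarrow> psum n a = psum n a'"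
  unfolding psum_def by (simp add: linT_cong[of n a a'])

text \<open>Units may have arbitrary tails, so \<open>a\<close> lists coefficients with respect to
  \<open>unit_seq\<close> rather than digits. The sum of \<open>Suc n\<close> terms includes the
  coefficient at position \<open>n\<close>, and agreement with \<open>x\<close> is required through
  that position.\<close>

definition expands :: "'a \<Rightarrow> (nat \<Rightarrow> int) \<Rightarrow> bool" where
  "expands x a \<longleftrightarrow> (\<forall>n. smaller H (sub H x (psum (Suc n) a)) (unit_seq n))"

text \<open>The units after \<open>unit_seq n\<close> vanish through position \<open>n\<close>, so
  the partial sums form a Cauchy sequence.\<close>

lemma psum_tail:
  assumes "n < m" shows "smaller H (sub H (psum (Suc n) a) (psum m a)) (unit_seq n)"
proof -
  have "sat H unit_seq (smallerF (DiffT (linT (Suc n) a) (linT m a)) (Var n))"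
  proof (rule transfer_chain[of m])
    fix s :: "nat \<Rightarrow> nat \<Rightarrow> int" assume s: "\<forall>i\<le>m. unit_at i (s i)"
    then have un: "unit_at n (s n)" using assms by simp
    show "sat G1 s (smallerF (DiffT (linT (Suc n) a) (linT m a)) (Var n))"
      using lin_diff_len[OF s assms] by (simp add: smaller_G1[OF un] del: linT.simps)
  qed (use range_unit_seq in auto)
  then show ?thesis by (simp add: psum_def val_DiffT_sub del: linT.simps)
qed

lemma psum_plus:
  assumes "x \<in> Univ H" "y \<in> Univ H" "smaller H (sub H x (psum (Suc n) a)) (unit_seq n)" "smaller H (sub H y (psum (Suc n) b)) (unit_seq n)"
  shows "smaller H (sub H (plusS H x y) (psum (Suc n) (\<lambda>i. a i + b i))) (unit_seq n)"
proof -
  let ?s = "unit_seq(Suc n := x, Suc (Suc n) := y)"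
  let ?X = "Var (Suc n)" and ?Y = "Var (Suc (Suc n))"
  let ?F = "ImpF (AndF (smallerF (DiffT ?X (linT (Suc n) a)) (Var n)) (smallerF (DiffT ?Y (linT (Suc n) b)) (Var n)))
     (smallerF (DiffT (PlusT ?X ?Y) (linT (Suc n) (\<lambda>i. a i + b i))) (Var n))"
  have "sat H ?s ?F"
  proof (rule transfer_chain[of n])
    fix s :: "nat \<Rightarrow> nat \<Rightarrow> int" assume s: "\<forall>i\<le>n. unit_at i (s i)"
    then have un: "unit_at n (s n)" by simp
    have "lin (Suc n) (\<lambda>i. a i + b i) s k = lin (Suc n) a s k + lin (Suc n) b s k" for k
      by (simp add: lin_def sum.distrib algebra_simps)
    then show "sat G1 s ?F"
      by (simp add: smaller_G1[OF un] del: linT.simps)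
  qed (use range_unit_seq assms in auto)
  then show ?thesis using assms by (simp add: val_DiffT_sub val_linT_psum del: linT.simps)
qed

lemma psum_minus:
  assumes "x \<in> Univ H" "smaller H (sub H x (psum (Suc n) a)) (unit_seq n)"
  shows "smaller H (sub H (minusS H x) (psum (Suc n) (\<lambda>i. - a i))) (unit_seq n)"
proof -
  let ?s = "unit_seq(Suc n := x)" and ?X = "Var (Suc n)"
  let ?F = "ImpF (smallerF (DiffT ?X (linT (Suc n) a)) (Var n))
     (smallerF (DiffT (MinusT ?X) (linT (Suc n) (\<lambda>i. - a i))) (Var n))"
  have "sat H ?s ?F"
  proof (rule transfer_chain[of n])
    fix s :: "nat \<Rightarrow> nat \<Rightarrow> int" assume s: "\<forall>i\<le>n. unit_at i (s i)"
    then have un: "unit_at n (s n)" by simp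
    have "lin (Suc n) (\<lambda>i. - a i) s k = - lin (Suc n) a s k" for k
      by (simp add: lin_def sum_negf)
    then show "sat G1 s ?F"
      by (simp add: smaller_G1[OF un] del: linT.simps)
  qed (use range_unit_seq assms in auto)
  then show ?thesis using assms by (simp add: val_DiffT_sub val_linT_psum del: linT.simps)
qed

lemma psum_zero: "smaller H (sub H (zeroS H) (psum (Suc n) (\<lambda>_. 0))) (unit_seq n)"
proof -
  have "sat H unit_seq (smallerF (DiffT ZeroT (linT (Suc n) (\<lambda>_. 0))) (Var n))"
  proof (rule transfer_chain[of n])
    fix s :: "nat \<Rightarrow> nat \<Rightarrow> int" assume "\<forall>i\<le>n. unit_at i (s i)"
    then have un: "unit_at n (s n)" by simp
    show "sat G1 s (smallerF (DiffT ZeroT (linT (Suc n) (\<lambda>_. 0))) (Var n))"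
      by (simp add: smaller_G1[OF un] lin_zero del: linT.simps)
  qed (use range_unit_seq in auto)
  then show ?thesis by (simp add: psum_def val_DiffT_sub del: linT.simps)
qed

text \<open>By unitriangularity the difference of the two sums has its leading digit at position
  \<open>n\<close>, and this digit is \<open>b n - a n\<close>.\<close>

lemma psum_less:
  assumes "x \<in> Univ H" "y \<in> Univ H" "smaller H (sub H x (psum (Suc n) a)) (unit_seq n)" "smaller H (sub H y (psum (Suc n) b)) (unit_seq n)"
    and ab: "\<forall>i<n. a i = b i" "a n < b n"
  shows "lessS H x y"
proof -
  let ?s = "unit_seq(Suc n := x, Suc (Suc n) := y)"
  let ?X = "Var (Suc n)" and ?Y = "Var (Suc (Suc n))"
  let ?F = "ImpF (AndF (smallerF (DiffT ?X (linT (Suc n) a)) (Var n)) (smallerF (DiffT ?Y (linT (Suc n) b)) (Var n)))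
     (LessF ?X ?Y)"
  have "sat H ?s ?F"
  proof (rule transfer_chain[of n])
    fix s :: "nat \<Rightarrow> nat \<Rightarrow> int" assume s: "\<forall>i\<le>n. unit_at i (s i)"
    then have un: "unit_at n (s n)" by simp
    let ?d = "\<lambda>i. b i - a i"
    have d: "lin (Suc n) ?d s k = lin (Suc n) b s k - lin (Suc n) a s k" for k by (rule lin_diff)
    have d0: "lin (Suc n) ?d s k = 0" if "k < n" for k
      by (rule lin_triangular_zero[of _ _ n]) (use s ab that in auto)
    have dn: "lin (Suc n) ?d s n = b n - a n"
      by (rule lin_triangular_lead[OF s]) (use ab in auto)
    have "lessS G1 X Y" if "\<forall>j\<le>n. X j = lin (Suc n) a s j" "\<forall>j\<le>n. Y j = lin (Suc n) b s j" for X Y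
      unfolding lessS_G1_iff using that d d0 dn ab(2) by (intro exI[of _ n]) auto
    then show "sat G1 s ?F"
      by (simp add: smaller_G1[OF un] del: linT.simps)
  qed (use range_unit_seq assms in auto)
  then show ?thesis using assms by (simp add: val_DiffT_sub val_linT_psum del: linT.simps)
qed

lemma psum_step:
  assumes "x \<in> Univ H" "smaller H (sub H (sub H x (psum n a)) (mul H k (unit_seq n))) (unit_seq n)"
  shows "smaller H (sub H x (psum (Suc n) (a(n := k)))) (unit_seq n)"
proof -
  let ?s = "unit_seq(Suc n := x)" and ?X = "Var (Suc n)"
  let ?F = "ImpF (smallerF (DiffT (DiffT ?X (linT n a)) (mulT k (Var n))) (Var n))
     (smallerF (DiffT ?X (linT (Suc n) (a(n := k)))) (Var n))"
  have "sat H ?s ?F"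
  proof (rule transfer_chain[of n])
    fix s :: "nat \<Rightarrow> nat \<Rightarrow> int" assume s: "\<forall>i\<le>n. unit_at i (s i)"
    then have un: "unit_at n (s n)" by simp
    have "lin (Suc n) (a(n := k)) s j = lin n a s j + k * s n j" for j
      by (auto simp: lin_def)
    then show "sat G1 s ?F"
      by (simp add: smaller_G1[OF un] algebra_simps del: linT.simps)
  qed (use range_unit_seq assms in auto)
  then show ?thesis using assms by (simp add: val_DiffT_sub val_mulT_mul val_linT_psum del: linT.simps)
qed

text \<open>The coefficients are chosen greedily: the remainder after \<open>n\<close> terms has
  valuation at least that of \<open>unit_seq n\<close>, so \<open>digit_exists\<close> yields the
  next one. Each choice alters only later coefficients, and the expansion is read off the
  diagonal.\<close>

lemma expansion_exists:
  assumes x: "x \<in> Univ H" shows "\<exists>a. expands x a"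
proof -
  let ?P = "\<lambda>n a. \<forall>m\<le>n. smaller H (sub H x (psum (Suc m) a)) (unit_seq m)"
  let ?Q = "\<lambda>n a a'. \<forall>i\<le>n. a' i = (a i :: int)"
  have step: "\<exists>k. smaller H (sub H x (psum (Suc n) (a(n := k)))) (unit_seq n)" if inf: "infra H (sub H x (psum n a)) (unit_seq n)" for n a
    using digit_exists[OF unit_seq(1) unit_seq(2) sub_closed[OF x psum_closed] inf] psum_step[OF x] by blast
  have "\<exists>f. \<forall>n. ?P n (f n) \<and> ?Q n (f n) (f (Suc n))"
  proof (rule dependent_nat_choice[where P = ?P and Q = ?Q])
    obtain k where "smaller H (sub H x (psum (Suc 0) ((\<lambda>_. 0)(0 := k)))) (unit_seq 0)"
      using step[OF infra_first[OF unit_seq(3)]] by blast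
    then show "\<exists>a. ?P 0 a" by auto
    fix a n assume P: "?P n a"
    have "infra H (sub H x (psum (Suc n) a)) (unit_seq (Suc n))"
      by (rule infra_next[OF sub_closed[OF x psum_closed] unit_seq(1) unit_seq(1) unit_seq(2) unit_seq(4)]) (use P in auto)
    then obtain k where k: "smaller H (sub H x (psum (Suc (Suc n)) (a(Suc n := k)))) (unit_seq (Suc n))"
      using step by blast
    have "psum (Suc m) (a(Suc n := k)) = psum (Suc m) a" if "m \<le> n" for m
      using that by (intro psum_cong) auto
    then have "?P (Suc n) (a(Suc n := k))" using P k by (auto simp: le_Suc_eq)
    then show "\<exists>a'. ?P (Suc n) a' \<and> ?Q n a a'" by (intro exI[of _ "a(Suc n := k)"]) auto
  qed
  then obtain f where f: "\<And>n. ?P n (f n)" "\<And>n. ?Q n (f n) (f (Suc n))" by blast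
  have stable: "f m i = f i i" if "i \<le> m" for i m
    using that
  proof (induction m rule: dec_induct)
    case (step m)
    then show ?case using f(2)[of m] by simp
  qed simp
  have "smaller H (sub H x (psum (Suc n) (\<lambda>i. f i i))) (unit_seq n)" for n
  proof -
    have "psum (Suc n) (\<lambda>i. f i i) = psum (Suc n) (f n)"
      by (rule psum_cong) (simp add: stable[of _ n])
    then show ?thesis using f(1)[of n] by auto
  qed
  then show ?thesis unfolding expands_def by blast
qed

text \<open>The balls around the prospective limit are the trace of the balls around a nonstandard
  partial sum, hence a definable family. The completeness scheme gives a common point.\<close>

lemma expansion_realized: "\<exists>x\<in>Univ H. expands x a"
proof -
  let ?c = "\<lambda>n. psum n a"
  have range_c: "range ?c \<subseteq> Univ H" using psum_closed by auto
  obtain \<phi> b where b: "range b \<subseteq> Univ H" and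
    "\<And>x u. x \<in> Univ H \<Longrightarrow> u \<in> Univ H \<Longrightarrow> sat H (b(0 := x, 1 := u)) \<phi> \<longleftrightarrow>
       (\<forall>\<^sub>F n in uf. sat H ((\<lambda>_. ?c n)(0 := x, 1 := u)) (smallerF (DiffT (Var 0) (Var 2)) (Var 1)))"
    by (rule trace_definable2[OF uf(2) range_c, where \<psi> = "smallerF (DiffT (Var 0) (Var 2)) (Var 1)"]) (rule that)
  then have Y: "sat H (b(0 := x, 1 := u)) \<phi> \<longleftrightarrow> (\<forall>\<^sub>F n in uf. smaller H (sub H x (psum n a)) u)"
    if "x \<in> Univ H" "u \<in> Univ H" for x u
    using that by (simp add: val_DiffT_sub)
  have "\<exists>x\<in>Univ H. \<forall>u\<in>Univ H. unit_elem H u \<longrightarrow> sat H (b(0 := x, 1 := u)) \<phi>"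
  proof (rule complete_definable[OF b, of \<phi>, unfolded complete_def, THEN mp], intro conjI ballI impI; (elim conjE)?)
    fix u assume u: "u \<in> Univ H" "unit_elem H u"
    \<comment> \<open>No unit lies beyond the standard chain, so a standard partial sum belongs to
      the ball at \<open>u\<close>.\<close>
    obtain n where n: "\<not> smaller H u (unit_seq n)" using levels[OF u] by blast
    have "smaller H (sub H (psum (Suc n) a) (psum m a)) u" if "m \<ge> Suc n" for m
      by (rule smaller_mono[OF sub_closed[OF psum_closed psum_closed] unit_seq(1) u(1) unit_seq(2) u(2) n psum_tail]) (use that in auto)
    then have "\<forall>\<^sub>F m in uf. smaller H (sub H (psum (Suc n) a) (psum m a)) u" by (rule eventually_U)
    then show "\<exists>x\<in>Univ H. sat H (b(0 := x, 1 := u)) \<phi>" using Y[OF psum_closed u(1)] psum_closed by blast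
  next
    fix u x y assume *: "u \<in> Univ H" "x \<in> Univ H" "y \<in> Univ H" "unit_elem H u"
      "sat H (b(0 := x, 1 := u)) \<phi>" "sat H (b(0 := y, 1 := u)) \<phi>"
    then have "\<forall>\<^sub>F n in uf. smaller H (sub H x (psum n a)) u" "\<forall>\<^sub>F n in uf. smaller H (sub H y (psum n a)) u"
      using Y by blast+
    then have "\<forall>\<^sub>F n in uf. smaller H (sub H x (psum n a)) u \<and> smaller H (sub H y (psum n a)) u"
      by eventually_elim simp
    then obtain n where "smaller H (sub H x (psum n a)) u" "smaller H (sub H y (psum n a)) u"
      using eventually_U_exists by blast
    then show "smaller H (sub H x y) u" by (rule smaller_sub(1)[OF *(2,3) psum_closed *(1,4)])
  next
    fix u x y assume *: "u \<in> Univ H" "x \<in> Univ H" "y \<in> Univ H" "unit_elem H u"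
      "sat H (b(0 := x, 1 := u)) \<phi>" "smaller H (sub H y x) u"
    then have "\<forall>\<^sub>F n in uf. smaller H (sub H x (psum n a)) u" using Y by blast
    then have "\<forall>\<^sub>F n in uf. smaller H (sub H y (psum n a)) u"
      by (rule eventually_mono) (rule smaller_sub(2)[OF *(2,3) psum_closed *(1,4) _ *(6)])
    then show "sat H (b(0 := y, 1 := u)) \<phi>" using Y * by blast
  next
    fix u x v assume *: "u \<in> Univ H" "x \<in> Univ H" "v \<in> Univ H" "unit_elem H u" "unit_elem H v"
      "\<not> smaller H v u" "sat H (b(0 := x, 1 := u)) \<phi>"
    then have "\<forall>\<^sub>F n in uf. smaller H (sub H x (psum n a)) u" using Y by blast
    then have "\<forall>\<^sub>F n in uf. smaller H (sub H x (psum n a)) v"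
      by (rule eventually_mono) (rule smaller_mono[OF sub_closed[OF *(2) psum_closed] *(1,3,4,5,6)])
    then show "sat H (b(0 := x, 1 := v)) \<phi>" using Y * by blast
  qed
  then obtain x where x: "x \<in> Univ H" and "\<And>u. u \<in> Univ H \<Longrightarrow> unit_elem H u \<Longrightarrow> sat H (b(0 := x, 1 := u)) \<phi>"
    by blast
  then have ev: "\<forall>\<^sub>F m in uf. smaller H (sub H x (psum m a)) (unit_seq n)" for n
    using Y[OF x unit_seq(1)] unit_seq(1,2) by blast
  have "smaller H (sub H x (psum (Suc n) a)) (unit_seq n)" for n
  proof -
    obtain m where m: "m \<ge> Suc n" "smaller H (sub H x (psum m a)) (unit_seq n)"
      using eventually_U_exists[OF ev] by blast
    have "smaller H (sub H (psum (Suc n) a) (psum m a)) (unit_seq n)" using m(1) by (intro psum_tail) auto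
    then show ?thesis by (rule smaller_sub(1)[OF x psum_closed psum_closed unit_seq(1) unit_seq(2) m(2)])
  qed
  then show ?thesis using x unfolding expands_def by blast
qed

lemma expands_less:
  assumes "x \<in> Univ H" "y \<in> Univ H" "expands x a" "expands y b" "lessS G1 a b"
  shows "lessS H x y"
proof -
  obtain n where "\<forall>i<n. a i = b i" "a n < b n" using assms(5) by (auto simp: lessS_G1_iff)
  then show ?thesis using psum_less[OF assms(1,2)] assms(3,4) unfolding expands_def by blast
qed

text \<open>Two different expansions are comparable in \<open>G1\<close>, which would give an
  element less than itself.\<close>

lemma expands_unique:
  assumes "x \<in> Univ H" "expands x a" "expands x b" shows "a = b"
  using lessS_G1_total[of a b] expands_less[OF assms(1,1)] assms less_irrefl_H by blast

text \<open>Equal expansions make the elements agree through all standard positions, and by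
  \<open>levels\<close> there are no others at which they could be separated.\<close>

lemma expands_inj:
  assumes "x \<in> Univ H" "y \<in> Univ H" "expands x a" "expands y a" shows "x = y"
proof (rule ccontr)
  assume "x \<noteq> y"
  then obtain u where u: "u \<in> Univ H" "unit_elem H u" "\<not> smaller H (sub H x y) u"
    using separated assms by blast
  obtain n where n: "\<not> smaller H u (unit_seq n)" using levels[OF u(1,2)] by blast
  have "smaller H (sub H x y) (unit_seq n)"
    by (rule smaller_sub(1)[OF assms(1,2) psum_closed unit_seq(1) unit_seq(2)]) (use assms(3,4) in \<open>auto simp: expands_def\<close>)
  then have "smaller H (sub H x y) u"
    by (rule smaller_mono[OF sub_closed[OF assms(1,2)] unit_seq(1) u(1) unit_seq(2) u(2) n])
  then show False using u(3) by blast
qed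

lemma isomorphic_G1: "isomorphic H G1"
proof -
  define h where "h x = (THE a. expands x a)" for x
  have h: "expands x (h x)" if x: "x \<in> Univ H" for x
  proof -
    obtain a where a: "expands x a" using expansion_exists[OF x] by blast
    show ?thesis unfolding h_def by (rule theI[where P = "expands x", OF a]) (rule expands_unique[OF x _ a])
  qed
  have hI: "h x = a" if "x \<in> Univ H" "expands x a" for x a
    using expands_unique[OF that(1) h[OF that(1)] that(2)] .
  have "bij_betw h (Univ H) (Univ G1)"
    unfolding bij_betw_def
  proof
    show "inj_on h (Univ H)"
    proof (rule inj_onI)
      fix x y assume xy: "x \<in> Univ H" "y \<in> Univ H" "h x = h y"
      show "x = y" by (rule expands_inj[OF xy(1,2) h[OF xy(1)]]) (use h[OF xy(2)] xy(3) in simp)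
    qed
    show "h ` Univ H = Univ G1"
      using expansion_realized hI by (auto simp: image_iff) metis
  qed
  moreover have "h (zeroS H) = zeroS G1"
    by (rule hI[OF closed(1)]) (simp add: expands_def psum_zero)
  moreover have "h (plusS H x y) = plusS G1 (h x) (h y)" if "x \<in> Univ H" "y \<in> Univ H" for x y
    by (rule hI[OF closed(2)[OF that]])
       (use h[OF that(1)] h[OF that(2)] psum_plus[OF that] in \<open>simp add: expands_def\<close>)
  moreover have "h (minusS H x) = minusS G1 (h x)" if "x \<in> Univ H" for x
    by (rule hI[OF closed(3)[OF that]]) (use h[OF that] psum_minus[OF that] in \<open>simp add: expands_def\<close>)
  moreover have "lessS H x y \<longleftrightarrow> lessS G1 (h x) (h y)" if xy: "x \<in> Univ H" "y \<in> Univ H" for x y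
  proof
    show "lessS H x y" if "lessS G1 (h x) (h y)"
      using expands_less[OF xy h[OF xy(1)] h[OF xy(2)] that] .
    show "lessS G1 (h x) (h y)" if less: "lessS H x y"
    proof (rule ccontr)
      assume not: "\<not> lessS G1 (h x) (h y)"
      show False
      proof (cases "h x = h y")
        case True
        have "x = y" by (rule expands_inj[OF xy h[OF xy(1)]]) (use h[OF xy(2)] True in simp)
        then show False using less less_irrefl_H[OF xy(1)] by simp
      next
        case False
        then have "lessS G1 (h y) (h x)" using not lessS_G1_total by blast
        then have "lessS H y x" using expands_less[OF xy(2,1) h[OF xy(2)] h[OF xy(1)]] by blast
        then show False using less_trans_H[OF xy(1,2,1) less] less_irrefl_H[OF xy(1)] by blast
      qed
    qed
  qed
  ultimately have "is_isomorphism H G1 h" unfolding is_isomorphism_def by blast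
  then show ?thesis unfolding isomorphic_def by blast
qed

end

theorem mainTheorem4:
  "stably_embedded TYPE('b) G1 \<and>
   (\<forall>H :: 'a oag_struct.
      is_model H (Th G1) \<and> stably_embedded TYPE(nat \<Rightarrow> 'a) H \<longrightarrow> isomorphic H G1)"
proof (intro conjI allI impI)
  show "stably_embedded TYPE('b) G1" by (rule stably_embedded_G1)
  fix H :: "'a oag_struct"
  assume "is_model H (Th G1) \<and> stably_embedded TYPE(nat \<Rightarrow> 'a) H"
  then interpret stable_model H by unfold_locales auto
  show "isomorphic H G1" by (rule isomorphic_G1)
qed

end
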